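(* Let $\epsilon\in\{-1,1\}$ and let $\overline M^{n+1}=\epsilon I\times_f M^n$ be a semi-Riemannian warped product with conformal vector field $V=(f\circ\pi_I)\partial_t$. Let $\psi:\Sigma^n\to\overline M^{n+1}$ be a Riemannian immersion, with $\Sigma$ oriented by a unit normal vector field $N$ and with shape operator $A$, and put $\eta=\langle V,N\rangle:\Sigma\to\mathbb R$. If $\Sigma$ has constant mean curvature $H$, then on $\Sigma$ $$\Delta\eta=-\epsilon\,\eta\left\{\mathrm{Ric}(N^{\top},N^{\top})+(n-1)(\log f)''\left(1-\langle N,\partial_t\rangle^2\right)+|A|^2\right\}-\epsilon\,nHf',$$ where $\mathrm{Ric}$ denotes the Ricci tensor of $M$, $N^{\top}=(\pi_M)_*N$, and $f'$ and $(\log f)''$ are evaluated at $\pi_I\circ\psi$.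
   Context: $M^n$ is a connected, $n$-dimensional oriented Riemannian manifold, $I\subset\mathbb R$ is an interval and $f:I\to\mathbb R$ is a positive smooth function. $\pi_I$ and $\pi_M$ are the projections of $I\times M^n$ onto $I$ and $M$. The semi-Riemannian warped product $\epsilon I\times_f M^n$ is the manifold $I\times M^n$ with the metric $\langle v,w\rangle=\epsilon\langle(\pi_I)_*v,(\pi_I)_*w\rangle+(f\circ\pi_I)^2\langle(\pi_M)_*v,(\pi_M)_*w\rangle$; it is Riemannian if $\epsilon=1$ and Lorentzian if $\epsilon=-1$. $\partial_t$ is the unit coordinate vector field of the factor $I$, so $\langle\partial_t,\partial_t\rangle=\epsilon$; primes denote derivatives with respect to $t\in I$. A Riemannian immersion $\psi:\Sigma^n\to\overline M^{n+1}$ is an immersion of a connected, orientable $n$-dimensional manifold such that the induced metric on $\Sigma$ is Riemannian. A unit normal field $N$ then satisfies $\langle N,N\rangle=\epsilon$. The shape operator is $AX=-\overline\nabla_XN$, where $\overline\nabla$ is the Levi-Civita connection of $\overline M$; $|A|$ is its Hilbert-Schmidt norm; the mean curvature is $H=\epsilon\,\mathrm{tr}(A)/n$. $\Delta$ is the Laplacian ($\Delta=\mathrm{tr}\,\nabla^2$) of the induced metric on $\Sigma$. *)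

theory Defs
  imports "HOL-Analysis.Analysis"
begin

section \<open>Smooth maps between open subsets of Euclidean spaces\<close>

text \<open>The definitions use two-sided Frechet derivatives and are meant for open sets \<open>S\<close>.\<close>

primrec Ck_on :: "nat \<Rightarrow> 'a::real_normed_vector set \<Rightarrow> ('a \<Rightarrow> 'b::real_normed_vector) \<Rightarrow> bool" where
  "Ck_on 0 S f \<longleftrightarrow> continuous_on S f"
| "Ck_on (Suc k) S f \<longleftrightarrow>
     (\<forall>x\<in>S. f differentiable (at x)) \<and> (\<forall>v. Ck_on k S (\<lambda>x. frechet_derivative f (at x) v))"

definition smooth_on :: "'a::real_normed_vector set \<Rightarrow> ('a \<Rightarrow> 'b::real_normed_vector) \<Rightarrow> bool" where
  "smooth_on S f \<longleftrightarrow> (\<forall>k. Ck_on k S f)"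

definition ltrace :: "('a::euclidean_space \<Rightarrow> 'a) \<Rightarrow> real" where
  "ltrace L = (\<Sum>b\<in>Basis. L b \<bullet> b)"


section \<open>Semi-Riemannian geometry in one coordinate chart\<close>

text \<open>Here \<open>G x u v\<close> is the value at the point \<open>x\<close> of an open subset of the model space \<open>'a\<close>
  of a semi-Riemannian metric, applied to the vectors \<open>u\<close> and \<open>v\<close>.\<close>

text \<open>A connection is \<open>\<nabla>\<^sub>u Y = DY u + \<Gamma> u Y\<close> in a chart.  It is torsion-free iff \<open>\<Gamma>\<close> is symmetric,
  and the last conjunct below is \<open>\<nabla>G = 0\<close>, tested on coordinate vector fields.\<close>

definition levi_civita ::
  "('a::euclidean_space \<Rightarrow> 'a \<Rightarrow> 'a \<Rightarrow> real) \<Rightarrow> 'a \<Rightarrow> 'a \<Rightarrow> 'a \<Rightarrow> 'a" where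
  "levi_civita G x = (THE \<Gamma>. bilinear \<Gamma> \<and> (\<forall>u v. \<Gamma> u v = \<Gamma> v u) \<and>
     (\<forall>w u v. frechet_derivative (\<lambda>y. G y u v) (at x) w = G x (\<Gamma> w u) v + G x u (\<Gamma> w v)))"

definition cov ::
  "('a::euclidean_space \<Rightarrow> 'a \<Rightarrow> 'a \<Rightarrow> real) \<Rightarrow> ('a \<Rightarrow> 'a) \<Rightarrow> 'a \<Rightarrow> 'a \<Rightarrow> 'a" where
  "cov G Y x u = frechet_derivative Y (at x) u + levi_civita G x u (Y x)"

text \<open>\<open>R(u,v)w = \<nabla>\<^sub>u\<nabla>\<^sub>v w - \<nabla>\<^sub>v\<nabla>\<^sub>u w\<close>; the vectors are extended to constant fields of the chart,
  whose Lie brackets vanish.\<close>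

definition curvature ::
  "('a::euclidean_space \<Rightarrow> 'a \<Rightarrow> 'a \<Rightarrow> real) \<Rightarrow> 'a \<Rightarrow> 'a \<Rightarrow> 'a \<Rightarrow> 'a \<Rightarrow> 'a" where
  "curvature G x u v w =
     cov G (\<lambda>y. cov G (\<lambda>_. w) y v) x u - cov G (\<lambda>y. cov G (\<lambda>_. w) y u) x v"

definition local_ricci ::
  "('a::euclidean_space \<Rightarrow> 'a \<Rightarrow> 'a \<Rightarrow> real) \<Rightarrow> 'a \<Rightarrow> 'a \<Rightarrow> 'a \<Rightarrow> real" where
  "local_ricci G x v w = ltrace (\<lambda>u. curvature G x u v w)"

text \<open>\<open>\<nabla>\<^sup>2u (v,w) = v (w u) - (\<nabla>\<^sub>v w) u\<close>, again with constant fields.\<close>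

definition hessian ::
  "('a::euclidean_space \<Rightarrow> 'a \<Rightarrow> 'a \<Rightarrow> real) \<Rightarrow> ('a \<Rightarrow> real) \<Rightarrow> 'a \<Rightarrow> 'a \<Rightarrow> 'a \<Rightarrow> real" where
  "hessian G u x v w =
     frechet_derivative (\<lambda>y. frechet_derivative u (at y) w) (at x) v
     - frechet_derivative u (at x) (cov G (\<lambda>_. w) x v)"

definition metric_trace ::
  "('a::euclidean_space \<Rightarrow> 'a \<Rightarrow> real) \<Rightarrow> ('a \<Rightarrow> 'a \<Rightarrow> real) \<Rightarrow> real" where
  "metric_trace B Q = ltrace (\<lambda>v. THE w. \<forall>z. B w z = Q v z)"

definition local_laplacian ::
  "('a::euclidean_space \<Rightarrow> 'a \<Rightarrow> 'a \<Rightarrow> real) \<Rightarrow> ('a \<Rightarrow> real) \<Rightarrow> 'a \<Rightarrow> real" where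
  "local_laplacian G u x = metric_trace (G x) (hessian G u x)"

definition metric_adjoint ::
  "('a \<Rightarrow> 'a \<Rightarrow> real) \<Rightarrow> ('a \<Rightarrow> 'a) \<Rightarrow> 'a \<Rightarrow> 'a" where
  "metric_adjoint B L = (THE L'. \<forall>u v. B (L u) v = B u (L' v))"

definition nondegenerate :: "('a::euclidean_space \<Rightarrow> 'a \<Rightarrow> real) \<Rightarrow> bool" where
  "nondegenerate B \<longleftrightarrow> (\<forall>u. u \<noteq> 0 \<longrightarrow> (\<exists>v. B u v \<noteq> 0))"

text \<open>The definite descriptions above are well defined: the next two lemmas give the existence and
  uniqueness of metric duals, and of the Levi-Civita connection with \<open>T w u v\<close> in place of the
  derivative of \<open>G x u v\<close> in direction \<open>w\<close>.\<close>

lemma metric_dual_ex1: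
  fixes B :: "'a::euclidean_space \<Rightarrow> 'a \<Rightarrow> real"
  assumes B: "bilinear B" and nd: "nondegenerate B" and \<alpha>: "linear \<alpha>"
  shows "\<exists>!w. \<forall>z. B w z = \<alpha> z"
proof -
  define F where "F w = (\<Sum>b\<in>Basis. B w b *\<^sub>R b)" for w
  have Fb: "F w \<bullet> b = B w b" if "b \<in> Basis" for w b
    using that by (simp add: F_def inner_sum_left_Basis)
  have linl: "linear (\<lambda>w. B w z)" for z
    using B by (simp add: bilinear_def)
  have linr: "linear (B w)" for w
    using B by (simp add: bilinear_def)
  have linF: "linear F"
  proof (rule linearI)
    show "F (x + y) = F x + F y" for x y
      using linear_add[OF linl] by (simp add: F_def scaleR_add_left sum.distrib)
    show "F (r *\<^sub>R x) = r *\<^sub>R F x" for r x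
      using linear_cmul[OF linl] by (simp add: F_def scaleR_sum_right)
  qed
  have char: "(\<forall>z. B w z = \<alpha> z) \<longleftrightarrow> F w = (\<Sum>b\<in>Basis. \<alpha> b *\<^sub>R b)" for w
  proof
    assume "\<forall>z. B w z = \<alpha> z" then show "F w = (\<Sum>b\<in>Basis. \<alpha> b *\<^sub>R b)"
      by (simp add: F_def)
  next
    assume eq: "F w = (\<Sum>b\<in>Basis. \<alpha> b *\<^sub>R b)"
    have "B w b = \<alpha> b" if "b \<in> Basis" for b
      using Fb[OF that, of w] eq that by (simp add: inner_sum_left_Basis)
    then have "B w = \<alpha>"
      using linear_eq_stdbasis[OF linr \<alpha>] by blast
    then show "\<forall>z. B w z = \<alpha> z" by simp
  qed
  have "inj F"
  proof (rule linear_injective_0[OF linF, THEN iffD2], intro allI impI)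
    fix w assume "F w = 0"
    then have "B w b = 0" if "b \<in> Basis" for b
      using Fb[OF that, of w] by simp
    then have "B w = (\<lambda>_. 0)"
      using linear_eq_stdbasis[OF linr linear_zero] by blast
    then show "w = 0"
      using nd by (auto simp: nondegenerate_def)
  qed
  then have "bij F"
    using linF linear_injective_imp_surjective by (auto simp: bij_def)
  then show ?thesis
    unfolding char by (metis bij_pointE)
qed

lemma levi_civita_ex1:
  fixes B :: "'a::euclidean_space \<Rightarrow> 'a \<Rightarrow> real"
  assumes B: "bilinear B" and sym: "\<And>u v. B u v = B v u" and nd: "nondegenerate B"
    and T: "\<And>w. bilinear (T w)" "\<And>u v. linear (\<lambda>w. T w u v)" "\<And>w u v. T w u v = T w v u"
  shows "\<exists>!\<Gamma>. bilinear \<Gamma> \<and> (\<forall>u v. \<Gamma> u v = \<Gamma> v u) \<and>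
           (\<forall>w u v. T w u v = B (\<Gamma> w u) v + B u (\<Gamma> w v))"
proof -
  define K where "K u v w = (T u v w + T v u w - T w u v) / 2" for u v w
  have T1: "T (a + b) u v = T a u v + T b u v" "T (r *\<^sub>R a) u v = r * T a u v" for a b u v r
    using linear_add[OF T(2)] linear_cmul[OF T(2)] by auto
  note T2 = bilinear_ladd[OF T(1)] bilinear_radd[OF T(1)] bilinear_lmul[OF T(1)] bilinear_rmul[OF T(1)]
  have linK: "linear (K u v)" for u v
    by (rule linearI) (simp_all add: K_def T1 T2 field_simps)
  have ex: "\<exists>!w. \<forall>z. B w z = K u v z" for u v
    by (rule metric_dual_ex1[OF B nd linK])
  define \<Gamma> where "\<Gamma> u v = (THE w. \<forall>z. B w z = K u v z)" for u v
  have \<Gamma>: "B (\<Gamma> u v) z = K u v z" for u v z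
    using theI'[OF ex[of u v]] by (simp add: \<Gamma>_def)
  have uniq: "a = b" if "\<And>z. B a z = B b z" for a b
  proof -
    have "B (a - b) z = 0" for z
      using that by (simp add: bilinear_lsub[OF B])
    then show ?thesis using nd by (auto simp: nondegenerate_def dest: spec[of _ "a - b"])
  qed
  note Bs = bilinear_ladd[OF B] bilinear_lmul[OF B]
  have Gb: "bilinear \<Gamma>"
    unfolding bilinear_def
  proof (intro conjI allI linearI; rule uniq)
  qed (simp_all add: \<Gamma> Bs, simp_all add: K_def T1 T2 field_simps)
  have Gs: "\<Gamma> u v = \<Gamma> v u" for u v
    by (rule uniq) (simp add: \<Gamma> K_def T(3)[of _ u v])
  have Gm: "T w u v = B (\<Gamma> w u) v + B u (\<Gamma> w v)" for w u v
    using T(3) by (simp add: sym[of u] \<Gamma> K_def field_simps)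
  show ?thesis
  proof (rule ex1I[of _ \<Gamma>])
    show "bilinear \<Gamma> \<and> (\<forall>u v. \<Gamma> u v = \<Gamma> v u) \<and> (\<forall>w u v. T w u v = B (\<Gamma> w u) v + B u (\<Gamma> w v))"
      using Gb Gs Gm by blast
  next
    fix \<Gamma>'
    assume *: "bilinear \<Gamma>' \<and> (\<forall>u v. \<Gamma>' u v = \<Gamma>' v u) \<and>
                 (\<forall>w u v. T w u v = B (\<Gamma>' w u) v + B u (\<Gamma>' w v))"
    have "\<Gamma>' u v = \<Gamma> u v" for u v
    proof (rule uniq)
      fix z
      have "K u v z = B (\<Gamma>' u v) z"
      proof -
        have a: "T u v z = B (\<Gamma>' u v) z + B v (\<Gamma>' u z)"
          "T v u z = B (\<Gamma>' v u) z + B u (\<Gamma>' v z)"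
          "T z u v = B (\<Gamma>' z u) v + B u (\<Gamma>' z v)" using * by blast+
        have b: "\<Gamma>' v u = \<Gamma>' u v" "\<Gamma>' z u = \<Gamma>' u z" "\<Gamma>' z v = \<Gamma>' v z" using * by blast+
        show ?thesis unfolding K_def a b sym[of v "\<Gamma>' u z"] by simp
      qed
      then show "B (\<Gamma>' u v) z = B (\<Gamma> u v) z" by (simp add: \<Gamma>)
    qed
    then show "\<Gamma>' = \<Gamma>" by blast
  qed
qed


section \<open>Smooth manifolds\<close>

text \<open>A chart is a coordinate domain with a coordinate map.  The model space is a Euclidean space
  \<open>'a\<close>, so that the manifold has dimension \<open>DIM('a)\<close>.\<close>

type_synonym ('m, 'a) chart = "'m set \<times> ('m \<Rightarrow> 'a)"

record ('m, 'a) manifold =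
  mtop :: "'m topology"
  atlas :: "('m, 'a) chart set"

abbreviation points :: "('m, 'a) manifold \<Rightarrow> 'm set" where
  "points M \<equiv> topspace (mtop M)"

definition chart_inv :: "('m, 'a) chart \<Rightarrow> 'a \<Rightarrow> 'm" where
  "chart_inv c = inv_into (fst c) (snd c)"

definition charts_at :: "('m, 'a) manifold \<Rightarrow> 'm \<Rightarrow> ('m, 'a) chart set" where
  "charts_at M p = {c \<in> atlas M. p \<in> fst c}"

text \<open>An arbitrary chart around \<open>p\<close>; everything below defined with it does not depend on the choice.\<close>

definition chart_at :: "('m, 'a) manifold \<Rightarrow> 'm \<Rightarrow> ('m, 'a) chart" where
  "chart_at M p = (SOME c. c \<in> charts_at M p)"

definition smooth_manifold :: "('m, 'a::euclidean_space) manifold \<Rightarrow> bool" where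
  "smooth_manifold M \<longleftrightarrow>
     Hausdorff_space (mtop M) \<and> second_countable (mtop M) \<and>
     \<Union>(fst ` atlas M) = points M \<and>
     (\<forall>c\<in>atlas M. openin (mtop M) (fst c) \<and> open (snd c ` fst c) \<and>
        homeomorphic_map (subtopology (mtop M) (fst c)) (top_of_set (snd c ` fst c)) (snd c)) \<and>
     (\<forall>c\<in>atlas M. \<forall>d\<in>atlas M. smooth_on (snd c ` (fst c \<inter> fst d)) (snd d \<circ> chart_inv c))"

definition product_manifold ::
  "('m, 'a) manifold \<Rightarrow> ('k, 'b) manifold \<Rightarrow> ('m \<times> 'k, 'a \<times> 'b) manifold" where
  "product_manifold M K = \<lparr>mtop = prod_topology (mtop M) (mtop K),
     atlas = {(fst c \<times> fst d, map_prod (snd c) (snd d)) | c d. c \<in> atlas M \<and> d \<in> atlas K}\<rparr>"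

definition interval_manifold :: "real set \<Rightarrow> (real, real) manifold" where
  "interval_manifold I = \<lparr>mtop = top_of_set I, atlas = {(I, \<lambda>t. t)}\<rparr>"

text \<open>\<open>Q\<close> is an orientation of \<open>M\<close>, given as an oriented atlas of the smooth structure of \<open>M\<close>.\<close>

definition orientation_of ::
  "('m, real^'n) manifold \<Rightarrow> ('m, real^'n) chart set \<Rightarrow> bool" where
  "orientation_of M Q \<longleftrightarrow>
     smooth_manifold (M\<lparr>atlas := Q\<rparr>) \<and> smooth_manifold (M\<lparr>atlas := atlas M \<union> Q\<rparr>) \<and>
     (\<forall>c\<in>Q. \<forall>d\<in>Q. \<forall>p\<in>fst c \<inter> fst d.
        det (matrix (frechet_derivative (snd d \<circ> chart_inv c) (at (snd c p)))) > 0)"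

definition orientable :: "('m, real^'n) manifold \<Rightarrow> bool" where
  "orientable M \<longleftrightarrow> (\<exists>Q. orientation_of M Q)"


section \<open>Tangent vectors and smooth maps\<close>

text \<open>A tangent vector at \<open>p\<close> assigns to every chart around \<open>p\<close> a component vector, with components
  related by the derivatives of the transition maps.  The value is \<open>0\<close> on all other charts, so that
  equal tangent vectors are equal functions.\<close>

type_synonym ('m, 'a) tangent = "('m, 'a) chart \<Rightarrow> 'a"

definition tangent_space ::
  "('m, 'a::euclidean_space) manifold \<Rightarrow> 'm \<Rightarrow> ('m, 'a) tangent set" where
  "tangent_space M p = {v.
     (\<forall>c\<in>charts_at M p. \<forall>d\<in>charts_at M p.
        v d = frechet_derivative (snd d \<circ> chart_inv c) (at (snd c p)) (v c)) \<and>
     (\<forall>c. c \<notin> charts_at M p \<longrightarrow> v c = 0)}"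

text \<open>The tangent vector at \<open>p\<close> with component vector \<open>u\<close> in the chart \<open>c\<close>.\<close>

definition tangent_of ::
  "('m, 'a::euclidean_space) manifold \<Rightarrow> ('m, 'a) chart \<Rightarrow> 'm \<Rightarrow> 'a \<Rightarrow> ('m, 'a) tangent" where
  "tangent_of M c p u =
     (\<lambda>d. if d \<in> charts_at M p then frechet_derivative (snd d \<circ> chart_inv c) (at (snd c p)) u else 0)"

definition smooth_map ::
  "('s, 'a::euclidean_space) manifold \<Rightarrow> ('m, 'b::euclidean_space) manifold \<Rightarrow> ('s \<Rightarrow> 'm) \<Rightarrow> bool"
  where
  "smooth_map S M \<psi> \<longleftrightarrow> continuous_map (mtop S) (mtop M) \<psi> \<and>
     (\<forall>c\<in>atlas S. \<forall>d\<in>atlas M.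
        smooth_on (snd c ` (fst c \<inter> \<psi> -` fst d)) (snd d \<circ> \<psi> \<circ> chart_inv c))"

definition pushforward ::
  "('s, 'a::euclidean_space) manifold \<Rightarrow> ('m, 'b::euclidean_space) manifold \<Rightarrow> ('s \<Rightarrow> 'm) \<Rightarrow>
   's \<Rightarrow> ('s, 'a) tangent \<Rightarrow> ('m, 'b) tangent" where
  "pushforward S M \<psi> p v = (let c = chart_at S p in
     (\<lambda>d. if d \<in> charts_at M (\<psi> p)
          then frechet_derivative (snd d \<circ> \<psi> \<circ> chart_inv c) (at (snd c p)) (v c) else 0))"

definition immersion ::
  "('s, 'a::euclidean_space) manifold \<Rightarrow> ('m, 'b::euclidean_space) manifold \<Rightarrow> ('s \<Rightarrow> 'm) \<Rightarrow> bool"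
  where
  "immersion S M \<psi> \<longleftrightarrow> smooth_map S M \<psi> \<and>
     (\<forall>p\<in>points S. inj_on (pushforward S M \<psi> p) (tangent_space S p))"

definition smooth_field_along ::
  "('s, 'a::euclidean_space) manifold \<Rightarrow> ('m, 'b::euclidean_space) manifold \<Rightarrow> ('s \<Rightarrow> 'm) \<Rightarrow>
   ('s \<Rightarrow> ('m, 'b) tangent) \<Rightarrow> bool" where
  "smooth_field_along S M \<psi> Y \<longleftrightarrow> (\<forall>p\<in>points S. Y p \<in> tangent_space M (\<psi> p)) \<and>
     (\<forall>c\<in>atlas S. \<forall>d\<in>atlas M.
        smooth_on (snd c ` (fst c \<inter> \<psi> -` fst d)) (\<lambda>x. Y (chart_inv c x) d))"


section \<open>Semi-Riemannian metrics\<close>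

text \<open>Only the values \<open>g p v w\<close> for \<open>v\<close> and \<open>w\<close> in the tangent space at \<open>p\<close> are relevant.\<close>

type_synonym ('m, 'a) metric = "'m \<Rightarrow> ('m, 'a) tangent \<Rightarrow> ('m, 'a) tangent \<Rightarrow> real"

definition local_metric ::
  "('m, 'a::euclidean_space) manifold \<Rightarrow> ('m, 'a) metric \<Rightarrow> ('m, 'a) chart \<Rightarrow>
   'a \<Rightarrow> 'a \<Rightarrow> 'a \<Rightarrow> real" where
  "local_metric M g c x u v = (let p = chart_inv c x in g p (tangent_of M c p u) (tangent_of M c p v))"

definition riemannian_metric ::
  "('m, 'a::euclidean_space) manifold \<Rightarrow> ('m, 'a) metric \<Rightarrow> bool" where
  "riemannian_metric M g \<longleftrightarrow> (\<forall>c\<in>atlas M.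
     (\<forall>u v. smooth_on (snd c ` fst c) (\<lambda>x. local_metric M g c x u v)) \<and>
     (\<forall>x\<in>snd c ` fst c. bilinear (local_metric M g c x) \<and>
        (\<forall>u v. local_metric M g c x u v = local_metric M g c x v u) \<and>
        (\<forall>u. u \<noteq> 0 \<longrightarrow> local_metric M g c x u u > 0)))"

definition induced_metric ::
  "('s, 'a::euclidean_space) manifold \<Rightarrow> ('m, 'b::euclidean_space) manifold \<Rightarrow> ('m, 'b) metric \<Rightarrow>
   ('s \<Rightarrow> 'm) \<Rightarrow> ('s, 'a) metric" where
  "induced_metric S M g \<psi> p v w = g (\<psi> p) (pushforward S M \<psi> p v) (pushforward S M \<psi> p w)"

definition ricci ::
  "('m, 'a::euclidean_space) manifold \<Rightarrow> ('m, 'a) metric \<Rightarrow> 'm \<Rightarrow>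
   ('m, 'a) tangent \<Rightarrow> ('m, 'a) tangent \<Rightarrow> real" where
  "ricci M g p v w = (let c = chart_at M p in
     local_ricci (local_metric M g c) (snd c p) (v c) (w c))"

definition laplacian ::
  "('m, 'a::euclidean_space) manifold \<Rightarrow> ('m, 'a) metric \<Rightarrow> ('m \<Rightarrow> real) \<Rightarrow> 'm \<Rightarrow> real" where
  "laplacian M g u p = (let c = chart_at M p in
     local_laplacian (local_metric M g c) (u \<circ> chart_inv c) (snd c p))"

text \<open>The covariant derivative \<open>\<nabla>\<^sub>v Y\<close> of a vector field \<open>Y\<close> along \<open>\<psi>\<close>, for the Levi-Civita
  connection of \<open>(M, g)\<close> and a vector \<open>v\<close> tangent to \<open>S\<close> at \<open>p\<close>.\<close>

definition nabla_along ::
  "('s, 'a::euclidean_space) manifold \<Rightarrow> ('m, 'b::euclidean_space) manifold \<Rightarrow> ('m, 'b) metric \<Rightarrow>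
   ('s \<Rightarrow> 'm) \<Rightarrow> ('s \<Rightarrow> ('m, 'b) tangent) \<Rightarrow> 's \<Rightarrow> ('s, 'a) tangent \<Rightarrow> ('m, 'b) tangent" where
  "nabla_along S M g \<psi> Y p v = (let c = chart_at S p; d = chart_at M (\<psi> p); x = snd c p in
     tangent_of M d (\<psi> p)
       (frechet_derivative (\<lambda>y. Y (chart_inv c y) d) (at x) (v c) +
        levi_civita (local_metric M g d) (snd d (\<psi> p))
          (frechet_derivative (snd d \<circ> \<psi> \<circ> chart_inv c) (at x) (v c)) (Y p d)))"


section \<open>Riemannian immersions of codimension one\<close>

definition riemannian_immersion ::
  "('s, real^'n) manifold \<Rightarrow> ('m, 'b::euclidean_space) manifold \<Rightarrow> ('m, 'b) metric \<Rightarrow>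
   ('s \<Rightarrow> 'm) \<Rightarrow> bool" where
  "riemannian_immersion S M g \<psi> \<longleftrightarrow>
     smooth_manifold S \<and> connected_space (mtop S) \<and> orientable S \<and>
     immersion S M \<psi> \<and> riemannian_metric S (induced_metric S M g \<psi>)"

definition unit_normal ::
  "('s, 'a::euclidean_space) manifold \<Rightarrow> ('m, 'b::euclidean_space) manifold \<Rightarrow> ('m, 'b) metric \<Rightarrow>
   ('s \<Rightarrow> 'm) \<Rightarrow> ('s \<Rightarrow> ('m, 'b) tangent) \<Rightarrow> bool" where
  "unit_normal S M g \<psi> N \<longleftrightarrow> smooth_field_along S M \<psi> N \<and>
     (\<forall>p\<in>points S. \<bar>g (\<psi> p) (N p) (N p)\<bar> = 1 \<and>
        (\<forall>v\<in>tangent_space S p. g (\<psi> p) (N p) (pushforward S M \<psi> p v) = 0))"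

text \<open>\<open>A X = -\<nabla>\<^sub>X N\<close>, where the tangent vectors \<open>w\<close> of \<open>S\<close> are identified with their images
  under the differential of \<open>\<psi>\<close>.\<close>

definition shape_operator ::
  "('s, 'a::euclidean_space) manifold \<Rightarrow> ('m, 'b::euclidean_space) manifold \<Rightarrow> ('m, 'b) metric \<Rightarrow>
   ('s \<Rightarrow> 'm) \<Rightarrow> ('s \<Rightarrow> ('m, 'b) tangent) \<Rightarrow> 's \<Rightarrow> ('s, 'a) tangent \<Rightarrow> ('s, 'a) tangent" where
  "shape_operator S M g \<psi> N p v = (THE w. w \<in> tangent_space S p \<and>
     pushforward S M \<psi> p w = (\<lambda>d. - nabla_along S M g \<psi> N p v d))"

definition in_chart ::
  "('s, 'a::euclidean_space) manifold \<Rightarrow> ('s, 'a) chart \<Rightarrow> 's \<Rightarrow>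
   (('s, 'a) tangent \<Rightarrow> ('s, 'a) tangent) \<Rightarrow> 'a \<Rightarrow> 'a" where
  "in_chart S c p L u = L (tangent_of S c p u) c"

definition tangent_trace ::
  "('s, 'a::euclidean_space) manifold \<Rightarrow> 's \<Rightarrow> (('s, 'a) tangent \<Rightarrow> ('s, 'a) tangent) \<Rightarrow> real" where
  "tangent_trace S p L = ltrace (in_chart S (chart_at S p) p L)"

text \<open>The Hilbert-Schmidt norm \<open>|L| = sqrt (tr (L\<^sup>* L))\<close> for the inner product \<open>h p\<close>.\<close>

definition hs_norm ::
  "('s, 'a::euclidean_space) manifold \<Rightarrow> ('s, 'a) metric \<Rightarrow> 's \<Rightarrow>
   (('s, 'a) tangent \<Rightarrow> ('s, 'a) tangent) \<Rightarrow> real" where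
  "hs_norm S h p L = (let c = chart_at S p; K = in_chart S c p L in
     sqrt (ltrace (metric_adjoint (local_metric S h c (snd c p)) K \<circ> K)))"

definition mean_curvature ::
  "real \<Rightarrow> ('s, real^'n) manifold \<Rightarrow> ('m, 'b::euclidean_space) manifold \<Rightarrow> ('m, 'b) metric \<Rightarrow>
   ('s \<Rightarrow> 'm) \<Rightarrow> ('s \<Rightarrow> ('m, 'b) tangent) \<Rightarrow> 's \<Rightarrow> real" where
  "mean_curvature \<epsilon> S M g \<psi> N p = \<epsilon> * tangent_trace S p (shape_operator S M g \<psi> N p) / real CARD('n)"


section \<open>Semi-Riemannian warped products\<close>

abbreviation warped :: "real set \<Rightarrow> ('m, 'a) manifold \<Rightarrow> (real \<times> 'm, real \<times> 'a) manifold" where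
  "warped I M \<equiv> product_manifold (interval_manifold I) M"

definition interval_metric :: "real set \<Rightarrow> (real, real) metric" where
  "interval_metric I t v w = v (I, \<lambda>s. s) * w (I, \<lambda>s. s)"

definition warped_metric ::
  "real \<Rightarrow> real set \<Rightarrow> (real \<Rightarrow> real) \<Rightarrow> ('m, 'a::euclidean_space) manifold \<Rightarrow> ('m, 'a) metric \<Rightarrow>
   (real \<times> 'm, real \<times> 'a) metric" where
  "warped_metric \<epsilon> I f M g q v w =
     \<epsilon> * interval_metric I (fst q) (pushforward (warped I M) (interval_manifold I) fst q v)
                                  (pushforward (warped I M) (interval_manifold I) fst q w)
     + (f (fst q))\<^sup>2 * g (snd q) (pushforward (warped I M) M snd q v)
                                (pushforward (warped I M) M snd q w)"

text \<open>\<open>\<partial>\<^sub>t\<close> at \<open>(t, p)\<close> is the velocity of the curve \<open>s \<mapsto> (s, p)\<close> at \<open>s = t\<close>.\<close>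

definition dt_field ::
  "real set \<Rightarrow> ('m, 'a::euclidean_space) manifold \<Rightarrow> real \<times> 'm \<Rightarrow>
   (real \<times> 'm, real \<times> 'a) tangent" where
  "dt_field I M q = pushforward (interval_manifold I) (warped I M) (\<lambda>s. (s, snd q)) (fst q)
     (tangent_of (interval_manifold I) (I, \<lambda>s. s) (fst q) 1)"

definition conformal_field ::
  "real set \<Rightarrow> (real \<Rightarrow> real) \<Rightarrow> ('m, 'a::euclidean_space) manifold \<Rightarrow> real \<times> 'm \<Rightarrow>
   (real \<times> 'm, real \<times> 'a) tangent" where
  "conformal_field I f M q = (\<lambda>d. f (fst q) *\<^sub>R dt_field I M q d)"

end

theory Submission
  imports Defs
begin

text \<open>Since \<open>\<nabla>\<^bsub>X\<^esub>V = f' X\<close>, the gradient of \<open>\<eta>\<close> is \<open>- A(V\<^sup>T)\<close>.  Taking the divergence produces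
  \<open>- f' tr A - \<epsilon> \<eta> |A|\<^sup>2\<close> from \<open>\<nabla>V\<^sup>T\<close> and, by the Codazzi equation,
  \<open>- V\<^sup>T(tr A) + Ric(V\<^sup>T, N)\<close> from \<open>div A\<close>, where \<open>Ric\<close> is the Ricci tensor of the ambient space.
  The first of these vanishes for constant mean curvature, the second is \<open>Ric(V, N) - \<epsilon> \<eta> Ric(N, N)\<close>,
  and both terms are read off from the curvature of the warped product.

  All of this is done in a pair of charts, with the ambient connection given by its Christoffel
  symbols.  The shape operator is defined with an arbitrary chart at each point, whereas \<open>tr A\<close> has
  to be differentiated in a fixed one, so the covariant derivative of \<open>N\<close> must be shown to be
  independent of the charts.\<close>


section \<open>Calculus\<close>

text \<open>The shape operator and the Levi-Civita connection are given by definite descriptions, so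
  there is no formula to differentiate. Both are determined by their products with all vectors; they
  solve linear systems with differentiable coefficients, and this yields their derivatives. Traces
  are taken of endomorphisms in coordinates, and \<open>ltrace_commute\<close> replaces adapted
  frames: it gives independence of the chart and removes the connection terms from the trace of the
  covariant derivative of A. The Codazzi equation yields a curvature trace over the tangent space of
  the hypersurface only; the slot missing from the ambient Ricci tensor is R(N, Z)N paired with N,
  which vanishes by skew-symmetry. A unit normal is only required to satisfy |<N, N>| = 1; the sign
  \<epsilon> is forced by the signatures of the two metrics. At the end, with s the square of <N,
  dt>, Ric(V, N) and the dt-part of Ric(N, N) contribute n f''/f times 1 - s, and the fibre part of
  Ric(N, N) takes away f''/f + (n - 1)(f'/f)^2 times the same factor. What remains is (n - 1)(log
  f)''(1 - s).\<close>

abbreviation fd :: "('a::real_normed_vector \<Rightarrow> 'b::real_normed_vector) \<Rightarrow> 'a \<Rightarrow> 'a \<Rightarrow> 'b" where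
  "fd f x \<equiv> frechet_derivative f (at x)"

lemma fd_eq: "(f has_derivative f') (at x) \<Longrightarrow> fd f x = f'"
  using frechet_derivative_at by metis

lemma fd_has: "f differentiable (at x) \<Longrightarrow> (f has_derivative fd f x) (at x)"
  by (simp add: frechet_derivative_works)

lemma linear_fd: "f differentiable (at x) \<Longrightarrow> linear (fd f x)"
  using fd_has has_derivative_linear by blast

text \<open>\<open>frechet_derivative\<close> is a choice among all derivatives, and functions that
  agree near the point have the same ones. The equality therefore covers the arbitrary value at
  points without a derivative as well.\<close>

lemma fd_cong_open:
  assumes "open S" "x \<in> S" "\<And>y. y \<in> S \<Longrightarrow> f y = g y"
  shows "fd f x = fd g x"
proof -
  have "(f has_derivative D) (at x) \<longleftrightarrow> (g has_derivative D) (at x)" for D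
    using has_derivative_transform_within_open[OF _ assms(1,2)] assms(3) by metis
  then show ?thesis by (simp add: frechet_derivative_def)
qed

lemma differentiable_cong_open:
  assumes "f differentiable (at x)" "open S" "x \<in> S" "\<And>y. y \<in> S \<Longrightarrow> f y = g y"
  shows "g differentiable (at x)"
  using has_derivative_transform_within_open[OF fd_has[OF assms(1)] assms(2,3,4)]
  by (rule differentiableI)

lemma fd_chain:
  assumes "f differentiable (at x)" "g differentiable (at (f x))"
  shows "fd (\<lambda>y. g (f y)) x u = fd g (f x) (fd f x u)"
  using fd_eq[OF diff_chain_at[OF fd_has[OF assms(1)] fd_has[OF assms(2)]]]
  by (simp add: o_def)

lemma smooth_on_differentiable: "smooth_on S f \<Longrightarrow> x \<in> S \<Longrightarrow> f differentiable (at x)"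
  by (metis smooth_on_def Ck_on.simps(2))

lemma smooth_on_fd: "smooth_on S f \<Longrightarrow> smooth_on S (\<lambda>x. fd f x v)"
  by (metis smooth_on_def Ck_on.simps(2))

text \<open>The quotient is symmetric in u and v, but its limit is computed from the u-derivative
  alone. Exchanging the roles of u and v then gives the symmetry of second derivatives.\<close>

lemma second_difference_limit:
  fixes f :: "'a::real_normed_vector \<Rightarrow> real"
  assumes S: "open S" "x \<in> S" and f: "\<And>y. y \<in> S \<Longrightarrow> f differentiable (at y)"
    and g: "((\<lambda>y. fd f y u) has_derivative g') (at x)"
  shows "((\<lambda>s. (f (x + s *\<^sub>R u + s *\<^sub>R v) - f (x + s *\<^sub>R u) - f (x + s *\<^sub>R v) + f x) / s\<^sup>2)
           \<longlongrightarrow> g' v) (at_right 0)"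
proof (rule LIM_zero_cancel, rule tendstoI)
  fix e :: real assume e: "e > 0"
  \<comment> \<open>The summand 1 keeps c positive when u and v are both zero and makes the final
    estimate strict. The factor 2 in \<open>e'\<close> pays for the two points at which the linear
    approximation is used.\<close>
  define c where "c = norm u + norm v + 1"
  have c: "c > 0" using norm_ge_zero[of u] norm_ge_zero[of v] unfolding c_def by linarith
  define e' where "e' = e / (2 * c)"
  have e': "e' > 0" using e c by (simp add: e'_def)
  interpret g': bounded_linear g' using g by (rule has_derivative_bounded_linear)
  obtain d1 where d1: "d1 > 0" "ball x d1 \<subseteq> S" using S openE by blast
  obtain d2 where d2: "d2 > 0"
    "\<And>y. norm (y - x) < d2 \<Longrightarrow> norm (fd f y u - fd f x u - g' (y - x)) \<le> e' * norm (y - x)"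
    using g e' unfolding has_derivative_at_alt by blast
  define d where "d = min d1 d2 / c"
  have d: "d > 0" using d1 d2 c by (simp add: d_def)
  have "norm ((f (x + s *\<^sub>R u + s *\<^sub>R v) - f (x + s *\<^sub>R u) - f (x + s *\<^sub>R v) + f x) / s\<^sup>2 - g' v) < e"
    if s: "0 < s" "s < d" for s
  proof -
    have bnd: "norm (r *\<^sub>R u + q *\<^sub>R v) \<le> s * (norm u + norm v)"
      if "0 \<le> r" "r \<le> s" "0 \<le> q" "q \<le> s" for r q
    proof -
      have "norm (r *\<^sub>R u + q *\<^sub>R v) \<le> r * norm u + q * norm v"
        using norm_triangle_ineq[of "r *\<^sub>R u" "q *\<^sub>R v"] that by simp
      also have "\<dots> \<le> s * norm u + s * norm v"
        using that by (intro add_mono mult_right_mono) auto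
      finally show ?thesis by (simp add: algebra_simps)
    qed
    have sc: "s * c < min d1 d2" using s c by (simp add: d_def pos_less_divide_eq)
    have "s * (norm u + norm v) \<le> s * c"
      using s by (intro mult_left_mono) (auto simp: c_def)
    then have small: "s * (norm u + norm v) < min d1 d2" using sc by linarith
    have inS: "x + r *\<^sub>R u + q *\<^sub>R v \<in> S"
      if "0 \<le> r" "r \<le> s" "0 \<le> q" "q \<le> s" for r q
    proof -
      have "x - (x + r *\<^sub>R u + q *\<^sub>R v) = - (r *\<^sub>R u + q *\<^sub>R v)" by simp
      then have "dist x (x + r *\<^sub>R u + q *\<^sub>R v) = norm (r *\<^sub>R u + q *\<^sub>R v)"
        by (simp only: dist_norm norm_minus_cancel)
      then have "dist x (x + r *\<^sub>R u + q *\<^sub>R v) < d1"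
        using bnd[OF that] small by linarith
      then show ?thesis using d1 by auto
    qed
    \<comment> \<open>The increment in direction v, as a function of the displacement r in direction
      u. The mean value theorem turns the second difference into s times a difference of
      u-derivatives at two nearby points, to which differentiability at x applies.\<close>
    define F where "F r = f (x + r *\<^sub>R u + s *\<^sub>R v) - f (x + r *\<^sub>R u)" for r
    have Fd: "(F has_derivative (\<lambda>h. h * (fd f (x + r *\<^sub>R u + s *\<^sub>R v) u - fd f (x + r *\<^sub>R u) u))) (at r)"
      if r: "0 \<le> r" "r \<le> s" for r
    proof -
      have 1: "((\<lambda>r. f (x + r *\<^sub>R u + q *\<^sub>R v)) has_derivative (\<lambda>h. h * fd f (x + r *\<^sub>R u + q *\<^sub>R v) u)) (at r)"
        if "0 \<le> q" "q \<le> s" for q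
      proof -
        have D: "f differentiable (at (x + r *\<^sub>R u + q *\<^sub>R v))" using inS r that f by auto
        have "((\<lambda>r. x + r *\<^sub>R u + q *\<^sub>R v) has_derivative (\<lambda>h. h *\<^sub>R u)) (at r)"
          by (auto intro!: derivative_eq_intros)
        from diff_chain_at[OF this fd_has[OF D]]
        show ?thesis using linear_cmul[OF linear_fd[OF D]] by (simp add: o_def)
      qed
      show ?thesis unfolding F_def
        using has_derivative_diff[OF 1[of s] 1[of 0]] s by (simp add: right_diff_distrib)
    qed
    obtain r where r: "0 < r" "r < s"
      and rF: "F s - F 0 = s * (fd f (x + r *\<^sub>R u + s *\<^sub>R v) u - fd f (x + r *\<^sub>R u) u)"
    proof -
      have "\<exists>r\<in>{0<..<s}. F s - F 0 = (s - 0) * (fd f (x + r *\<^sub>R u + s *\<^sub>R v) u - fd f (x + r *\<^sub>R u) u)"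
        by (rule mvt_simple[OF s(1), of F "\<lambda>r h. h * (fd f (x + r *\<^sub>R u + s *\<^sub>R v) u - fd f (x + r *\<^sub>R u) u)"])
          (rule has_derivative_at_withinI[OF Fd])
      then show ?thesis using that by auto
    qed
    let ?a = "r *\<^sub>R u + s *\<^sub>R v" and ?b = "r *\<^sub>R u"
    have na: "norm ?a \<le> s * (norm u + norm v)" and nb: "norm ?b \<le> s * (norm u + norm v)"
      using bnd[of r s] bnd[of r 0] r s by auto
    have d2': "norm (fd f (x + z) u - fd f x u - g' z) \<le> e' * (s * (norm u + norm v))"
      if z: "norm z \<le> s * (norm u + norm v)" for z
    proof -
      have "norm (fd f (x + z) u - fd f x u - g' z) \<le> e' * norm z"
        using d2(2)[of "x + z"] z small by simp
      also have "\<dots> \<le> e' * (s * (norm u + norm v))" using z e' by (intro mult_left_mono) auto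
      finally show ?thesis .
    qed
    have A: "norm (fd f (x + ?a) u - fd f x u - g' ?a) \<le> e' * (s * (norm u + norm v))"
      by (rule d2'[OF na])
    have B: "norm (fd f (x + ?b) u - fd f x u - g' ?b) \<le> e' * (s * (norm u + norm v))"
      by (rule d2'[OF nb])
    have ab: "g' ?a - g' ?b = s * g' v" by (simp add: g'.add g'.scaleR)
    have "\<bar>(F s - F 0) / s - s * g' v\<bar> \<le> 2 * (e' * (s * (norm u + norm v)))"
    proof -
      have "(F s - F 0) / s = fd f (x + ?a) u - fd f (x + ?b) u"
        using rF s by (simp add: add.assoc)
      then show ?thesis using A B ab unfolding real_norm_def by linarith
    qed
    also have "\<dots> = s * (e' * (2 * (norm u + norm v)))" by simp
    also have "\<dots> < s * e"
    proof -
      have "e' * (2 * (norm u + norm v)) < e' * (2 * c)"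
        using e' norm_ge_zero[of u] norm_ge_zero[of v] unfolding c_def
        by (intro mult_strict_left_mono) linarith+
      moreover have "e' * (2 * c) = e" using c by (simp add: e'_def)
      ultimately show ?thesis using s by (simp only: mult_strict_left_mono)
    qed
    finally have *: "\<bar>(F s - F 0) / s - s * g' v\<bar> < s * e" .
    have "(F s - F 0) / s\<^sup>2 - g' v = ((F s - F 0) / s - s * g' v) / s"
      using s by (simp add: field_simps power2_eq_square)
    then have "\<bar>(F s - F 0) / s\<^sup>2 - g' v\<bar> = \<bar>(F s - F 0) / s - s * g' v\<bar> / s"
      using s by simp
    also have "\<dots> < e" using * s by (simp add: pos_divide_less_eq mult.commute)
    finally have "\<bar>(F s - F 0) / s\<^sup>2 - g' v\<bar> < e" .
    moreover have "F s - F 0 = f (x + s *\<^sub>R u + s *\<^sub>R v) - f (x + s *\<^sub>R u) - f (x + s *\<^sub>R v) + f x"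
      by (simp add: F_def)
    ultimately show ?thesis by (simp only: real_norm_def)
  qed
  then have "\<forall>s>0. s < d \<longrightarrow> dist ((f (x + s *\<^sub>R u + s *\<^sub>R v) - f (x + s *\<^sub>R u) - f (x + s *\<^sub>R v) + f x) / s\<^sup>2 - g' v) 0 < e"
    by simp
  then show "\<forall>\<^sub>F s in at_right 0. dist ((f (x + s *\<^sub>R u + s *\<^sub>R v) - f (x + s *\<^sub>R u) - f (x + s *\<^sub>R v) + f x) / s\<^sup>2 - g' v) 0 < e"
    unfolding eventually_at_right_field using d by blast
qed

text \<open>Taken component by component, because the mean value theorem behind the difference
  quotient is one for real functions.\<close>

lemma fd_second_symmetric:
  fixes f :: "'a::real_normed_vector \<Rightarrow> 'b::euclidean_space"
  assumes S: "open S" "x \<in> S" and f: "\<And>y. y \<in> S \<Longrightarrow> f differentiable (at y)"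
    and u: "(\<lambda>y. fd f y u) differentiable (at x)" and v: "(\<lambda>y. fd f y v) differentiable (at x)"
  shows "fd (\<lambda>y. fd f y u) x v = fd (\<lambda>y. fd f y v) x u"
proof (rule euclidean_eqI)
  fix b :: 'b assume "b \<in> Basis"
  define h where "h y = f y \<bullet> b" for y
  have hd: "(h has_derivative (\<lambda>w. fd f y w \<bullet> b)) (at y)" if "y \<in> S" for y
    unfolding h_def using fd_has[OF f[OF that]] by (auto intro!: derivative_eq_intros)
  have h: "fd h y w = fd f y w \<bullet> b" if "y \<in> S" for y w using fd_eq[OF hd[OF that]] by simp
  have hdf: "h differentiable (at y)" if "y \<in> S" for y using hd[OF that] differentiableI by blast
  have 2: "((\<lambda>y. fd h y w) has_derivative (\<lambda>z. fd (\<lambda>y. fd f y w) x z \<bullet> b)) (at x)"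
    if "(\<lambda>y. fd f y w) differentiable (at x)" for w
  proof (rule has_derivative_transform_within_open[OF _ S])
    show "((\<lambda>y. fd f y w \<bullet> b) has_derivative (\<lambda>z. fd (\<lambda>y. fd f y w) x z \<bullet> b)) (at x)"
      using fd_has[OF that] by (auto intro!: derivative_eq_intros)
  qed (simp add: h)
  let ?q = "\<lambda>u v s. (h (x + s *\<^sub>R u + s *\<^sub>R v) - h (x + s *\<^sub>R u) - h (x + s *\<^sub>R v) + h x) / s\<^sup>2"
  have qu: "(?q u v \<longlongrightarrow> fd (\<lambda>y. fd f y u) x v \<bullet> b) (at_right 0)"
    by (rule second_difference_limit[OF S hdf 2[OF u]])
  have "(?q v u \<longlongrightarrow> fd (\<lambda>y. fd f y v) x u \<bullet> b) (at_right 0)"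
    by (rule second_difference_limit[OF S hdf 2[OF v]])
  moreover have "?q u v = ?q v u"
    by (rule ext) (simp add: add.commute add.left_commute)
  ultimately have "(?q u v \<longlongrightarrow> fd (\<lambda>y. fd f y v) x u \<bullet> b) (at_right 0)" by (simp only:)
  from tendsto_unique[OF trivial_limit_at_right_real qu this]
  show "fd (\<lambda>y. fd f y u) x v \<bullet> b = fd (\<lambda>y. fd f y v) x u \<bullet> b" .
qed

lemma smooth_on_second_symmetric:
  fixes f :: "'a::real_normed_vector \<Rightarrow> 'b::euclidean_space"
  assumes "open S" "x \<in> S" "smooth_on S f"
  shows "fd (\<lambda>y. fd f y u) x v = fd (\<lambda>y. fd f y v) x u"
  by (rule fd_second_symmetric[OF assms(1,2)])
     (auto intro: smooth_on_differentiable[OF _ assms(2)] smooth_on_differentiable smooth_on_fd assms(3))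

text \<open>A product rule in which \<open>L\<close> is differentiable only for each fixed second
  argument. Expanding \<open>a y\<close> in the basis leaves a finite sum of products of
  differentiable functions.\<close>

lemma has_derivative_linear_family:
  fixes L :: "'c::real_normed_vector \<Rightarrow> 'a::euclidean_space \<Rightarrow> 'b::real_normed_vector"
  assumes S: "open S" "x \<in> S" and lin: "\<And>y. y \<in> S \<Longrightarrow> linear (L y)"
    and L': "\<And>u. ((\<lambda>y. L y u) has_derivative (\<lambda>w. L' w u)) (at x)"
    and a: "(a has_derivative a') (at x)"
  shows "((\<lambda>y. L y (a y)) has_derivative (\<lambda>w. L' w (a x) + L x (a' w))) (at x)"
proof -
  \<comment> \<open>Linearity in the vector argument passes from \<open>L y\<close> to its
    derivative by uniqueness of derivatives.\<close>
  have lin': "linear (L' w)" for w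
  proof (rule linearI)
    fix u v r
    have "((\<lambda>y. L y (u + v)) has_derivative (\<lambda>w. L' w u + L' w v)) (at x)"
      by (rule has_derivative_transform_within_open[OF has_derivative_add[OF L' L'] S])
         (simp add: linear_add[OF lin])
    from has_derivative_unique[OF this L'] show "L' w (u + v) = L' w u + L' w v" by metis
    have "((\<lambda>y. L y (r *\<^sub>R u)) has_derivative (\<lambda>w. r *\<^sub>R L' w u)) (at x)"
      by (rule has_derivative_transform_within_open[OF has_derivative_scaleR_right[OF L'] S])
         (simp add: linear_cmul[OF lin])
    from has_derivative_unique[OF this L'] show "L' w (r *\<^sub>R u) = r *\<^sub>R L' w u" by metis
  qed
  have ex: "K z = (\<Sum>i\<in>Basis. (z \<bullet> i) *\<^sub>R K i)" if "linear K" for K :: "'a \<Rightarrow> 'b" and z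
    using linear_sum[OF that, of "\<lambda>i. (z \<bullet> i) *\<^sub>R i" Basis] linear_cmul[OF that]
    by (simp add: euclidean_representation)
  have "((\<lambda>y. \<Sum>i\<in>Basis. (a y \<bullet> i) *\<^sub>R L y i) has_derivative
         (\<lambda>w. \<Sum>i\<in>Basis. (a x \<bullet> i) *\<^sub>R L' w i + (a' w \<bullet> i) *\<^sub>R L x i)) (at x)"
    by (intro derivative_intros a L')
  moreover have "(\<Sum>i\<in>Basis. (a x \<bullet> i) *\<^sub>R L' w i + (a' w \<bullet> i) *\<^sub>R L x i) = L' w (a x) + L x (a' w)" for w
    unfolding sum.distrib ex[OF lin', of w "a x"] ex[OF lin[OF S(2)], of "a' w"] ..
  ultimately have "((\<lambda>y. \<Sum>i\<in>Basis. (a y \<bullet> i) *\<^sub>R L y i) has_derivative (\<lambda>w. L' w (a x) + L x (a' w))) (at x)"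
    by simp
  then show ?thesis
    by (rule has_derivative_transform_within_open[OF _ S]) (rule ex[OF lin, symmetric])
qed

lemma linear_fd_family:
  assumes S: "open S" "x \<in> S" and lin: "\<And>y. y \<in> S \<Longrightarrow> linear (L y)"
    and L: "\<And>u. (\<lambda>y. L y u) differentiable (at x)"
  shows "linear (\<lambda>u. fd (\<lambda>y. L y u) x w)"
proof (rule linearI)
  fix u v r
  have "((\<lambda>y. L y (u + v)) has_derivative (\<lambda>w. fd (\<lambda>y. L y u) x w + fd (\<lambda>y. L y v) x w)) (at x)"
    by (rule has_derivative_transform_within_open[OF has_derivative_add[OF fd_has[OF L] fd_has[OF L]] S])
       (simp add: linear_add[OF lin])
  from fd_eq[OF this]
  show "fd (\<lambda>y. L y (u + v)) x w = fd (\<lambda>y. L y u) x w + fd (\<lambda>y. L y v) x w" by simp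
  have "((\<lambda>y. L y (r *\<^sub>R u)) has_derivative (\<lambda>w. r *\<^sub>R fd (\<lambda>y. L y u) x w)) (at x)"
    by (rule has_derivative_transform_within_open[OF has_derivative_scaleR_right[OF fd_has[OF L]] S])
       (simp add: linear_cmul[OF lin])
  from fd_eq[OF this]
  show "fd (\<lambda>y. L y (r *\<^sub>R u)) x w = r *\<^sub>R fd (\<lambda>y. L y u) x w" by simp
qed

lemma has_derivative_bilinear_family:
  fixes B :: "'c::real_normed_vector \<Rightarrow> 'a::euclidean_space \<Rightarrow> 'd::euclidean_space \<Rightarrow> 'b::real_normed_vector"
  assumes S: "open S" "x \<in> S" and bil: "\<And>y. y \<in> S \<Longrightarrow> bilinear (B y)"
    and B': "\<And>u v. ((\<lambda>y. B y u v) has_derivative (\<lambda>w. B' w u v)) (at x)"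
    and a: "(a has_derivative a') (at x)" and b: "(b has_derivative b') (at x)"
  shows "((\<lambda>y. B y (a y) (b y)) has_derivative
           (\<lambda>w. B' w (a x) (b x) + B x (a' w) (b x) + B x (a x) (b' w))) (at x)"
proof -
  have 1: "((\<lambda>y. B y u (b y)) has_derivative (\<lambda>w. B' w u (b x) + B x u (b' w))) (at x)" for u
    by (rule has_derivative_linear_family[OF S _ B' b]) (use bil in \<open>auto simp: bilinear_def\<close>)
  have "((\<lambda>y. B y (a y) (b y)) has_derivative
           (\<lambda>w. (B' w (a x) (b x) + B x (a x) (b' w)) + B x (a' w) (b x))) (at x)"
    by (rule has_derivative_linear_family[OF S _ 1 a])
       (use bil in \<open>auto simp: bilinear_def\<close>)
  then show ?thesis by (simp add: add_ac)
qed

section \<open>Differentiability of solutions of linear systems\<close>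

lemma differentiable_prod:
  fixes f :: "'i \<Rightarrow> 'a::real_normed_vector \<Rightarrow> real"
  assumes "\<And>i. i \<in> J \<Longrightarrow> f i differentiable (at x)"
  shows "(\<lambda>y. \<Prod>i\<in>J. f i y) differentiable (at x)"
  using has_derivative_prod[of J f "\<lambda>i. fd (f i) x"] fd_has[OF assms] differentiableI by blast

lemma differentiable_det:
  fixes A :: "'c::real_normed_vector \<Rightarrow> real^'n^'n"
  assumes "\<And>i j. (\<lambda>y. A y $ i $ j) differentiable (at x)"
  shows "(\<lambda>y. det (A y)) differentiable (at x)"
  unfolding det_def
  by (auto intro!: differentiable_sum differentiable_mult differentiable_prod assms differentiable_const)

text \<open>By Cramer's rule.\<close>

lemma differentiable_linear_solve:
  fixes L :: "'c::real_normed_vector \<Rightarrow> real^'n \<Rightarrow> real^'n"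
  assumes S: "open S" "x \<in> S" and lin: "\<And>y. y \<in> S \<Longrightarrow> linear (L y)"
    and inj: "\<And>y. y \<in> S \<Longrightarrow> inj (L y)"
    and L: "\<And>u. (\<lambda>y. L y u) differentiable (at x)" and c: "c differentiable (at x)"
    and eq: "\<And>y. y \<in> S \<Longrightarrow> L y (a y) = c y"
  shows "a differentiable (at x)"
proof -
  have comp: "(\<lambda>y. h y $ i) differentiable (at x)" if "h differentiable (at x)"
    for h :: "'c \<Rightarrow> real^'n" and i
    using differentiable_compose[OF bounded_linear_imp_differentiable[OF bounded_linear_vec_nth] that] by simp
  have det0: "det (matrix (L y)) \<noteq> 0" if "y \<in> S" for y
    using det_nz_iff_inj[OF lin[OF that]] inj[OF that] by simp
  have sol: "a y = (\<chi> k. det (\<chi> i j. if j = k then c y $ i else matrix (L y) $ i $ j) / det (matrix (L y)))"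
    if "y \<in> S" for y
    using cramer[OF det0[OF that], of "a y" "c y"] eq[OF that] matrix_works[of "L y" "a y"] lin[OF that]
    by (simp add: linear_matrix_vector_mul_eq)
  have dm: "(\<lambda>y. matrix (L y) $ i $ j) differentiable (at x)" for i j
    unfolding matrix_def by (simp add: comp[OF L])
  have "(\<lambda>y. \<chi> k. det (\<chi> i j. if j = k then c y $ i else matrix (L y) $ i $ j) / det (matrix (L y)))
          differentiable (at x)"
    unfolding differentiable_componentwise_within[where f = "\<lambda>y. \<chi> k. F y k" for F]
  proof
    fix b :: "real^'n" assume "b \<in> Basis"
    then obtain k where b: "b = axis k 1" by (auto simp: Basis_vec_def)
    have "(\<lambda>y. det (\<chi> i j. if j = k then c y $ i else matrix (L y) $ i $ j)) differentiable (at x)"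
    proof (rule differentiable_det)
      fix i j
      show "(\<lambda>y. (\<chi> i j. if j = k then c y $ i else matrix (L y) $ i $ j) $ i $ j) differentiable (at x)"
        by (cases "j = k") (simp_all add: comp[OF c] dm)
    qed
    then show "(\<lambda>y. (\<chi> k. det (\<chi> i j. if j = k then c y $ i else matrix (L y) $ i $ j) / det (matrix (L y))) \<bullet> b)
          differentiable (at x)"
      using differentiable_divide[OF _ differentiable_det[OF dm]] det0[OF S(2)]
      by (simp add: b inner_axis)
  qed
  then show ?thesis
    by (rule differentiable_cong_open[OF _ S]) (simp add: sol)
qed

lemma nondegenerate_cancel:
  assumes "bilinear B" "nondegenerate B" "\<And>z. B a z = B b z"
  shows "a = b"
proof -
  have "B (a - b) z = 0" for z
    using assms(3) by (simp add: bilinear_lsub[OF assms(1)])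
  then show ?thesis using assms(2) by (auto simp: nondegenerate_def dest: spec[of _ "a - b"])
qed

text \<open>The source of differentiability for the shape operator and for the Christoffel symbols.
  Testing against the basis gives a linear system with the Gram matrix of \<open>B y\<close>, which
  is invertible by nondegeneracy.\<close>

lemma differentiable_metric_dual:
  fixes B :: "'c::real_normed_vector \<Rightarrow> real^'n \<Rightarrow> real^'n \<Rightarrow> real"
  assumes S: "open S" "x \<in> S" and bil: "\<And>y. y \<in> S \<Longrightarrow> bilinear (B y)"
    and nd: "\<And>y. y \<in> S \<Longrightarrow> nondegenerate (B y)"
    and B: "\<And>u v. (\<lambda>y. B y u v) differentiable (at x)"
    and \<alpha>: "\<And>z. (\<lambda>y. \<alpha> y z) differentiable (at x)"
    and eq: "\<And>y z. y \<in> S \<Longrightarrow> B y (a y) z = \<alpha> y z"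
  shows "a differentiable (at x)"
proof (rule differentiable_linear_solve[OF S, where L = "\<lambda>y u. \<Sum>b\<in>Basis. B y u b *\<^sub>R b"
      and c = "\<lambda>y. \<Sum>b\<in>Basis. \<alpha> y b *\<^sub>R b"])
  fix y assume y: "y \<in> S"
  have l: "linear (\<lambda>u. B y u z)" for z using bil[OF y] by (simp add: bilinear_def)
  have r: "linear (B y u)" for u using bil[OF y] by (simp add: bilinear_def)
  show "linear (\<lambda>u. \<Sum>b\<in>Basis. B y u b *\<^sub>R b)"
    by (rule linearI) (simp_all add: linear_add[OF l] linear_cmul[OF l] scaleR_add_left sum.distrib scaleR_sum_right)
  show "inj (\<lambda>u. \<Sum>b\<in>Basis. B y u b *\<^sub>R b)"
  proof (rule injI)
    fix u v assume e: "(\<Sum>b\<in>Basis. B y u b *\<^sub>R b) = (\<Sum>b\<in>Basis. B y v b *\<^sub>R b)"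
    have "B y u b = B y v b" if "b \<in> Basis" for b
      using arg_cong[OF e, of "\<lambda>z. z \<bullet> b"] that by (simp add: inner_sum_left_Basis)
    then have "B y u = B y v" using linear_eq_stdbasis[OF r r] by blast
    then show "u = v" using nondegenerate_cancel[OF bil[OF y] nd[OF y]] by simp
  qed
  show "(\<Sum>b\<in>Basis. B y (a y) b *\<^sub>R b) = (\<Sum>b\<in>Basis. \<alpha> y b *\<^sub>R b)"
    using eq[OF y] by simp
qed (auto intro!: differentiable_sum differentiable_scaleR B \<alpha> differentiable_const)

lemma smooth_on_real_deriv:
  fixes f :: "real \<Rightarrow> real"
  assumes I: "open I" and f: "smooth_on I f" and t: "t \<in> I"
  shows "(f has_real_derivative deriv f t) (at t)"
    and "(deriv f has_real_derivative deriv (deriv f) t) (at t)"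
proof -
  have 1: "(f has_real_derivative deriv f s) (at s)" if "s \<in> I" for s
    using smooth_on_differentiable[OF f that] by (simp add: DERIV_deriv_iff_real_differentiable)
  then show "(f has_real_derivative deriv f t) (at t)" using t .
  have "fd f s 1 = deriv f s" if "s \<in> I" for s
    using 1[OF that] unfolding has_field_derivative_def by (simp add: fd_eq)
  then have "deriv f differentiable (at t)"
    by (intro differentiable_cong_open[OF smooth_on_differentiable[OF smooth_on_fd[OF f, of 1] t] I t])
  then show "(deriv f has_real_derivative deriv (deriv f) t) (at t)"
    by (simp add: DERIV_deriv_iff_real_differentiable)
qed


section \<open>Traces\<close>

lemma ltrace_add: "ltrace (\<lambda>u. K u + L u) = ltrace K + ltrace L"
  by (simp add: ltrace_def inner_add_left sum.distrib)

lemma ltrace_diff: "ltrace (\<lambda>u. K u - L u) = ltrace K - ltrace L"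
  by (simp add: ltrace_def inner_diff_left sum_subtractf)

lemma ltrace_scaleR: "ltrace (\<lambda>u. r *\<^sub>R L u) = r * ltrace L"
  by (simp add: ltrace_def sum_distrib_left)

lemma ltrace_id: "ltrace (\<lambda>u::'a::euclidean_space. u) = real DIM('a)"
  by (simp add: ltrace_def)

lemma ltrace_rank_one:
  assumes "linear (\<phi> :: 'a::euclidean_space \<Rightarrow> real)"
  shows "ltrace (\<lambda>u. \<phi> u *\<^sub>R z) = \<phi> z"
proof -
  have "\<phi> z = \<phi> (\<Sum>b\<in>Basis. (z \<bullet> b) *\<^sub>R b)" by (simp add: euclidean_representation)
  also have "\<dots> = (\<Sum>b\<in>Basis. (z \<bullet> b) * \<phi> b)"
    by (simp add: linear_sum[OF assms] linear_cmul[OF assms])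
  finally show ?thesis by (simp add: ltrace_def mult.commute)
qed

text \<open>Both sides are the same double sum over matrix entries. It serves for changes of chart,
  for the change to the frame adapted to the hypersurface, and for the trace of a
  commutator.\<close>

lemma ltrace_commute:
  fixes K :: "'a::euclidean_space \<Rightarrow> 'b::euclidean_space" and L :: "'b \<Rightarrow> 'a"
  assumes K: "linear K" and L: "linear L"
  shows "ltrace (\<lambda>u. K (L u)) = ltrace (\<lambda>u. L (K u))"
proof -
  have ex: "J z \<bullet> w = (\<Sum>i\<in>Basis. (z \<bullet> i) * (J i \<bullet> w))" if "linear J"
    for J :: "'x::euclidean_space \<Rightarrow> 'y::euclidean_space" and z w
  proof -
    have "J z = (\<Sum>i\<in>Basis. (z \<bullet> i) *\<^sub>R J i)"
      using linear_sum[OF that, of "\<lambda>i. (z \<bullet> i) *\<^sub>R i" Basis] linear_cmul[OF that]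
      by (simp add: euclidean_representation)
    then show ?thesis by (simp add: inner_sum_left)
  qed
  have "ltrace (\<lambda>u. K (L u)) = (\<Sum>b\<in>Basis. \<Sum>c\<in>Basis. (L b \<bullet> c) * (K c \<bullet> b))"
    unfolding ltrace_def by (rule sum.cong[OF refl]) (rule ex[OF K])
  also have "\<dots> = (\<Sum>c\<in>Basis. \<Sum>b\<in>Basis. (K c \<bullet> b) * (L b \<bullet> c))"
    by (subst sum.swap) (simp add: mult.commute)
  also have "\<dots> = ltrace (\<lambda>u. L (K u))"
    unfolding ltrace_def by (rule sum.cong[OF refl]) (rule ex[OF L, symmetric])
  finally show ?thesis .
qed

lemma ltrace_prod:
  fixes L :: "real \<times> 'a::euclidean_space \<Rightarrow> real \<times> 'a"
  shows "ltrace L = fst (L (1, 0)) + ltrace (\<lambda>u. snd (L (0, u)))"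
proof -
  have "ltrace L = (\<Sum>b\<in>(\<lambda>u. (u, 0)) ` (Basis::real set) \<union> (\<lambda>v. (0, v)) ` (Basis::'a set). L b \<bullet> b)"
    by (simp add: ltrace_def Basis_prod_def)
  also have "\<dots> = (\<Sum>b\<in>(\<lambda>u. (u, 0)) ` (Basis::real set). L b \<bullet> b) + (\<Sum>b\<in>(\<lambda>v. (0, v)) ` (Basis::'a set). L b \<bullet> b)"
    by (rule sum.union_disjoint) (auto simp: nonzero_Basis)
  also have "\<dots> = fst (L (1, 0)) + ltrace (\<lambda>u. snd (L (0, u)))"
    by (simp add: sum.reindex inj_on_def ltrace_def inner_prod_def)
  finally show ?thesis .
qed

text \<open>An orthonormal set of maximal cardinality works: if some vector were not recovered from
  its coefficients, the normalised remainder could be added to the set.\<close>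

lemma orthonormal_basis_exists:
  fixes B :: "'a::euclidean_space \<Rightarrow> 'a \<Rightarrow> real"
  assumes B: "bilinear B" and sym: "\<And>u v. B u v = B v u" and pos: "\<And>u. u \<noteq> 0 \<Longrightarrow> B u u > 0"
  obtains X where "finite X" "\<And>y. y = (\<Sum>u\<in>X. B y u *\<^sub>R u)"
proof -
  have linl: "linear (\<lambda>u. B u z)" for z using B by (simp add: bilinear_def)
  define ON where "ON X \<longleftrightarrow> finite X \<and> (\<forall>u\<in>X. \<forall>v\<in>X. B u v = (if u = v then 1 else 0))" for X
  have coeff: "B (\<Sum>u\<in>X. r u *\<^sub>R u) v = r v" if "ON X" "v \<in> X" for X r v
  proof -
    have "B (\<Sum>u\<in>X. r u *\<^sub>R u) v = (\<Sum>u\<in>X. r u * B u v)"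
      by (simp add: linear_sum[OF linl] linear_cmul[OF linl])
    also have "\<dots> = (\<Sum>u\<in>X. if u = v then r u else 0)"
      by (rule sum.cong) (use that in \<open>auto simp: ON_def\<close>)
    also have "\<dots> = r v" using that by (simp add: ON_def)
    finally show ?thesis .
  qed
  have card: "card X \<le> DIM('a)" if X: "ON X" for X
  proof -
    have "independent X"
    proof (rule independent_if_scalars_zero)
      show "finite X" using X by (simp add: ON_def)
      fix r v assume "(\<Sum>u\<in>X. r u *\<^sub>R u) = 0" "v \<in> X"
      then show "r v = 0" using coeff[OF X, of v r] bilinear_lzero[OF B, of v] by simp
    qed
    then show ?thesis using independent_bound by blast
  qed
  \<comment> \<open>The maximum exists because orthonormal sets are independent, so their size is
    bounded by the dimension.\<close>
  define k where "k = Max (card ` {X. ON X})"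
  have fin: "finite (card ` {X. ON X})"
    by (rule finite_subset[of _ "{..DIM('a)}"]) (use card in auto)
  have "ON {}" by (simp add: ON_def)
  then have "k \<in> card ` {X. ON X}" unfolding k_def by (intro Max_in fin) auto
  then obtain X where X: "ON X" "card X = k" by auto
  have "y = (\<Sum>u\<in>X. B y u *\<^sub>R u)" for y
  proof (rule ccontr)
    define w where "w = y - (\<Sum>u\<in>X. B y u *\<^sub>R u)"
    assume "y \<noteq> (\<Sum>u\<in>X. B y u *\<^sub>R u)"
    then have w: "w \<noteq> 0" by (simp add: w_def)
    have wX: "B w v = 0" if "v \<in> X" for v
      using coeff[OF X(1) that, of "B y"] by (simp add: w_def linear_diff[OF linl])
    define z where "z = (1 / sqrt (B w w)) *\<^sub>R w"
    have zz: "B z z = 1"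
      using pos[OF w] by (simp add: z_def bilinear_lmul[OF B] bilinear_rmul[OF B])
    have zX: "B z v = 0" "B v z = 0" if "v \<in> X" for v
      using wX[OF that] sym[of v] by (simp_all add: z_def bilinear_lmul[OF B])
    have "z \<notin> X" using zX(1)[of z] zz by auto
    moreover have "ON (insert z X)"
      using X(1) zz zX \<open>z \<notin> X\<close> unfolding ON_def by auto
    ultimately have "card (insert z X) = Suc k" using X by (simp add: ON_def)
    moreover have "card (insert z X) \<le> k"
      unfolding k_def by (rule Max_ge[OF fin]) (use \<open>ON (insert z X)\<close> in blast)
    ultimately show False by simp
  qed
  then show ?thesis using that X(1) by (auto simp: ON_def)
qed

text \<open>In an orthonormal basis the trace is the sum of the squared lengths of the vectors
  \<open>A u\<close>. The sign matters because \<open>hs_norm\<close> is a square root, and squaring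
  gives back the radicand only if that is nonnegative.\<close>

lemma ltrace_square_nonneg:
  fixes A :: "'a::euclidean_space \<Rightarrow> 'a" and B :: "'a \<Rightarrow> 'a \<Rightarrow> real"
  assumes B: "bilinear B" and sym: "\<And>u v. B u v = B v u" and pos: "\<And>u. u \<noteq> 0 \<Longrightarrow> B u u > 0"
    and A: "linear A" and adj: "\<And>u v. B (A u) v = B u (A v)"
  shows "ltrace (\<lambda>u. A (A u)) \<ge> 0"
proof -
  obtain X where X: "finite X" "\<And>y. y = (\<Sum>u\<in>X. B y u *\<^sub>R u)"
    using orthonormal_basis_exists[OF B sym pos] by metis
  have lin: "linear (\<lambda>v. B (A (A v)) u)" for u
  proof -
    have "linear (\<lambda>u. B u z)" for z using B by (simp add: bilinear_def)
    from linear_compose[OF linear_compose[OF A A] this] show ?thesis by (simp add: o_def)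
  qed
  have "ltrace (\<lambda>u. A (A u)) = ltrace (\<lambda>v. \<Sum>u\<in>X. B (A (A v)) u *\<^sub>R u)"
    using X(2) by (intro arg_cong[of _ _ ltrace] ext)
  also have "\<dots> = (\<Sum>u\<in>X. ltrace (\<lambda>v. B (A (A v)) u *\<^sub>R u))"
    unfolding ltrace_def inner_sum_left by (rule sum.swap)
  also have "\<dots> = (\<Sum>u\<in>X. B (A u) (A u))"
    unfolding ltrace_rank_one[OF lin] by (simp add: adj)
  also have "\<dots> \<ge> 0"
  proof (rule sum_nonneg)
    fix u show "0 \<le> B (A u) (A u)"
      using pos[of "A u"] bilinear_lzero[OF B, of 0] by (cases "A u = 0") auto
  qed
  finally show ?thesis .
qed


section \<open>Levi-Civita connection and curvature in a chart\<close>

text \<open>Identifies an explicit candidate. The properties of the derivative of \<open>G\<close>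
  that existence and uniqueness ask for are read off from its expression through the
  candidate.\<close>

lemma levi_civita_eq:
  assumes B: "bilinear (G x)" "\<And>u v. G x u v = G x v u" "nondegenerate (G x)"
    and G: "bilinear \<Gamma>" "\<And>u v. \<Gamma> u v = \<Gamma> v u"
    "\<And>w u v. fd (\<lambda>y. G y u v) x w = G x (\<Gamma> w u) v + G x u (\<Gamma> w v)"
  shows "levi_civita G x = \<Gamma>"
proof -
  note Gl = bilinear_ladd[OF G(1)] bilinear_radd[OF G(1)] bilinear_lmul[OF G(1)] bilinear_rmul[OF G(1)]
  note Bl = bilinear_ladd[OF B(1)] bilinear_radd[OF B(1)] bilinear_lmul[OF B(1)] bilinear_rmul[OF B(1)]
  have "\<exists>!\<Gamma>. bilinear \<Gamma> \<and> (\<forall>u v. \<Gamma> u v = \<Gamma> v u) \<and>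
           (\<forall>w u v. fd (\<lambda>y. G y u v) x w = G x (\<Gamma> w u) v + G x u (\<Gamma> w v))"
  proof (rule levi_civita_ex1[OF B])
    show "bilinear (\<lambda>u v. fd (\<lambda>y. G y u v) x w)" for w
      unfolding G(3) bilinear_def
      by (intro conjI allI linearI) (simp_all add: Gl Bl algebra_simps)
    show "linear (\<lambda>w. fd (\<lambda>y. G y u v) x w)" for u v
      unfolding G(3) by (intro linearI) (simp_all add: Gl Bl algebra_simps)
    show "fd (\<lambda>y. G y u v) x w = fd (\<lambda>y. G y v u) x w" for w u v
      unfolding G(3) by (simp add: B(2) add.commute)
  qed
  then show ?thesis
    unfolding levi_civita_def by (rule the1_equality) (use G in blast)
qed

lemma levi_civita_cong:
  assumes "open S" "x \<in> S" "\<And>y u v. y \<in> S \<Longrightarrow> G y u v = G' y u v"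
  shows "levi_civita G x = levi_civita G' x"
proof -
  have "fd (\<lambda>y. G y u v) x = fd (\<lambda>y. G' y u v) x" for u v
    by (rule fd_cong_open[OF assms(1,2)]) (rule assms(3))
  moreover have "G x = G' x" using assms(2,3) by (intro ext) auto
  ultimately show ?thesis unfolding levi_civita_def by simp
qed

lemma local_laplacian_cong:
  assumes S: "open S" "x \<in> S" and G: "\<And>y u v. y \<in> S \<Longrightarrow> G y u v = G' y u v"
    and u: "\<And>y. y \<in> S \<Longrightarrow> u y = u' y"
  shows "local_laplacian G u x = local_laplacian G' u' x"
proof -
  have 1: "fd u y = fd u' y" if "y \<in> S" for y by (rule fd_cong_open[OF S(1) that u])
  have 2: "fd (\<lambda>y. fd u y w) x = fd (\<lambda>y. fd u' y w) x" for w
    by (rule fd_cong_open[OF S]) (simp add: 1)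
  have 3: "G x = G' x" using S(2) G by (intro ext) auto
  have "hessian G u x v w = hessian G' u' x v w" for v w
    by (simp add: hessian_def cov_def levi_civita_cong[OF S G] 1[OF S(2)] 2)
  then have "hessian G u x = hessian G' u' x" by (intro ext)
  then show ?thesis by (simp add: local_laplacian_def 3)
qed

text \<open>The curvature as a function of the Christoffel symbols alone, so that it can be computed
  for a connection given by a formula.\<close>

definition curv :: "('a::real_normed_vector \<Rightarrow> 'a \<Rightarrow> 'a \<Rightarrow> 'a) \<Rightarrow> 'a \<Rightarrow> 'a \<Rightarrow> 'a \<Rightarrow> 'a \<Rightarrow> 'a" where
  "curv \<Gamma> y u v w = fd (\<lambda>z. \<Gamma> z v w) y u - fd (\<lambda>z. \<Gamma> z u w) y v + \<Gamma> y u (\<Gamma> y v w) - \<Gamma> y v (\<Gamma> y u w)"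

definition ric :: "('a::euclidean_space \<Rightarrow> 'a \<Rightarrow> 'a \<Rightarrow> 'a) \<Rightarrow> 'a \<Rightarrow> 'a \<Rightarrow> 'a \<Rightarrow> real" where
  "ric \<Gamma> y v w = ltrace (\<lambda>u. curv \<Gamma> y u v w)"

lemma curvature_eq: "curvature G = curv (levi_civita G)"
  by (intro ext) (simp add: curvature_def cov_def curv_def)

lemma local_ricci_eq: "local_ricci G = ric (levi_civita G)"
  by (intro ext) (simp add: local_ricci_def ric_def curvature_eq)


section \<open>Hypersurfaces in a chart\<close>

text \<open>\<open>\<Psi>\<close> and \<open>\<nu>\<close> are the immersion and the unit normal in
  coordinates. \<open>\<Gamma>\<close> is a parameter that is torsion-free and compatible with
  \<open>G\<close>, which lets the explicit symbols of the warped product be inserted.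
  \<open>G\<close> may be indefinite; only its restriction to the hypersurface is positive.\<close>

locale hypersurface_chart =
  fixes \<Omega> :: "(real^'n) set" and W :: "(real \<times> (real^'n)) set"
    and \<Psi> \<nu> :: "real^'n \<Rightarrow> real \<times> (real^'n)"
    and G :: "real \<times> (real^'n) \<Rightarrow> real \<times> (real^'n) \<Rightarrow> real \<times> (real^'n) \<Rightarrow> real"
    and \<Gamma> :: "real \<times> (real^'n) \<Rightarrow> real \<times> (real^'n) \<Rightarrow> real \<times> (real^'n) \<Rightarrow> real \<times> (real^'n)"
    and \<epsilon> :: real
  assumes open_\<Omega>: "open \<Omega>" and open_W: "open W"
    and \<Psi>_smooth: "smooth_on \<Omega> \<Psi>" and \<nu>_smooth: "smooth_on \<Omega> \<nu>"
    and \<Psi>_in: "\<And>x. x \<in> \<Omega> \<Longrightarrow> \<Psi> x \<in> W"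
    and G_bil: "\<And>y. y \<in> W \<Longrightarrow> bilinear (G y)"
    and G_sym: "\<And>y u v. y \<in> W \<Longrightarrow> G y u v = G y v u"
    and G_diff: "\<And>y u v. y \<in> W \<Longrightarrow> (\<lambda>z. G z u v) differentiable (at y)"
    and \<Gamma>_bil: "\<And>y. y \<in> W \<Longrightarrow> bilinear (\<Gamma> y)"
    and \<Gamma>_sym: "\<And>y u v. y \<in> W \<Longrightarrow> \<Gamma> y u v = \<Gamma> y v u"
    and \<Gamma>_diff: "\<And>y u v. y \<in> W \<Longrightarrow> (\<lambda>z. \<Gamma> z u v) differentiable (at y)"
    and \<Gamma>_metric: "\<And>y u v w. y \<in> W \<Longrightarrow> fd (\<lambda>z. G z u v) y w = G y (\<Gamma> y w u) v + G y u (\<Gamma> y w v)"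
    and h_pos: "\<And>x u. x \<in> \<Omega> \<Longrightarrow> u \<noteq> 0 \<Longrightarrow> G (\<Psi> x) (fd \<Psi> x u) (fd \<Psi> x u) > 0"
    and normal: "\<And>x u. x \<in> \<Omega> \<Longrightarrow> G (\<Psi> x) (\<nu> x) (fd \<Psi> x u) = 0"
    and unit: "\<And>x. x \<in> \<Omega> \<Longrightarrow> G (\<Psi> x) (\<nu> x) (\<nu> x) = \<epsilon>"
    and \<epsilon>_sq: "\<epsilon> * \<epsilon> = 1"
begin

abbreviation "R \<equiv> curv \<Gamma>"
abbreviation "Ric \<equiv> ric \<Gamma>"

definition h :: "real^'n \<Rightarrow> real^'n \<Rightarrow> real^'n \<Rightarrow> real" where
  "h x u v = G (\<Psi> x) (fd \<Psi> x u) (fd \<Psi> x v)"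

definition covD :: "(real^'n \<Rightarrow> real \<times> (real^'n)) \<Rightarrow> real^'n \<Rightarrow> real^'n \<Rightarrow> real \<times> (real^'n)" where
  "covD X x w = fd X x w + \<Gamma> (\<Psi> x) (fd \<Psi> x w) (X x)"

text \<open>\<open>Gh\<close>, the tangential part of the second derivative of \<open>\<Psi>\<close>, will be the Levi-Civita connection
  of \<open>h\<close>, and \<open>dshape\<close> is the covariant derivative of \<open>shape\<close> with respect to it.\<close>

definition tang :: "real^'n \<Rightarrow> real \<times> (real^'n) \<Rightarrow> real^'n" where
  "tang x y = (THE u. fd \<Psi> x u = y - (\<epsilon> * G (\<Psi> x) y (\<nu> x)) *\<^sub>R \<nu> x)"

definition shape :: "real^'n \<Rightarrow> real^'n \<Rightarrow> real^'n" where
  "shape x w = - tang x (covD \<nu> x w)"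

text \<open>The whole covariant second derivative of \<open>\<Psi>\<close>, not only the second
  fundamental form: its tangential part is kept and becomes the induced connection
  \<open>Gh\<close>.\<close>

definition II :: "real^'n \<Rightarrow> real^'n \<Rightarrow> real^'n \<Rightarrow> real \<times> (real^'n)" where
  "II x v w = covD (\<lambda>y. fd \<Psi> y w) x v"

definition Gh :: "real^'n \<Rightarrow> real^'n \<Rightarrow> real^'n \<Rightarrow> real^'n" where
  "Gh x v w = tang x (II x v w)"

definition dshape :: "real^'n \<Rightarrow> real^'n \<Rightarrow> real^'n \<Rightarrow> real^'n" where
  "dshape x v w = fd (\<lambda>y. shape y w) x v + Gh x v (shape x w) - shape x (Gh x v w)"

section \<open>Covariant differentiation along the immersion\<close>

lemma \<Psi>_diff: "x \<in> \<Omega> \<Longrightarrow> \<Psi> differentiable (at x)"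
  and d\<Psi>_diff: "x \<in> \<Omega> \<Longrightarrow> (\<lambda>y. fd \<Psi> y w) differentiable (at x)"
  and \<nu>_diff: "x \<in> \<Omega> \<Longrightarrow> \<nu> differentiable (at x)"
  and d\<nu>_diff: "x \<in> \<Omega> \<Longrightarrow> (\<lambda>y. fd \<nu> y w) differentiable (at x)"
  using smooth_on_differentiable \<Psi>_smooth \<nu>_smooth smooth_on_fd by metis+

lemma lin_d\<Psi>: "x \<in> \<Omega> \<Longrightarrow> linear (fd \<Psi> x)"
  by (rule linear_fd[OF \<Psi>_diff])

lemma lin_d\<nu>: "x \<in> \<Omega> \<Longrightarrow> linear (fd \<nu> x)"
  by (rule linear_fd[OF \<nu>_diff])

lemmas d\<Psi>_lin = linear_add[OF lin_d\<Psi>] linear_cmul[OF lin_d\<Psi>] linear_diff[OF lin_d\<Psi>]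
  linear_neg[OF lin_d\<Psi>] linear_0[OF lin_d\<Psi>]

lemmas G_lin = bilinear_ladd[OF G_bil] bilinear_radd[OF G_bil] bilinear_lmul[OF G_bil]
  bilinear_rmul[OF G_bil] bilinear_lsub[OF G_bil] bilinear_rsub[OF G_bil]
  bilinear_lneg[OF G_bil] bilinear_rneg[OF G_bil] bilinear_lzero[OF G_bil] bilinear_rzero[OF G_bil]

lemmas \<Gamma>_lin = bilinear_ladd[OF \<Gamma>_bil] bilinear_radd[OF \<Gamma>_bil] bilinear_lmul[OF \<Gamma>_bil]
  bilinear_rmul[OF \<Gamma>_bil] bilinear_lsub[OF \<Gamma>_bil] bilinear_rsub[OF \<Gamma>_bil]
  bilinear_lneg[OF \<Gamma>_bil] bilinear_rneg[OF \<Gamma>_bil]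

text \<open>By \<open>\<Gamma>_metric\<close> the derivative of \<open>G\<close> in the direction
  \<open>fd \<Psi> x w\<close> splits into two Christoffel terms, which complete the derivatives of
  \<open>X\<close> and \<open>Y\<close> to covariant ones.\<close>

lemma metric_along:
  assumes x: "x \<in> \<Omega>" and X: "X differentiable (at x)" and Y: "Y differentiable (at x)"
  shows "((\<lambda>y. G (\<Psi> y) (X y) (Y y)) has_derivative
    (\<lambda>w. G (\<Psi> x) (covD X x w) (Y x) + G (\<Psi> x) (X x) (covD Y x w))) (at x)"
proof -
  have W: "\<Psi> x \<in> W" using \<Psi>_in x .
  let ?B' = "\<lambda>w u v. G (\<Psi> x) (\<Gamma> (\<Psi> x) (fd \<Psi> x w) u) v + G (\<Psi> x) u (\<Gamma> (\<Psi> x) (fd \<Psi> x w) v)"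
  have 1: "((\<lambda>y. G (\<Psi> y) u v) has_derivative (\<lambda>w. ?B' w u v)) (at x)" for u v
    using diff_chain_at[OF fd_has[OF \<Psi>_diff[OF x]] fd_has[OF G_diff[OF W, of u v]]]
    by (simp add: o_def \<Gamma>_metric[OF W])
  have "((\<lambda>y. G (\<Psi> y) (X y) (Y y)) has_derivative (\<lambda>w. ?B' w (X x) (Y x)
      + G (\<Psi> x) (fd X x w) (Y x) + G (\<Psi> x) (X x) (fd Y x w))) (at x)"
    by (rule has_derivative_bilinear_family[OF open_\<Omega> x _ 1 fd_has[OF X] fd_has[OF Y]])
       (rule G_bil[OF \<Psi>_in])
  then show ?thesis by (simp add: covD_def G_lin[OF W] add_ac)
qed

lemma covD_tangent:
  assumes x: "x \<in> \<Omega>" and a: "a differentiable (at x)"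
  shows "(\<lambda>y. fd \<Psi> y (a y)) differentiable (at x)"
    and "covD (\<lambda>y. fd \<Psi> y (a y)) x w = II x w (a x) + fd \<Psi> x (fd a x w)"
proof -
  have "((\<lambda>y. fd \<Psi> y (a y)) has_derivative
      (\<lambda>w. fd (\<lambda>y. fd \<Psi> y (a x)) x w + fd \<Psi> x (fd a x w))) (at x)"
    by (rule has_derivative_linear_family[OF open_\<Omega> x lin_d\<Psi> fd_has[OF d\<Psi>_diff[OF x]] fd_has[OF a]])
  from fd_eq[OF this] differentiableI[OF this]
  show "(\<lambda>y. fd \<Psi> y (a y)) differentiable (at x)"
    "covD (\<lambda>y. fd \<Psi> y (a y)) x w = II x w (a x) + fd \<Psi> x (fd a x w)"
    by (simp_all add: covD_def II_def)
qed

lemma second_sym: "x \<in> \<Omega> \<Longrightarrow> fd (\<lambda>y. fd \<Psi> y w) x v = fd (\<lambda>y. fd \<Psi> y v) x w"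
  by (rule smooth_on_second_symmetric[OF open_\<Omega> _ \<Psi>_smooth])

lemma II_sym: "x \<in> \<Omega> \<Longrightarrow> II x v w = II x w v"
  unfolding II_def covD_def by (simp add: second_sym[of x w v] \<Gamma>_sym[OF \<Psi>_in, of x "fd \<Psi> x v"])

lemma bilinear_II:
  assumes x: "x \<in> \<Omega>" shows "bilinear (II x)"
proof -
  have l: "linear (\<lambda>v. II x v w)" for w
    unfolding II_def covD_def
    by (rule linearI)
       (simp_all add: linear_add[OF linear_fd[OF d\<Psi>_diff[OF x]]] linear_cmul[OF linear_fd[OF d\<Psi>_diff[OF x]]]
        d\<Psi>_lin[OF x] \<Gamma>_lin[OF \<Psi>_in[OF x]] scaleR_add_right)
  moreover have "linear (II x v)" for v
    using l[of v] by (simp add: II_sym[OF x, of _ v])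
  ultimately show ?thesis by (simp add: bilinear_def)
qed

lemma linear_covD_\<nu>:
  assumes x: "x \<in> \<Omega>" shows "linear (covD \<nu> x)"
  unfolding covD_def
  by (rule linearI)
     (simp_all add: linear_add[OF lin_d\<nu>[OF x]] linear_cmul[OF lin_d\<nu>[OF x]]
      d\<Psi>_lin[OF x] \<Gamma>_lin[OF \<Psi>_in[OF x]] scaleR_add_right)

lemma covD_\<nu>_\<nu>:
  assumes x: "x \<in> \<Omega>" shows "G (\<Psi> x) (covD \<nu> x w) (\<nu> x) = 0"
proof -
  have "((\<lambda>y. \<epsilon>) has_derivative
    (\<lambda>w. G (\<Psi> x) (covD \<nu> x w) (\<nu> x) + G (\<Psi> x) (\<nu> x) (covD \<nu> x w))) (at x)"
    by (rule has_derivative_transform_within_open[OF metric_along[OF x \<nu>_diff[OF x] \<nu>_diff[OF x]] open_\<Omega> x])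
       (rule unit)
  from has_derivative_unique[OF this has_derivative_const]
  have "G (\<Psi> x) (covD \<nu> x w) (\<nu> x) + G (\<Psi> x) (\<nu> x) (covD \<nu> x w) = 0" by metis
  then show ?thesis using G_sym[OF \<Psi>_in[OF x], of "\<nu> x" "covD \<nu> x w"] by simp
qed

text \<open>The Weingarten relation, obtained by differentiating the orthogonality of
  \<open>\<nu>\<close> and the coordinate field \<open>fd \<Psi> y u\<close>.\<close>

lemma covD_\<nu>_tangent:
  assumes x: "x \<in> \<Omega>" shows "G (\<Psi> x) (covD \<nu> x w) (fd \<Psi> x u) = - G (\<Psi> x) (\<nu> x) (II x w u)"
proof -
  have "((\<lambda>y. 0) has_derivative
    (\<lambda>w. G (\<Psi> x) (covD \<nu> x w) (fd \<Psi> x u) + G (\<Psi> x) (\<nu> x) (covD (\<lambda>y. fd \<Psi> y u) x w))) (at x)"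
    by (rule has_derivative_transform_within_open[OF metric_along[OF x \<nu>_diff[OF x] d\<Psi>_diff[OF x]] open_\<Omega> x])
       (rule normal)
  from has_derivative_unique[OF this has_derivative_const]
  have "G (\<Psi> x) (covD \<nu> x w) (fd \<Psi> x u) + G (\<Psi> x) (\<nu> x) (covD (\<lambda>y. fd \<Psi> y u) x w) = 0" by metis
  then show ?thesis by (simp add: II_def)
qed

text \<open>Coordinates adapted to the splitting into normal and tangential directions. Its domain
  has the ambient dimension, so injectivity already makes every ambient vector decomposable.\<close>

definition frame :: "real^'n \<Rightarrow> real \<times> (real^'n) \<Rightarrow> real \<times> (real^'n)" where
  "frame x p = fst p *\<^sub>R \<nu> x + fd \<Psi> x (snd p)"

lemma linear_frame: "x \<in> \<Omega> \<Longrightarrow> linear (frame x)"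
  unfolding frame_def by (rule linearI) (simp_all add: d\<Psi>_lin scaleR_add_left scaleR_add_right)

lemma frame_normal:
  assumes x: "x \<in> \<Omega>" shows "G (\<Psi> x) (frame x p) (\<nu> x) = fst p * \<epsilon>"
  using normal[OF x] unit[OF x]
  by (simp add: frame_def G_lin[OF \<Psi>_in[OF x]] G_sym[OF \<Psi>_in[OF x], of "fd \<Psi> x u" for u])

lemma d\<Psi>_inj: "x \<in> \<Omega> \<Longrightarrow> fd \<Psi> x u = fd \<Psi> x v \<Longrightarrow> u = v"
proof (rule ccontr)
  assume x: "x \<in> \<Omega>" and e: "fd \<Psi> x u = fd \<Psi> x v" and "u \<noteq> v"
  then have "G (\<Psi> x) (fd \<Psi> x (u - v)) (fd \<Psi> x (u - v)) > 0" using h_pos by simp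
  moreover have "fd \<Psi> x (u - v) = 0" using e by (simp add: d\<Psi>_lin[OF x])
  ultimately show False by (simp add: G_lin[OF \<Psi>_in[OF x]])
qed

lemma surj_frame:
  assumes x: "x \<in> \<Omega>" shows "surj (frame x)"
proof -
  have "inj (frame x)"
  proof (rule linear_injective_0[OF linear_frame[OF x], THEN iffD2], intro allI impI)
    fix p assume p: "frame x p = 0"
    have "fst p * \<epsilon> = 0"
      using frame_normal[OF x, of p] p by (simp add: G_lin[OF \<Psi>_in[OF x]])
    then have "fst p = 0" using \<epsilon>_sq by auto
    moreover from this p have "fd \<Psi> x (snd p) = fd \<Psi> x 0" by (simp add: frame_def d\<Psi>_lin[OF x])
    then have "snd p = 0" by (rule d\<Psi>_inj[OF x])
    ultimately show "p = 0" by (simp add: prod_eq_iff)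
  qed
  then show ?thesis using linear_injective_imp_surjective linear_frame[OF x] by blast
qed

lemma tang_frame:
  assumes x: "x \<in> \<Omega>" shows "tang x (frame x p) = snd p"
proof -
  have "(\<epsilon> * (fst p * \<epsilon>)) = fst p" using \<epsilon>_sq by (simp add: algebra_simps)
  then have "frame x p - (\<epsilon> * G (\<Psi> x) (frame x p) (\<nu> x)) *\<^sub>R \<nu> x = fd \<Psi> x (snd p)"
    unfolding frame_normal[OF x] by (simp add: frame_def)
  then show ?thesis unfolding tang_def using d\<Psi>_inj[OF x] by auto
qed

text \<open>This makes the definite description in \<open>tang\<close> meaningful. The normal
  coefficient is \<open>\<epsilon> * G (\<Psi> x) y (\<nu> x)\<close> because \<open>\<nu>\<close>
  has square \<epsilon>, which is its own inverse.\<close>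

lemma d\<Psi>_tang:
  assumes x: "x \<in> \<Omega>" shows "fd \<Psi> x (tang x y) = y - (\<epsilon> * G (\<Psi> x) y (\<nu> x)) *\<^sub>R \<nu> x"
proof -
  obtain p where p: "y = frame x p" using surj_frame[OF x] by (metis surjD)
  have "(\<epsilon> * (fst p * \<epsilon>)) = fst p" using \<epsilon>_sq by (simp add: algebra_simps)
  then show ?thesis unfolding p tang_frame[OF x] frame_normal[OF x] by (simp add: frame_def)
qed

lemma tang_unique: "x \<in> \<Omega> \<Longrightarrow> fd \<Psi> x u = y - (\<epsilon> * G (\<Psi> x) y (\<nu> x)) *\<^sub>R \<nu> x \<Longrightarrow> tang x y = u"
  using d\<Psi>_tang d\<Psi>_inj by metis

lemma tang_d\<Psi>: "x \<in> \<Omega> \<Longrightarrow> tang x (fd \<Psi> x u) = u"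
  using tang_frame[of x "(0, u)"] by (simp add: frame_def)

lemma linear_tang:
  assumes x: "x \<in> \<Omega>" shows "linear (tang x)"
  by (rule linearI; rule tang_unique[OF x])
     (simp_all add: d\<Psi>_lin[OF x] d\<Psi>_tang[OF x] G_lin[OF \<Psi>_in[OF x]] algebra_simps)

lemma G_tang:
  assumes x: "x \<in> \<Omega>" shows "G (\<Psi> x) y (fd \<Psi> x u) = h x (tang x y) u"
  unfolding h_def d\<Psi>_tang[OF x] by (simp add: G_lin[OF \<Psi>_in[OF x]] normal[OF x])

section \<open>The induced metric, its connection and the shape operator\<close>

lemma bilinear_h: "x \<in> \<Omega> \<Longrightarrow> bilinear (h x)"
  unfolding h_def bilinear_def
  by (intro conjI allI linearI) (simp_all add: d\<Psi>_lin G_lin[OF \<Psi>_in])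

lemma h_sym: "x \<in> \<Omega> \<Longrightarrow> h x u v = h x v u"
  unfolding h_def by (rule G_sym[OF \<Psi>_in])

lemma nondegenerate_h: "x \<in> \<Omega> \<Longrightarrow> nondegenerate (h x)"
  unfolding nondegenerate_def h_def using h_pos by (metis less_irrefl)

lemmas h_cancel = nondegenerate_cancel[OF bilinear_h nondegenerate_h]

lemmas h_lin = bilinear_ladd[OF bilinear_h] bilinear_radd[OF bilinear_h] bilinear_lmul[OF bilinear_h]
  bilinear_rmul[OF bilinear_h] bilinear_lsub[OF bilinear_h] bilinear_rsub[OF bilinear_h]
  bilinear_lneg[OF bilinear_h] bilinear_rneg[OF bilinear_h]

lemma d\<Psi>_shape: "x \<in> \<Omega> \<Longrightarrow> fd \<Psi> x (shape x w) = - covD \<nu> x w"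
  by (simp add: shape_def d\<Psi>_lin d\<Psi>_tang covD_\<nu>_\<nu>)

lemma linear_shape:
  assumes x: "x \<in> \<Omega>" shows "linear (shape x)"
  unfolding shape_def
  by (rule linearI)
     (simp_all add: linear_add[OF linear_covD_\<nu>[OF x]] linear_cmul[OF linear_covD_\<nu>[OF x]]
      linear_add[OF linear_tang[OF x]] linear_cmul[OF linear_tang[OF x]])

lemma h_shape_II: "x \<in> \<Omega> \<Longrightarrow> h x (shape x v) w = G (\<Psi> x) (\<nu> x) (II x v w)"
  by (simp add: h_def d\<Psi>_shape G_lin[OF \<Psi>_in] covD_\<nu>_tangent)

lemma shape_self_adjoint: "x \<in> \<Omega> \<Longrightarrow> h x (shape x v) w = h x v (shape x w)"
  using h_shape_II[of x v w] h_shape_II[of x w v] II_sym[of x v w] h_sym[of x v "shape x w"] by simp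

text \<open>The Gauss formula; the factor \<epsilon> comes from projecting onto a normal of square
  \<epsilon>.\<close>

lemma gauss: "x \<in> \<Omega> \<Longrightarrow> II x v w = fd \<Psi> x (Gh x v w) + (\<epsilon> * h x (shape x v) w) *\<^sub>R \<nu> x"
  by (simp add: Gh_def d\<Psi>_tang h_shape_II G_sym[OF \<Psi>_in, of x "\<nu> x"])

lemma Gh_sym: "x \<in> \<Omega> \<Longrightarrow> Gh x v w = Gh x w v"
  unfolding Gh_def using II_sym by metis

lemma bilinear_Gh: 
  assumes x: "x \<in> \<Omega>" shows "bilinear (Gh x)"
  unfolding Gh_def bilinear_def
  by (intro conjI allI linearI)
     (simp_all add: bilinear_ladd[OF bilinear_II[OF x]] bilinear_radd[OF bilinear_II[OF x]]
      bilinear_lmul[OF bilinear_II[OF x]] bilinear_rmul[OF bilinear_II[OF x]]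
      linear_add[OF linear_tang[OF x]] linear_cmul[OF linear_tang[OF x]])

lemma h_has_derivative:
  assumes x: "x \<in> \<Omega>"
  shows "((\<lambda>y. h y u v) has_derivative (\<lambda>w. h x (Gh x w u) v + h x u (Gh x w v))) (at x)"
proof -
  have "((\<lambda>y. h y u v) has_derivative
    (\<lambda>w. G (\<Psi> x) (II x w u) (fd \<Psi> x v) + G (\<Psi> x) (fd \<Psi> x u) (II x w v))) (at x)"
    unfolding h_def using metric_along[OF x d\<Psi>_diff[OF x] d\<Psi>_diff[OF x]] by (simp add: II_def)
  moreover have "G (\<Psi> x) (II x w u) (fd \<Psi> x v) + G (\<Psi> x) (fd \<Psi> x u) (II x w v)
      = h x (Gh x w u) v + h x u (Gh x w v)" for w
    using G_tang[OF x, of "II x w u" v] G_tang[OF x, of "II x w v" u]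
      G_sym[OF \<Psi>_in[OF x], of "fd \<Psi> x u" "II x w v"] h_sym[OF x, of u] by (simp add: Gh_def)
  ultimately show ?thesis by simp
qed

text \<open>\<open>Gh\<close> is torsion-free since second derivatives of \<open>\<Psi>\<close> and
  the ambient symbols are symmetric, and metric since pairing with a tangent vector ignores the
  normal part of \<open>II\<close>.\<close>

lemma levi_civita_h:
  assumes x: "x \<in> \<Omega>" shows "levi_civita h x = Gh x"
proof (rule levi_civita_eq)
  show "fd (\<lambda>y. h y u v) x w = h x (Gh x w u) v + h x u (Gh x w v)" for u v w
    by (simp add: fd_eq[OF h_has_derivative[OF x]])
qed (rule bilinear_h[OF x] h_sym[OF x] nondegenerate_h[OF x] bilinear_Gh[OF x] Gh_sym[OF x])+

section \<open>The Codazzi equation and the covariant derivative of the shape operator\<close>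

lemma covD_\<nu>_has_derivative:
  assumes x: "x \<in> \<Omega>"
  shows "((\<lambda>y. covD \<nu> y w) has_derivative
    (\<lambda>v. fd (\<lambda>y. fd \<nu> y w) x v + (fd (\<lambda>z. \<Gamma> z (fd \<Psi> x w) (\<nu> x)) (\<Psi> x) (fd \<Psi> x v)
      + \<Gamma> (\<Psi> x) (fd (\<lambda>y. fd \<Psi> y w) x v) (\<nu> x) + \<Gamma> (\<Psi> x) (fd \<Psi> x w) (fd \<nu> x v)))) (at x)"
proof -
  have 1: "((\<lambda>y. \<Gamma> (\<Psi> y) a b) has_derivative (\<lambda>v. fd (\<lambda>z. \<Gamma> z a b) (\<Psi> x) (fd \<Psi> x v))) (at x)" for a b
    using diff_chain_at[OF fd_has[OF \<Psi>_diff[OF x]] fd_has[OF \<Gamma>_diff[OF \<Psi>_in[OF x], of a b]]]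
    by (simp add: o_def)
  show ?thesis unfolding covD_def
    by (rule has_derivative_add[OF fd_has[OF d\<nu>_diff[OF x]]
          has_derivative_bilinear_family[OF open_\<Omega> x _ 1 fd_has[OF d\<Psi>_diff[OF x]] fd_has[OF \<nu>_diff[OF x]]]])
       (rule \<Gamma>_bil[OF \<Psi>_in])
qed

text \<open>This avoids differentiating \<open>tang\<close>: \<open>shape y w\<close> is the dual,
  with respect to \<open>h y\<close>, of a functional built from \<open>covD \<nu>\<close>, which is
  differentiable.\<close>

lemma shape_diff:
  assumes x: "x \<in> \<Omega>" shows "(\<lambda>y. shape y w) differentiable (at x)"
proof (rule differentiable_metric_dual[OF open_\<Omega> x bilinear_h nondegenerate_h])
  show "(\<lambda>y. h y u v) differentiable (at x)" for u v
    using differentiableI[OF h_has_derivative[OF x]] .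
  show "(\<lambda>y. - G (\<Psi> y) (covD \<nu> y w) (fd \<Psi> y z)) differentiable (at x)" for z
    by (intro differentiable_minus differentiableI[OF metric_along[OF x differentiableI[OF covD_\<nu>_has_derivative[OF x]] d\<Psi>_diff[OF x]]])
  show "h y (shape y w) z = - G (\<Psi> y) (covD \<nu> y w) (fd \<Psi> y z)" if "y \<in> \<Omega>" for y z
    using that by (simp add: h_def d\<Psi>_shape G_lin[OF \<Psi>_in])
qed

text \<open>Since \<open>covD \<nu> y w\<close> is tangent, its covariant derivative is that of a
  tangent field, and the Gauss formula can split it.\<close>

lemma covD_covD_\<nu>:
  assumes x: "x \<in> \<Omega>"
  shows "covD (\<lambda>y. covD \<nu> y w) x v = - (II x v (shape x w) + fd \<Psi> x (fd (\<lambda>y. shape y w) x v))"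
proof -
  have e: "covD \<nu> y w = - fd \<Psi> y (shape y w)" if "y \<in> \<Omega>" for y
    using d\<Psi>_shape[OF that] by simp
  have "fd (\<lambda>y. covD \<nu> y w) x v = fd (\<lambda>y. - fd \<Psi> y (shape y w)) x v"
    by (simp add: fd_cong_open[OF open_\<Omega> x e])
  also have "\<dots> = - fd (\<lambda>y. fd \<Psi> y (shape y w)) x v"
    using fd_eq[OF has_derivative_minus[OF fd_has[OF covD_tangent(1)[OF x shape_diff[OF x]]]]] by metis
  finally have "covD (\<lambda>y. covD \<nu> y w) x v = - covD (\<lambda>y. fd \<Psi> y (shape y w)) x v"
    by (simp add: covD_def[of "\<lambda>y. covD \<nu> y w"] covD_def[of "\<lambda>y. fd \<Psi> y (shape y w)"] e[OF x] \<Gamma>_lin[OF \<Psi>_in[OF x]])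
  then show ?thesis by (simp add: covD_tangent(2)[OF x shape_diff[OF x]])
qed

text \<open>Coordinate fields commute, so the curvature is the antisymmetrised second covariant
  derivative of \<open>\<nu>\<close>; the second derivatives of \<open>\<nu>\<close> and of
  \<open>\<Psi>\<close> drop out by symmetry.\<close>

lemma codazzi:
  assumes x: "x \<in> \<Omega>"
  shows "R (\<Psi> x) (fd \<Psi> x v) (fd \<Psi> x w) (\<nu> x) = - fd \<Psi> x (dshape x v w - dshape x w v)"
proof -
  have "R (\<Psi> x) (fd \<Psi> x v) (fd \<Psi> x w) (\<nu> x) = covD (\<lambda>y. covD \<nu> y w) x v - covD (\<lambda>y. covD \<nu> y v) x w"
    using smooth_on_second_symmetric[OF open_\<Omega> x \<nu>_smooth, of w v] second_sym[OF x, of w v]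
    unfolding covD_def[of "\<lambda>y. covD \<nu> y w" for w] fd_eq[OF covD_\<nu>_has_derivative[OF x]] curv_def
    by (simp add: covD_def \<Gamma>_lin[OF \<Psi>_in[OF x]])
  \<comment> \<open>The normal parts are both given by \<open>h x (shape x v) (shape x w)\<close>
    and cancel. The terms \<open>shape x (Gh x v w)\<close> cancel because \<open>Gh\<close> is
    symmetric.\<close>
  also have "\<dots> = - fd \<Psi> x (dshape x v w - dshape x w v)"
    using h_sym[OF x, of "shape x v" "shape x w"]
    unfolding covD_covD_\<nu>[OF x] gauss[OF x] dshape_def
    by (simp add: d\<Psi>_lin[OF x] Gh_sym[OF x, of v w])
  finally show ?thesis .
qed

lemma dshape_swap:
  assumes x: "x \<in> \<Omega>"
  shows "dshape x v w = dshape x w v - tang x (R (\<Psi> x) (fd \<Psi> x v) (fd \<Psi> x w) (\<nu> x))"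
  unfolding codazzi[OF x]
  by (simp add: linear_neg[OF linear_tang[OF x]] tang_d\<Psi>[OF x])

text \<open>The derivative of the self-adjointness of \<open>shape\<close>; the terms in which
  \<open>Gh\<close> acts on u or w match after moving \<open>shape\<close> across
  \<open>h\<close>.\<close>

lemma dshape_self_adjoint:
  assumes x: "x \<in> \<Omega>" shows "h x (dshape x v u) w = h x u (dshape x v w)"
proof -
  have d: "((\<lambda>y. h y (a y) (b y)) has_derivative (\<lambda>v. (h x (Gh x v (a x)) (b x) + h x (a x) (Gh x v (b x)))
      + h x (fd a x v) (b x) + h x (a x) (fd b x v))) (at x)"
    if "a differentiable (at x)" "b differentiable (at x)" for a b
    by (rule has_derivative_bilinear_family[OF open_\<Omega> x bilinear_h h_has_derivative[OF x] fd_has[OF that(1)] fd_has[OF that(2)]])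
  have 1: "((\<lambda>y. h y (shape y u) w) has_derivative (\<lambda>v. (h x (Gh x v (shape x u)) w + h x (shape x u) (Gh x v w))
      + h x (fd (\<lambda>y. shape y u) x v) w)) (at x)"
    using d[OF shape_diff[OF x, of u] differentiable_const[of w]] by (simp add: bilinear_rzero[OF bilinear_h[OF x]])
  have 2: "((\<lambda>y. h y u (shape y w)) has_derivative (\<lambda>v. (h x (Gh x v u) (shape x w) + h x u (Gh x v (shape x w)))
      + h x u (fd (\<lambda>y. shape y w) x v))) (at x)"
    using d[OF differentiable_const[of u] shape_diff[OF x, of w]] by (simp add: bilinear_lzero[OF bilinear_h[OF x]])
  have "((\<lambda>y. h y (shape y u) w) has_derivative (\<lambda>v. (h x (Gh x v u) (shape x w) + h x u (Gh x v (shape x w)))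
      + h x u (fd (\<lambda>y. shape y w) x v))) (at x)"
    by (rule has_derivative_transform_within_open[OF 2 open_\<Omega> x]) (simp add: shape_self_adjoint)
  from has_derivative_unique[OF 1 this]
  have "(h x (Gh x v (shape x u)) w + h x (shape x u) (Gh x v w)) + h x (fd (\<lambda>y. shape y u) x v) w
     = (h x (Gh x v u) (shape x w) + h x u (Gh x v (shape x w))) + h x u (fd (\<lambda>y. shape y w) x v)"
    by metis
  then show ?thesis
    using shape_self_adjoint[OF x, of "Gh x v u" w] shape_self_adjoint[OF x, of u "Gh x v w"]
    unfolding dshape_def by (simp add: h_lin[OF x])
qed

text \<open>The connection terms of \<open>dshape\<close> are the commutator of
  \<open>Gh x v\<close> and \<open>shape x\<close>, which has trace zero.\<close>

lemma ltrace_dshape: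
  assumes x: "x \<in> \<Omega>" shows "ltrace (dshape x v) = fd (\<lambda>y. ltrace (shape y)) x v"
proof -
  have "((\<lambda>y. ltrace (shape y)) has_derivative (\<lambda>v. \<Sum>b\<in>Basis. fd (\<lambda>y. shape y b) x v \<bullet> b)) (at x)"
    unfolding ltrace_def
    by (intro has_derivative_sum has_derivative_inner_left fd_has[OF shape_diff[OF x]])
  then have 1: "fd (\<lambda>y. ltrace (shape y)) x v = ltrace (\<lambda>w. fd (\<lambda>y. shape y w) x v)"
    by (simp add: fd_eq ltrace_def)
  have "linear (Gh x v)" using bilinear_Gh[OF x] by (simp add: bilinear_def)
  from ltrace_commute[OF this linear_shape[OF x]]
  show ?thesis unfolding dshape_def[abs_def] ltrace_diff ltrace_add 1 by simp
qed

section \<open>Curvature traces and the Laplacian of the support function\<close>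

lemma R_linear:
  assumes y: "y \<in> W"
  shows "linear (\<lambda>u. R y u v w)" "linear (\<lambda>v. R y u v w)"
proof -
  have 1: "linear (\<lambda>u. fd (\<lambda>z. \<Gamma> z u w) y v)" for v w
    by (rule linear_fd_family[of W y "\<lambda>z u. \<Gamma> z u w", OF open_W y _ \<Gamma>_diff[OF y]])
       (use \<Gamma>_bil in \<open>unfold bilinear_def, blast\<close>)
  have 2: "linear (fd (\<lambda>z. \<Gamma> z v w) y)" for v w by (rule linear_fd[OF \<Gamma>_diff[OF y]])
  show "linear (\<lambda>u. R y u v w)" "linear (\<lambda>v. R y u v w)"
    unfolding curv_def
    by (rule linearI; simp add: linear_add[OF 1] linear_cmul[OF 1] linear_add[OF 2] linear_cmul[OF 2]
        \<Gamma>_lin[OF y] algebra_simps)+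
qed

lemma linear_Ric: "y \<in> W \<Longrightarrow> linear (\<lambda>v. Ric y v w)"
  unfolding ric_def
  by (rule linearI)
     (simp_all add: linear_add[OF R_linear(2)] linear_cmul[OF R_linear(2)] ltrace_add ltrace_scaleR)

text \<open>Computing the ambient trace in the adapted frame gives the tangential trace plus a
  normal slot. That slot is \<epsilon> times the product of R(\<nu>, z)\<nu> with \<nu>, zero by
  \<open>skew\<close>.\<close>

lemma ltrace_tang_R:
  assumes x: "x \<in> \<Omega>" and skew: "\<And>u v w. G (\<Psi> x) (R (\<Psi> x) u v w) w = 0"
  shows "ltrace (\<lambda>u. tang x (R (\<Psi> x) (fd \<Psi> x u) z (\<nu> x))) = Ric (\<Psi> x) z (\<nu> x)"
proof -
  define L where "L u = R (\<Psi> x) u z (\<nu> x)" for u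
  \<comment> \<open>The inverse of \<open>frame x\<close>; conjugating by it does not change the
    trace.\<close>
  define J where "J y = (\<epsilon> * G (\<Psi> x) y (\<nu> x), tang x y)" for y
  have L: "linear L" unfolding L_def by (rule R_linear(1)[OF \<Psi>_in[OF x]])
  have J: "linear J" unfolding J_def
    by (rule linearI) (simp_all add: G_lin[OF \<Psi>_in[OF x]] linear_add[OF linear_tang[OF x]]
       linear_cmul[OF linear_tang[OF x]] algebra_simps)
  have FJ: "frame x (J y) = y" for y by (simp add: frame_def J_def d\<Psi>_tang[OF x])
  have LF: "linear (\<lambda>p. L (frame x p))"
    using linear_compose[OF linear_frame[OF x] L] by (simp add: o_def)
  have "Ric (\<Psi> x) z (\<nu> x) = ltrace (\<lambda>u. L (frame x (J u)))"
    by (simp add: ric_def FJ L_def)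
  also have "\<dots> = ltrace (\<lambda>p. J (L (frame x p)))" by (rule ltrace_commute[OF LF J])
  also have "\<dots> = \<epsilon> * G (\<Psi> x) (L (\<nu> x)) (\<nu> x) + ltrace (\<lambda>u. tang x (L (fd \<Psi> x u)))"
    by (simp add: ltrace_prod J_def frame_def d\<Psi>_lin[OF x])
  finally show ?thesis using skew by (simp add: L_def)
qed

text \<open>The hypothesis \<open>V\<close> says that \<open>V\<close> is a closed conformal field with factor \<open>\<phi>\<close>.\<close>

lemma laplacian_support:
  fixes V :: "real \<times> (real^'n) \<Rightarrow> real \<times> (real^'n)" and \<phi> :: "real \<times> (real^'n) \<Rightarrow> real"
  assumes x: "x \<in> \<Omega>" and V_diff: "\<And>y. y \<in> W \<Longrightarrow> V differentiable (at y)"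
    and V: "\<And>y u. y \<in> W \<Longrightarrow> fd V y u + \<Gamma> y u (V y) = \<phi> y *\<^sub>R u"
    and skew: "\<And>u v w. G (\<Psi> x) (R (\<Psi> x) u v w) w = 0"
    and \<eta>: "\<And>y. y \<in> \<Omega> \<Longrightarrow> \<eta> y = G (\<Psi> y) (V (\<Psi> y)) (\<nu> y)"
  shows "local_laplacian h \<eta> x = - \<phi> (\<Psi> x) * ltrace (shape x) - \<epsilon> * \<eta> x * ltrace (\<lambda>v. shape x (shape x v))
    - fd (\<lambda>y. ltrace (shape y)) x (tang x (V (\<Psi> x)))
    + Ric (\<Psi> x) (V (\<Psi> x)) (\<nu> x) - \<epsilon> * \<eta> x * Ric (\<Psi> x) (\<nu> x) (\<nu> x)"
proof -
  define Z where "Z = tang x (V (\<Psi> x))"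
  have Vd: "(\<lambda>y. V (\<Psi> y)) differentiable (at y)" if "y \<in> \<Omega>" for y
    using differentiable_chain_at[OF \<Psi>_diff[OF that] V_diff[OF \<Psi>_in[OF that]]] by (simp add: o_def)
  have cV: "covD (\<lambda>y. V (\<Psi> y)) y w = \<phi> (\<Psi> y) *\<^sub>R fd \<Psi> y w" if "y \<in> \<Omega>" for y w
    using V[OF \<Psi>_in[OF that], of "fd \<Psi> y w"] fd_chain[OF \<Psi>_diff[OF that] V_diff[OF \<Psi>_in[OF that]]]
    by (simp add: covD_def)
  \<comment> \<open>The derivative of \<open>V\<close> is a multiple of \<open>fd \<Psi> y w\<close>
    and hence orthogonal to \<open>\<nu>\<close>, so only the derivative of \<open>\<nu>\<close>
    contributes.\<close>
  have d\<eta>: "fd \<eta> y w = - G (\<Psi> y) (V (\<Psi> y)) (fd \<Psi> y (shape y w))" if y: "y \<in> \<Omega>" for y w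
  proof -
    have "(\<eta> has_derivative (\<lambda>w. G (\<Psi> y) (covD (\<lambda>y. V (\<Psi> y)) y w) (\<nu> y) + G (\<Psi> y) (V (\<Psi> y)) (covD \<nu> y w))) (at y)"
      by (rule has_derivative_transform_within_open[OF metric_along[OF y Vd[OF y] \<nu>_diff[OF y]] open_\<Omega> y])
         (simp add: \<eta>)
    then show ?thesis
      using normal[OF y, of w]
      by (simp add: fd_eq cV[OF y] d\<Psi>_shape[OF y] G_lin[OF \<Psi>_in[OF y]] G_sym[OF \<Psi>_in[OF y], of "fd \<Psi> y w"])
  qed
  have VZ: "G (\<Psi> x) (V (\<Psi> x)) (fd \<Psi> x u) = h x Z u" for u
    by (simp add: Z_def G_tang[OF x])
  have dd\<eta>: "fd (\<lambda>y. fd \<eta> y w) x v = - (\<phi> (\<Psi> x) * h x v (shape x w)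
      + h x Z (Gh x v (shape x w)) + \<epsilon> * h x (shape x v) (shape x w) * \<eta> x + h x Z (fd (\<lambda>y. shape y w) x v))" for v w
  proof -
    let ?Y = "\<lambda>y. fd \<Psi> y (shape y w)"
    have "fd (\<lambda>y. fd \<eta> y w) x = fd (\<lambda>y. - G (\<Psi> y) (V (\<Psi> y)) (?Y y)) x"
      by (rule fd_cong_open[OF open_\<Omega> x d\<eta>])
    also have "\<dots> = (\<lambda>v. - (G (\<Psi> x) (covD (\<lambda>y. V (\<Psi> y)) x v) (?Y x) + G (\<Psi> x) (V (\<Psi> x)) (covD ?Y x v)))"
      by (rule fd_eq[OF has_derivative_minus[OF metric_along[OF x Vd[OF x] covD_tangent(1)[OF x shape_diff[OF x]]]]])
    finally have "fd (\<lambda>y. fd \<eta> y w) x v = - (G (\<Psi> x) (covD (\<lambda>y. V (\<Psi> y)) x v) (?Y x) + G (\<Psi> x) (V (\<Psi> x)) (covD ?Y x v))"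
      by simp
    moreover have "G (\<Psi> x) (covD (\<lambda>y. V (\<Psi> y)) x v) (?Y x) = \<phi> (\<Psi> x) * h x v (shape x w)"
      by (simp add: cV[OF x] G_lin[OF \<Psi>_in[OF x]] h_def)
    moreover have "G (\<Psi> x) (V (\<Psi> x)) (covD ?Y x v) = h x Z (Gh x v (shape x w))
        + \<epsilon> * h x (shape x v) (shape x w) * \<eta> x + h x Z (fd (\<lambda>y. shape y w) x v)"
      unfolding covD_tangent(2)[OF x shape_diff[OF x]] gauss[OF x]
      by (simp add: G_lin[OF \<Psi>_in[OF x]] VZ \<eta>[OF x])
    ultimately show ?thesis by simp
  qed
  \<comment> \<open>The endomorphism that represents the Hessian, found by moving
    \<open>shape\<close> and \<open>dshape\<close> off w by self-adjointness. The Laplacian is then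
    its ordinary trace.\<close>
  define Q where "Q v = - \<phi> (\<Psi> x) *\<^sub>R shape x v - (\<epsilon> * \<eta> x) *\<^sub>R shape x (shape x v) - dshape x v Z" for v
  have hess: "hessian h \<eta> x v w = h x (Q v) w" for v w
  proof -
    have "hessian h \<eta> x v w = fd (\<lambda>y. fd \<eta> y w) x v - fd \<eta> x (Gh x v w)"
      by (simp add: hessian_def cov_def levi_civita_h[OF x])
    also have "\<dots> = - \<phi> (\<Psi> x) * h x v (shape x w) - \<epsilon> * \<eta> x * h x (shape x v) (shape x w) - h x Z (dshape x v w)"
      unfolding dd\<eta> d\<eta>[OF x] VZ dshape_def by (simp add: h_lin[OF x] algebra_simps)
    also have "\<dots> = h x (Q v) w"
      unfolding Q_def using dshape_self_adjoint[OF x, of v Z w]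
      by (simp add: h_lin[OF x] shape_self_adjoint[OF x])
    finally show ?thesis .
  qed
  have "(THE q. \<forall>z. h x q z = hessian h \<eta> x v z) = Q v" for v
    by (rule the_equality) (use hess h_cancel[OF x x] in \<open>auto\<close>)
  then have "local_laplacian h \<eta> x = ltrace Q"
    by (simp add: local_laplacian_def metric_trace_def)
  \<comment> \<open>In \<open>dshape x v Z\<close> the traced vector is the direction of
    differentiation. The Codazzi equation exchanges it with \<open>Z\<close>, so that
    \<open>ltrace_dshape\<close> applies, at the cost of a curvature term.\<close>
  also have "Q = (\<lambda>v. ((- \<phi> (\<Psi> x)) *\<^sub>R shape x v - (\<epsilon> * \<eta> x) *\<^sub>R shape x (shape x v)) -
     (dshape x Z v - tang x (R (\<Psi> x) (fd \<Psi> x v) (fd \<Psi> x Z) (\<nu> x))))"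
    unfolding Q_def using dshape_swap[OF x, of _ Z] by simp
  also have "ltrace \<dots> = - \<phi> (\<Psi> x) * ltrace (shape x) - \<epsilon> * \<eta> x * ltrace (\<lambda>v. shape x (shape x v))
      - fd (\<lambda>y. ltrace (shape y)) x Z + Ric (\<Psi> x) (fd \<Psi> x Z) (\<nu> x)"
    unfolding ltrace_diff ltrace_scaleR ltrace_tang_R[OF x skew] ltrace_dshape[OF x, symmetric]
    by simp
  also have "Ric (\<Psi> x) (fd \<Psi> x Z) (\<nu> x) = Ric (\<Psi> x) (V (\<Psi> x)) (\<nu> x) - \<epsilon> * \<eta> x * Ric (\<Psi> x) (\<nu> x) (\<nu> x)"
    unfolding Z_def d\<Psi>_tang[OF x] \<eta>[OF x]
    by (simp add: linear_diff[OF linear_Ric[OF \<Psi>_in[OF x]]] linear_cmul[OF linear_Ric[OF \<Psi>_in[OF x]]])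
  finally show ?thesis by (simp add: Z_def)
qed

end


section \<open>Warped products in a chart\<close>

locale riemannian_chart =
  fixes U :: "(real^'n) set" and g :: "real^'n \<Rightarrow> real^'n \<Rightarrow> real^'n \<Rightarrow> real"
  assumes open_U: "open U"
    and g_smooth: "\<And>u v. smooth_on U (\<lambda>y. g y u v)"
    and g_bil: "\<And>y. y \<in> U \<Longrightarrow> bilinear (g y)"
    and g_sym: "\<And>y u v. y \<in> U \<Longrightarrow> g y u v = g y v u"
    and g_pos: "\<And>y u. y \<in> U \<Longrightarrow> u \<noteq> 0 \<Longrightarrow> g y u u > 0"
begin

abbreviation "LC \<equiv> levi_civita g"

lemma g_nondeg: "y \<in> U \<Longrightarrow> nondegenerate (g y)"
  unfolding nondegenerate_def using g_pos by (metis less_irrefl)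

lemma g_diff: "y \<in> U \<Longrightarrow> (\<lambda>z. g z u v) differentiable (at y)"
  by (rule smooth_on_differentiable[OF g_smooth])

lemma dg_diff: "y \<in> U \<Longrightarrow> (\<lambda>z. fd (\<lambda>z. g z u v) z w) differentiable (at y)"
  by (rule smooth_on_differentiable[OF smooth_on_fd[OF g_smooth]])

lemmas g_lin = bilinear_ladd[OF g_bil] bilinear_radd[OF g_bil] bilinear_lmul[OF g_bil]
  bilinear_rmul[OF g_bil] bilinear_lsub[OF g_bil] bilinear_rsub[OF g_bil]
  bilinear_lneg[OF g_bil] bilinear_rneg[OF g_bil] bilinear_lzero[OF g_bil] bilinear_rzero[OF g_bil]

lemma bilinear_dg:
  assumes y: "y \<in> U" shows "bilinear (\<lambda>u v. fd (\<lambda>z. g z u v) y w)"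
proof -
  have "linear (\<lambda>u. fd (\<lambda>z. g z u v) y w)" for v
    by (rule linear_fd_family[of U y "\<lambda>z u. g z u v", OF open_U y _ g_diff[OF y]])
       (use g_bil in \<open>unfold bilinear_def, blast\<close>)
  moreover have "linear (\<lambda>v. fd (\<lambda>z. g z u v) y w)" for u
    by (rule linear_fd_family[of U y "\<lambda>z v. g z u v", OF open_U y _ g_diff[OF y]])
       (use g_bil in \<open>unfold bilinear_def, blast\<close>)
  ultimately show ?thesis by (simp add: bilinear_def)
qed

lemma
  assumes y: "y \<in> U"
  shows LC_bil: "bilinear (LC y)" and LC_sym: "LC y u v = LC y v u"
    and LC_metric: "fd (\<lambda>z. g z u v) y w = g y (LC y w u) v + g y u (LC y w v)"
proof -
  have "fd (\<lambda>z. g z u v) y = fd (\<lambda>z. g z v u) y" for u v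
    by (rule fd_cong_open[OF open_U y]) (rule g_sym)
  then have "\<exists>!\<Gamma>. bilinear \<Gamma> \<and> (\<forall>u v. \<Gamma> u v = \<Gamma> v u) \<and>
           (\<forall>w u v. fd (\<lambda>z. g z u v) y w = g y (\<Gamma> w u) v + g y u (\<Gamma> w v))"
    by (intro levi_civita_ex1[OF g_bil[OF y] g_sym[OF y] g_nondeg[OF y]] bilinear_dg[OF y]
        linear_fd[OF g_diff[OF y]]) simp
  from theI'[OF this, folded levi_civita_def]
  show "bilinear (LC y)" "LC y u v = LC y v u"
    "fd (\<lambda>z. g z u v) y w = g y (LC y w u) v + g y u (LC y w v)" by blast+
qed

lemmas LC_lin = bilinear_ladd[OF LC_bil] bilinear_radd[OF LC_bil] bilinear_lmul[OF LC_bil]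
  bilinear_rmul[OF LC_bil] bilinear_lsub[OF LC_bil] bilinear_rsub[OF LC_bil]
  bilinear_lneg[OF LC_bil] bilinear_rneg[OF LC_bil]

text \<open>The right-hand side contains only first derivatives of \<open>g\<close>, which are
  differentiable; this is the form that \<open>differentiable_metric_dual\<close> asks for.\<close>

lemma koszul:
  assumes y: "y \<in> U"
  shows "g y (LC y u v) z = (fd (\<lambda>x. g x v z) y u + fd (\<lambda>x. g x u z) y v - fd (\<lambda>x. g x u v) y z) / 2"
  unfolding LC_metric[OF y]
  by (simp add: LC_sym[OF y, of v u] LC_sym[OF y, of z] g_sym[OF y, of v] g_sym[OF y, of u "LC y v z"])

lemma LC_diff:
  assumes y: "y \<in> U" shows "(\<lambda>z. LC z u v) differentiable (at y)"
  by (rule differentiable_metric_dual[OF open_U y g_bil g_nondeg g_diff[OF y] _ koszul])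
     (auto intro!: dg_diff[OF y] derivative_intros)

text \<open>The second derivative of \<open>g z w w\<close> in directions u and v is twice <D_u D_v
  w, w> + <D_v w, D_u w>, with D the connection. It is symmetric in u and v, and so is its last
  term; antisymmetrising leaves the curvature.\<close>

lemma curv_skew:
  assumes y: "y \<in> U" shows "g y (curv LC y u v w) w = 0"
proof -
  let ?D = "\<lambda>u v. fd (\<lambda>z. fd (\<lambda>z. g z w w) z v) y u"
  have "?D u v = 2 * (g y (LC y u (LC y v w)) w + g y (LC y v w) (LC y u w) + g y (fd (\<lambda>z. LC z v w) y u) w)" for u v
  proof -
    have "((\<lambda>z. 2 * g z (LC z v w) w) has_derivative (\<lambda>u. 2 * (fd (\<lambda>z. g z (LC y v w) w) y u
        + g y (fd (\<lambda>z. LC z v w) y u) w + g y (LC y v w) 0))) (at y)"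
      by (intro has_derivative_mult_right
          has_derivative_bilinear_family[OF open_U y g_bil fd_has[OF g_diff[OF y]] fd_has[OF LC_diff[OF y]] has_derivative_const])
    from fd_eq[OF this]
    have "fd (\<lambda>z. 2 * g z (LC z v w) w) y u = 2 * (g y (LC y u (LC y v w)) w + g y (LC y v w) (LC y u w) + g y (fd (\<lambda>z. LC z v w) y u) w)"
      by (simp add: g_lin[OF y] LC_metric[OF y])
    moreover have "fd (\<lambda>z. fd (\<lambda>z. g z w w) z v) y = fd (\<lambda>z. 2 * g z (LC z v w) w) y"
      by (rule fd_cong_open[OF open_U y]) (simp add: LC_metric g_sym[of _ w])
    ultimately show ?thesis by simp
  qed
  moreover have "?D u v = ?D v u" by (rule smooth_on_second_symmetric[OF open_U y g_smooth])
  ultimately show ?thesis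
    unfolding curv_def by (simp add: g_lin[OF y] g_sym[OF y, of "LC y v w" "LC y u w"])
qed

end

locale warped_chart = riemannian_chart U g
  for U :: "(real^'n) set" and g +
  fixes J :: "real set" and f f' f'' :: "real \<Rightarrow> real" and \<epsilon> :: real
  assumes open_J: "open J"
    and f_pos: "\<And>t. t \<in> J \<Longrightarrow> f t > 0"
    and f1: "\<And>t. t \<in> J \<Longrightarrow> (f has_real_derivative f' t) (at t)"
    and f2: "\<And>t. t \<in> J \<Longrightarrow> (f' has_real_derivative f'' t) (at t)"
    and eps_sq: "\<epsilon> * \<epsilon> = 1"
begin

definition G :: "real \<times> (real^'n) \<Rightarrow> real \<times> (real^'n) \<Rightarrow> real \<times> (real^'n) \<Rightarrow> real" where
  "G p u v = \<epsilon> * (fst u * fst v) + (f (fst p))\<^sup>2 * g (snd p) (snd u) (snd v)"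

text \<open>The familiar D_X dt = (f'/f) X for X tangent to the fibre, together with the dt-part
  -\<epsilon> (f'/f) <X, Y> of D_X Y. Since <X, Y> is f^2 times the fibre metric, the latter
  coefficient becomes f f'.\<close>

definition \<Gamma> :: "real \<times> (real^'n) \<Rightarrow> real \<times> (real^'n) \<Rightarrow> real \<times> (real^'n) \<Rightarrow> real \<times> (real^'n)" where
  "\<Gamma> p u v = (- \<epsilon> * (f (fst p) * f' (fst p)) * g (snd p) (snd u) (snd v),
     (f' (fst p) / f (fst p)) *\<^sub>R (fst u *\<^sub>R snd v + fst v *\<^sub>R snd u) + LC (snd p) (snd u) (snd v))"

lemma eps_cancel [simp]: "\<epsilon> * (\<epsilon> * a) = a"
  using eps_sq by (simp add: mult.assoc[symmetric])

lemma open_dom: "open (J \<times> U)"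
  using open_J open_U by (rule open_Times)

lemma f_ne: "t \<in> J \<Longrightarrow> f t \<noteq> 0"
  using f_pos by fastforce

lemma has_derivative_fst_comp:
  "(\<phi> has_real_derivative d) (at (fst p)) \<Longrightarrow> ((\<lambda>z. \<phi> (fst z)) has_derivative (\<lambda>w. d * fst w)) (at p)"
  using diff_chain_at[OF bounded_linear_imp_has_derivative[OF bounded_linear_fst], of \<phi> "\<lambda>h. d * h" p]
  by (simp add: o_def has_field_derivative_def)

lemma has_derivative_snd_comp:
  "\<phi> differentiable (at (snd p)) \<Longrightarrow> ((\<lambda>z. \<phi> (snd z)) has_derivative (\<lambda>w. fd \<phi> (snd p) (snd w))) (at p)"
  using diff_chain_at[OF bounded_linear_imp_has_derivative[OF bounded_linear_snd], of \<phi> "fd \<phi> (snd p)" p]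
  by (simp add: o_def fd_has)

lemma G_bil: "p \<in> J \<times> U \<Longrightarrow> bilinear (G p)"
  unfolding G_def bilinear_def
  by (intro conjI allI linearI) (auto simp: g_lin algebra_simps)

lemma G_sym: "p \<in> J \<times> U \<Longrightarrow> G p u v = G p v u"
  unfolding G_def by (auto simp: g_sym mult.commute)

lemma G_nondeg: assumes p: "p \<in> J \<times> U" shows "nondegenerate (G p)"
  unfolding nondegenerate_def
proof (intro allI impI)
  fix u :: "real \<times> (real^'n)" assume u: "u \<noteq> 0"
  have y: "snd p \<in> U" and t: "fst p \<in> J" using p by auto
  show "\<exists>v. G p u v \<noteq> 0"
  proof (cases "snd u = 0")
    case True
    then have "G p u (1, 0) \<noteq> 0"
      using u eps_sq by (auto simp: G_def prod_eq_iff g_lin[OF y])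
    then show ?thesis by blast
  next
    case False
    then have "G p u (0, snd u) \<noteq> 0"
      using g_pos[OF y False] f_ne[OF t] by (auto simp: G_def)
    then show ?thesis by blast
  qed
qed

lemma G_has_derivative:
  assumes p: "p \<in> J \<times> U"
  shows "((\<lambda>z. G z u v) has_derivative (\<lambda>w. G p (\<Gamma> p w u) v + G p u (\<Gamma> p w v))) (at p)"
proof -
  have y: "snd p \<in> U" and t: "fst p \<in> J" using p by auto
  have "((\<lambda>z. G z u v) has_derivative (\<lambda>w. 2 * f (fst p) * (f' (fst p) * fst w) * g (snd p) (snd u) (snd v)
     + (f (fst p))\<^sup>2 * fd (\<lambda>z. g z (snd u) (snd v)) (snd p) (snd w))) (at p)"
    unfolding G_def
    by (auto intro!: derivative_eq_intros has_derivative_fst_comp[OF f1[OF t]] has_derivative_snd_comp[OF g_diff[OF y]])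
  moreover have "2 * f (fst p) * (f' (fst p) * fst w) * g (snd p) (snd u) (snd v)
     + (f (fst p))\<^sup>2 * fd (\<lambda>z. g z (snd u) (snd v)) (snd p) (snd w) = G p (\<Gamma> p w u) v + G p u (\<Gamma> p w v)" for w
    using f_ne[OF t] g_sym[OF y, of "snd u" "snd w"]
    unfolding LC_metric[OF y] G_def \<Gamma>_def
    by (simp add: g_lin[OF y] power2_eq_square field_simps)
  ultimately show ?thesis by simp
qed

lemma \<Gamma>_bil: "p \<in> J \<times> U \<Longrightarrow> bilinear (\<Gamma> p)"
  unfolding \<Gamma>_def bilinear_def
  by (intro conjI allI linearI) (auto simp: g_lin LC_lin algebra_simps)

lemma \<Gamma>_sym: "p \<in> J \<times> U \<Longrightarrow> \<Gamma> p u v = \<Gamma> p v u"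
  unfolding \<Gamma>_def using g_sym[of "snd p" "snd u"] LC_sym[of "snd p" "snd u"] by (auto simp: add.commute)

lemma levi_civita_G:
  assumes p: "p \<in> J \<times> U" shows "levi_civita G p = \<Gamma> p"
proof (rule levi_civita_eq)
  show "fd (\<lambda>y. G y u v) p w = G p (\<Gamma> p w u) v + G p u (\<Gamma> p w v)" for u v w
    by (simp add: fd_eq[OF G_has_derivative[OF p]])
qed (rule G_bil[OF p] G_sym[OF p] G_nondeg[OF p] \<Gamma>_bil[OF p] \<Gamma>_sym[OF p])+

lemma \<Gamma>_has_derivative:
  assumes p: "p \<in> J \<times> U"
  defines "t \<equiv> fst p" and "y \<equiv> snd p"
  shows "((\<lambda>z. \<Gamma> z u v) has_derivative (\<lambda>w.
    (- \<epsilon> * ((f' t * f' t + f t * f'' t) * fst w * g y (snd u) (snd v)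
       + f t * f' t * fd (\<lambda>z. g z (snd u) (snd v)) y (snd w)),
     ((f'' t * f t - f' t * f' t) / (f t * f t) * fst w) *\<^sub>R (fst u *\<^sub>R snd v + fst v *\<^sub>R snd u)
       + fd (\<lambda>z. LC z (snd u) (snd v)) y (snd w)))) (at p)"
proof -
  have y: "snd p \<in> U" and t: "fst p \<in> J" using p by auto
  have 1: "((\<lambda>t. f t * f' t) has_real_derivative (f' t * f' t + f t * f'' t)) (at (fst p))"
    unfolding t_def using DERIV_mult[OF f1[OF t] f2[OF t]] by (simp add: algebra_simps)
  have 2: "((\<lambda>t. f' t / f t) has_real_derivative ((f'' t * f t - f' t * f' t) / (f t * f t))) (at (fst p))"
    unfolding t_def using DERIV_divide[OF f2[OF t] f1[OF t] f_ne[OF t]] .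
  have A: "((\<lambda>z. - \<epsilon> * (f (fst z) * f' (fst z)) * g (snd z) (snd u) (snd v)) has_derivative
      (\<lambda>w. - \<epsilon> * ((f' t * f' t + f t * f'' t) * fst w * g y (snd u) (snd v)
       + f t * f' t * fd (\<lambda>z. g z (snd u) (snd v)) y (snd w)))) (at p)"
    unfolding mult.assoc[of "- \<epsilon>"]
    by (rule has_derivative_mult_right)
       (use has_derivative_mult[OF has_derivative_fst_comp[OF 1] has_derivative_snd_comp[OF g_diff[OF y, of "snd u" "snd v"]]]
        in \<open>simp add: t_def y_def add.commute\<close>)
  have B: "((\<lambda>z. (f' (fst z) / f (fst z)) *\<^sub>R (fst u *\<^sub>R snd v + fst v *\<^sub>R snd u)) has_derivative
     (\<lambda>w. ((f'' t * f t - f' t * f' t) / (f t * f t) * fst w) *\<^sub>R (fst u *\<^sub>R snd v + fst v *\<^sub>R snd u))) (at p)"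
    using has_derivative_scaleR_left[OF has_derivative_fst_comp[OF 2]] by simp
  show ?thesis
    unfolding \<Gamma>_def
    by (rule has_derivative_Pair[OF A has_derivative_add[OF B has_derivative_snd_comp[OF LC_diff[OF y], folded y_def]]])
qed

text \<open>In the first component the derivatives of \<open>g\<close> are absorbed by
  \<open>LC_metric\<close> and the squares of \<open>f'\<close> cancel. In the second, (f'/f)' +
  (f'/f)^2 = f''/f, and the last term is the product of the coefficients f'/f and -\<epsilon> f
  f'.\<close>

lemma curv_\<Gamma>:
  assumes p: "p \<in> J \<times> U"
  defines "t \<equiv> fst p" and "y \<equiv> snd p"
  shows "curv \<Gamma> p (a, u) (c, z) (b, w) =
    (- \<epsilon> * (f t * f'' t) * (a * g y z w - c * g y u w),
     (f'' t / f t * b) *\<^sub>R (a *\<^sub>R z - c *\<^sub>R u) + curv LC y u z w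
       - (\<epsilon> * (f' t)\<^sup>2) *\<^sub>R (g y z w *\<^sub>R u - g y u w *\<^sub>R z))"
proof -
  have y: "y \<in> U" and t: "f t \<noteq> 0" using p f_ne by (auto simp: y_def t_def)
  have q: "(f'' t * f t - f' t * f' t) / (f t * f t) = f'' t / f t - f' t / f t * (f' t / f t)"
    using t by (simp add: field_simps)
  \<comment> \<open>With the two quotients as atoms, both components become polynomial
    identities.\<close>
  define q0 where "q0 = f' t / f t"
  define q1 where "q1 = f'' t / f t"
  have f'0: "f' t = q0 * f t" and f''0: "f'' t = q1 * f t" using t by (simp_all add: q0_def q1_def)
  have e1: "fst (curv \<Gamma> p (a, u) (c, z) (b, w)) = - \<epsilon> * (f t * f'' t) * (a * g y z w - c * g y u w)"
    unfolding curv_def fd_eq[OF \<Gamma>_has_derivative[OF p]] t_def[symmetric] y_def[symmetric]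
    unfolding \<Gamma>_def t_def[symmetric] y_def[symmetric] LC_metric[OF y] q
    unfolding q0_def[symmetric] q1_def[symmetric] f'0 f''0
    by (simp add: g_lin[OF y] LC_sym[OF y, of z u] g_sym[OF y, of z u] g_sym[OF y, of z "LC y u w"] algebra_simps)
  have e2: "snd (curv \<Gamma> p (a, u) (c, z) (b, w)) = (f'' t / f t * b) *\<^sub>R (a *\<^sub>R z - c *\<^sub>R u) + curv LC y u z w
       - (\<epsilon> * (f' t)\<^sup>2) *\<^sub>R (g y z w *\<^sub>R u - g y u w *\<^sub>R z)"
    unfolding curv_def fd_eq[OF \<Gamma>_has_derivative[OF p]] t_def[symmetric] y_def[symmetric]
    unfolding \<Gamma>_def t_def[symmetric] y_def[symmetric] q
    unfolding q0_def[symmetric] q1_def[symmetric] f'0 f''0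
    by (simp add: LC_lin[OF y] LC_sym[OF y, of z u] algebra_simps power2_eq_square)
  show ?thesis by (rule prod_eqI) (simp_all only: e1 e2 fst_conv snd_conv)
qed

text \<open>\<open>curv_skew\<close> is about positive definite metrics, whereas \<open>G\<close> is
  indefinite for \<epsilon> = -1; the explicit formula reduces the claim to the fibre.\<close>

lemma curv_\<Gamma>_skew:
  assumes p: "p \<in> J \<times> U" shows "G p (curv \<Gamma> p u v w) w = 0"
proof -
  obtain a u0 c z b w0 where s: "u = (a, u0)" "v = (c, z)" "w = (b, w0)" by (metis prod.exhaust)
  have y: "snd p \<in> U" and t: "f (fst p) \<noteq> 0" using p f_ne by auto
  show ?thesis
    unfolding s curv_\<Gamma>[OF p] G_def
    using curv_skew[OF y, of u0 z w0] t
    by (simp add: g_lin[OF y] power2_eq_square field_simps)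
qed

text \<open>The dt-slot of the trace gives \<open>- \<epsilon> * (f t * f'' t) * g y z w\<close>. In
  the fibre the identity contributes the factor n, and the identity minus a rank-one map contributes
  n - 1.\<close>

lemma ric_\<Gamma>:
  assumes p: "p \<in> J \<times> U"
  defines "t \<equiv> fst p" and "y \<equiv> snd p"
  shows "ric \<Gamma> p (c, z) (b, w) = - (real CARD('n) * (f'' t / f t) * (c * b)) + ric LC y z w
     - \<epsilon> * g y z w * (f t * f'' t + (real CARD('n) - 1) * (f' t)\<^sup>2)"
proof -
  have y: "y \<in> U" using p by (auto simp: y_def)
  have lg: "linear (\<lambda>u. g y u w)" using g_bil[OF y] by (simp add: bilinear_def)
  have "ric \<Gamma> p (c, z) (b, w) = - \<epsilon> * (f t * f'' t) * g y z w
     + ltrace (\<lambda>u. (- (f'' t / f t * b * c)) *\<^sub>R u + curv LC y u z w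
       - (\<epsilon> * (f' t)\<^sup>2) *\<^sub>R (g y z w *\<^sub>R u - g y u w *\<^sub>R z))"
    unfolding ric_def ltrace_prod zero_prod_def
    unfolding curv_\<Gamma>[OF p, folded t_def y_def]
    by (simp add: g_lin[OF y] mult.assoc)
  also have "\<dots> = - \<epsilon> * (f t * f'' t) * g y z w + (- (f'' t / f t * b * c)) * real CARD('n) + ric LC y z w
     - (\<epsilon> * (f' t)\<^sup>2) * (g y z w * real CARD('n) - g y z w)"
    unfolding ltrace_add ltrace_diff ltrace_scaleR ltrace_rank_one[OF lg] ltrace_id ric_def by simp
  finally show ?thesis by (simp add: algebra_simps)
qed

end


section \<open>Tangent vectors and differentials in charts\<close>

text \<open>The part of a smooth structure on which the calculus of tangent vectors rests. It is
  easily checked for the interval and for the warped product, without their topologies.\<close>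

definition diff_atlas :: "('m, 'a::euclidean_space) manifold \<Rightarrow> bool" where
  "diff_atlas M \<longleftrightarrow> (\<forall>c\<in>atlas M. inj_on (snd c) (fst c)) \<and>
     (\<forall>c\<in>atlas M. \<forall>d\<in>atlas M. open (snd c ` (fst c \<inter> fst d)) \<and>
        (\<forall>x\<in>snd c ` (fst c \<inter> fst d). (snd d \<circ> chart_inv c) differentiable (at x)))"

lemma chart_inv_eq: "inj_on (snd c) (fst c) \<Longrightarrow> p \<in> fst c \<Longrightarrow> chart_inv c (snd c p) = p"
  unfolding chart_inv_def by (rule inv_into_f_f)

lemma charts_atD: "c \<in> charts_at M p \<Longrightarrow> c \<in> atlas M" "c \<in> charts_at M p \<Longrightarrow> p \<in> fst c"
  by (auto simp: charts_at_def)

lemma chart_at_in: "c \<in> charts_at M p \<Longrightarrow> chart_at M p \<in> charts_at M p"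
  unfolding chart_at_def by (rule someI)

lemma smooth_manifold_chart:
  assumes M: "smooth_manifold M" and c: "c \<in> atlas M"
  shows "inj_on (snd c) (fst c)" "openin (mtop M) (fst c)"
    and "\<And>A. openin (mtop M) A \<Longrightarrow> A \<subseteq> fst c \<Longrightarrow> open (snd c ` A)"
proof -
  have o: "openin (mtop M) (fst c)" "open (snd c ` fst c)"
    and h: "homeomorphic_map (subtopology (mtop M) (fst c)) (top_of_set (snd c ` fst c)) (snd c)"
    using M c by (auto simp: smooth_manifold_def)
  have t: "topspace (subtopology (mtop M) (fst c)) = fst c"
    using openin_subset[OF o(1)] by auto
  show "inj_on (snd c) (fst c)" using homeomorphic_imp_injective_map[OF h] t by simp
  show "openin (mtop M) (fst c)" by (rule o)
  show "open (snd c ` A)" if A: "openin (mtop M) A" "A \<subseteq> fst c" for A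
  proof -
    have "openin (subtopology (mtop M) (fst c)) A" using A by (auto simp: openin_subtopology)
    then have "openin (top_of_set (snd c ` fst c)) (snd c ` A)"
      using homeomorphic_imp_open_map[OF h] by (auto simp: open_map_def)
    then show ?thesis using o(2) openin_open_eq by blast
  qed
qed

lemma diff_atlas_smooth_manifold:
  assumes M: "smooth_manifold M" shows "diff_atlas M"
  unfolding diff_atlas_def
proof (intro conjI ballI)
  show "inj_on (snd c) (fst c)" if "c \<in> atlas M" for c by (rule smooth_manifold_chart[OF M that])
  fix c d assume c: "c \<in> atlas M" and d: "d \<in> atlas M"
  show "open (snd c ` (fst c \<inter> fst d))"
    by (rule smooth_manifold_chart(3)[OF M c openin_Int[OF smooth_manifold_chart(2)[OF M c] smooth_manifold_chart(2)[OF M d]]]) simp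
  have "smooth_on (snd c ` (fst c \<inter> fst d)) (snd d \<circ> chart_inv c)"
    using M c d by (auto simp: smooth_manifold_def)
  then show "(snd d \<circ> chart_inv c) differentiable (at x)" if "x \<in> snd c ` (fst c \<inter> fst d)" for x
    using smooth_on_differentiable that by blast
qed

context
  fixes M :: "('m, 'a::euclidean_space) manifold"
  assumes M: "diff_atlas M"
begin

lemma atlas_inj: "c \<in> atlas M \<Longrightarrow> inj_on (snd c) (fst c)"
  using M by (simp add: diff_atlas_def)

lemma atlas_inv: "c \<in> atlas M \<Longrightarrow> p \<in> fst c \<Longrightarrow> chart_inv c (snd c p) = p"
  by (rule chart_inv_eq[OF atlas_inj])

lemma trans_open: "c \<in> atlas M \<Longrightarrow> d \<in> atlas M \<Longrightarrow> open (snd c ` (fst c \<inter> fst d))"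
  using M by (simp add: diff_atlas_def)

lemma chart_open: "c \<in> atlas M \<Longrightarrow> open (snd c ` fst c)"
  using trans_open[of c c] by simp

lemma trans_diff: "c \<in> charts_at M p \<Longrightarrow> d \<in> charts_at M p \<Longrightarrow> (snd d \<circ> chart_inv c) differentiable (at (snd c p))"
  using M by (auto simp: diff_atlas_def charts_at_def)

lemma trans_id:
  assumes c: "c \<in> charts_at M p" shows "fd (snd c \<circ> chart_inv c) (snd c p) = (\<lambda>u. u)"
proof -
  have "fd (snd c \<circ> chart_inv c) (snd c p) = fd (\<lambda>x. x) (snd c p)"
    by (rule fd_cong_open[OF chart_open]) (use charts_atD[OF c] in \<open>auto simp: atlas_inv\<close>)
  then show ?thesis by simp
qed

lemma trans_chain:
  assumes c: "c \<in> charts_at M p" and d: "d \<in> charts_at M p" and e: "e \<in> charts_at M p"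
  shows "fd (snd e \<circ> chart_inv d) (snd d p) (fd (snd d \<circ> chart_inv c) (snd c p) u)
    = fd (snd e \<circ> chart_inv c) (snd c p) u"
proof -
  note C = charts_atD[OF c] and D = charts_atD[OF d] and E = charts_atD[OF e]
  have p: "(snd d \<circ> chart_inv c) (snd c p) = snd d p" using C by (simp add: atlas_inv)
  have "fd (snd e \<circ> chart_inv d) (snd d p) (fd (snd d \<circ> chart_inv c) (snd c p) u)
     = fd (\<lambda>y. (snd e \<circ> chart_inv d) ((snd d \<circ> chart_inv c) y)) (snd c p) u"
    using fd_chain[OF trans_diff[OF c d], of "snd e \<circ> chart_inv d"] trans_diff[OF d e] p by simp
  also have "fd (\<lambda>y. (snd e \<circ> chart_inv d) ((snd d \<circ> chart_inv c) y)) (snd c p) = fd (snd e \<circ> chart_inv c) (snd c p)"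
    by (rule fd_cong_open[of "snd c ` (fst c \<inter> fst d)"])
       (use C D in \<open>auto simp: atlas_inv trans_open\<close>)
  finally show ?thesis .
qed

lemma tangent_of_in:
  assumes c: "c \<in> charts_at M p" shows "tangent_of M c p u \<in> tangent_space M p"
proof -
  have "tangent_of M c p u e = fd (snd e \<circ> chart_inv d) (snd d p) (tangent_of M c p u d)"
    if "d \<in> charts_at M p" "e \<in> charts_at M p" for d e
    using that by (simp only: tangent_of_def trans_chain[OF c that] if_True)
  moreover have "tangent_of M c p u e = 0" if "e \<notin> charts_at M p" for e
    using that by (simp add: tangent_of_def)
  ultimately show ?thesis unfolding tangent_space_def by blast
qed

lemma tangent_of_self: "c \<in> charts_at M p \<Longrightarrow> tangent_of M c p u c = u"
  by (simp add: tangent_of_def trans_id)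

lemma tangent_of_apply: "d \<in> charts_at M p \<Longrightarrow> tangent_of M c p u d = fd (snd d \<circ> chart_inv c) (snd c p) u"
  by (simp add: tangent_of_def)

lemma tangent_space_eq: "v \<in> tangent_space M p \<Longrightarrow> c \<in> charts_at M p \<Longrightarrow> v = tangent_of M c p (v c)"
proof
  fix d assume v: "v \<in> tangent_space M p" and c: "c \<in> charts_at M p"
  show "v d = tangent_of M c p (v c) d"
  proof (cases "d \<in> charts_at M p")
    case True
    have "v d = fd (snd d \<circ> chart_inv c) (snd c p) (v c)"
      using v c True unfolding tangent_space_def by blast
    then show ?thesis using True by (simp only: tangent_of_def if_True)
  next
    case False
    then have "v d = 0" using v unfolding tangent_space_def by blast
    then show ?thesis using False by (simp only: tangent_of_def if_False)
  qed
qed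

lemma tangent_of_change:
  assumes c: "c \<in> charts_at M p" and d: "d \<in> charts_at M p"
  shows "tangent_of M d p (fd (snd d \<circ> chart_inv c) (snd c p) u) = tangent_of M c p u"
  using tangent_space_eq[OF tangent_of_in[OF c, of u] d] unfolding tangent_of_apply[OF d] by (rule sym)

lemma tangent_of_inject: "c \<in> charts_at M p \<Longrightarrow> tangent_of M c p u = tangent_of M c p v \<Longrightarrow> u = v"
proof -
  assume c: "c \<in> charts_at M p" and e: "tangent_of M c p u = tangent_of M c p v"
  from fun_cong[OF e, of c] show "u = v" unfolding tangent_of_self[OF c] .
qed

lemma tangent_of_minus:
  assumes c: "c \<in> charts_at M p" shows "tangent_of M c p (- u) = (\<lambda>d. - tangent_of M c p u d)"
  using linear_neg[OF linear_fd[OF trans_diff[OF c]]] by (intro ext) (simp add: tangent_of_def)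

lemma tangent_of_scaleR:
  assumes c: "c \<in> charts_at M p" shows "tangent_of M c p (r *\<^sub>R u) = (\<lambda>d. r *\<^sub>R tangent_of M c p u d)"
  using linear_cmul[OF linear_fd[OF trans_diff[OF c]]] by (intro ext) (simp add: tangent_of_def)

lemma local_metric_change:
  assumes c: "c \<in> charts_at M p" and d: "d \<in> charts_at M p"
  defines "L \<equiv> fd (snd d \<circ> chart_inv c) (snd c p)"
  shows "local_metric M g c (snd c p) u v = local_metric M g d (snd d p) (L u) (L v)"
  using charts_atD[OF c] charts_atD[OF d] tangent_of_change[OF c d]
  by (simp add: local_metric_def atlas_inv L_def)

end

text \<open>A pointwise form of smoothness in charts, sufficient for the chain rule. It holds for
  the immersion, and is verified directly for the two projections and for the curve defining
  dt.\<close>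

definition chart_diff ::
  "('s, 'a::euclidean_space) manifold \<Rightarrow> ('m, 'b::euclidean_space) manifold \<Rightarrow> ('s \<Rightarrow> 'm) \<Rightarrow> 's \<Rightarrow> bool" where
  "chart_diff S M \<psi> p \<longleftrightarrow> (\<forall>c\<in>charts_at S p. \<forall>d\<in>charts_at M (\<psi> p).
     open (snd c ` (fst c \<inter> \<psi> -` fst d)) \<and> (snd d \<circ> \<psi> \<circ> chart_inv c) differentiable (at (snd c p)))"

context
  fixes S :: "('s, 'a::euclidean_space) manifold" and M :: "('m, 'b::euclidean_space) manifold"
    and \<psi> :: "'s \<Rightarrow> 'm" and p
  assumes S: "diff_atlas S" and M: "diff_atlas M" and \<psi>: "chart_diff S M \<psi> p"
begin

lemma chart_map_diff:
  "c \<in> charts_at S p \<Longrightarrow> d \<in> charts_at M (\<psi> p) \<Longrightarrow> (snd d \<circ> \<psi> \<circ> chart_inv c) differentiable (at (snd c p))"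
  using \<psi> by (simp add: chart_diff_def)

lemma chart_map_open:
  "c \<in> charts_at S p \<Longrightarrow> d \<in> charts_at M (\<psi> p) \<Longrightarrow> open (snd c ` (fst c \<inter> \<psi> -` fst d))"
  using \<psi> by (simp add: chart_diff_def)

lemma chart_map_pre:
  assumes c: "c \<in> charts_at S p" and c': "c' \<in> charts_at S p" and d: "d \<in> charts_at M (\<psi> p)"
  shows "fd (snd d \<circ> \<psi> \<circ> chart_inv c) (snd c p) (fd (snd c \<circ> chart_inv c') (snd c' p) u)
    = fd (snd d \<circ> \<psi> \<circ> chart_inv c') (snd c' p) u"
proof -
  note C = charts_atD[OF c] and C' = charts_atD[OF c'] and D = charts_atD[OF d]
  have p: "(snd c \<circ> chart_inv c') (snd c' p) = snd c p" using C' by (simp add: atlas_inv[OF S])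
  have "fd (snd d \<circ> \<psi> \<circ> chart_inv c) (snd c p) (fd (snd c \<circ> chart_inv c') (snd c' p) u)
     = fd (\<lambda>y. (snd d \<circ> \<psi> \<circ> chart_inv c) ((snd c \<circ> chart_inv c') y)) (snd c' p) u"
    using fd_chain[OF trans_diff[OF S c' c], of "snd d \<circ> \<psi> \<circ> chart_inv c"] chart_map_diff[OF c d] p by simp
  also have "fd (\<lambda>y. (snd d \<circ> \<psi> \<circ> chart_inv c) ((snd c \<circ> chart_inv c') y)) (snd c' p)
     = fd (snd d \<circ> \<psi> \<circ> chart_inv c') (snd c' p)"
    by (rule fd_cong_open[of "snd c' ` (fst c' \<inter> fst c)"])
       (use C C' in \<open>auto simp: atlas_inv[OF S] trans_open[OF S]\<close>)
  finally show ?thesis .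
qed

lemma chart_map_post:
  assumes c: "c \<in> charts_at S p" and d: "d \<in> charts_at M (\<psi> p)" and d': "d' \<in> charts_at M (\<psi> p)"
  shows "fd (snd d' \<circ> chart_inv d) (snd d (\<psi> p)) (fd (snd d \<circ> \<psi> \<circ> chart_inv c) (snd c p) u)
    = fd (snd d' \<circ> \<psi> \<circ> chart_inv c) (snd c p) u"
proof -
  note C = charts_atD[OF c] and D' = charts_atD[OF d'] and D = charts_atD[OF d]
  have p: "(snd d \<circ> \<psi> \<circ> chart_inv c) (snd c p) = snd d (\<psi> p)" using C by (simp add: atlas_inv[OF S])
  have "fd (snd d' \<circ> chart_inv d) (snd d (\<psi> p)) (fd (snd d \<circ> \<psi> \<circ> chart_inv c) (snd c p) u)
     = fd (\<lambda>y. (snd d' \<circ> chart_inv d) ((snd d \<circ> \<psi> \<circ> chart_inv c) y)) (snd c p) u"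
    using fd_chain[OF chart_map_diff[OF c d], of "snd d' \<circ> chart_inv d"] trans_diff[OF M d d'] p by simp
  also have "fd (\<lambda>y. (snd d' \<circ> chart_inv d) ((snd d \<circ> \<psi> \<circ> chart_inv c) y)) (snd c p)
     = fd (snd d' \<circ> \<psi> \<circ> chart_inv c) (snd c p)"
    by (rule fd_cong_open[OF chart_map_open[OF c d]])
       (use C D D' in \<open>auto simp: atlas_inv[OF S] atlas_inv[OF M]\<close>)
  finally show ?thesis .
qed

text \<open>Frees the differential from the arbitrary source chart in its definition, by the chain
  rule on both sides.\<close>

lemma pushforward_eq:
  assumes v: "v \<in> tangent_space S p" and c: "c \<in> charts_at S p" and d: "d \<in> charts_at M (\<psi> p)"
  shows "pushforward S M \<psi> p v = tangent_of M d (\<psi> p) (fd (snd d \<circ> \<psi> \<circ> chart_inv c) (snd c p) (v c))"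
proof
  fix d'
  have c0: "chart_at S p \<in> charts_at S p" by (rule chart_at_in[OF c])
  have vc: "v c = fd (snd c \<circ> chart_inv (chart_at S p)) (snd (chart_at S p) p) (v (chart_at S p))"
    using v c c0 unfolding tangent_space_def by blast
  show "pushforward S M \<psi> p v d' = tangent_of M d (\<psi> p) (fd (snd d \<circ> \<psi> \<circ> chart_inv c) (snd c p) (v c)) d'"
    unfolding pushforward_def tangent_of_def Let_def
    by (simp only: chart_map_post[OF c d] vc chart_map_pre[OF c c0] cong: if_cong)
qed

lemma pushforward_tangent_of:
  assumes c: "c \<in> charts_at S p" and d: "d \<in> charts_at M (\<psi> p)"
  shows "pushforward S M \<psi> p (tangent_of S c p u) = tangent_of M d (\<psi> p) (fd (snd d \<circ> \<psi> \<circ> chart_inv c) (snd c p) u)"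
  using pushforward_eq[OF tangent_of_in[OF S c] c d] by (simp add: tangent_of_self[OF S c])

end

text \<open>The target enters through open chart domains only, which is the form in which warped
  products are available here.\<close>

lemma chart_diff_smooth_map:
  assumes S: "smooth_manifold S" and M: "\<And>d. d \<in> atlas M \<Longrightarrow> openin (mtop M) (fst d)"
    and \<psi>: "smooth_map S M \<psi>"
  shows "c \<in> atlas S \<Longrightarrow> d \<in> atlas M \<Longrightarrow> open (snd c ` (fst c \<inter> \<psi> -` fst d))"
    and "chart_diff S M \<psi> p"
proof -
  have op: "open (snd c ` (fst c \<inter> \<psi> -` fst d))" if c: "c \<in> atlas S" and d: "d \<in> atlas M" for c d
  proof -
    have "openin (mtop S) {x \<in> topspace (mtop S). \<psi> x \<in> fst d}"
      using \<psi> M[OF d] by (auto simp: smooth_map_def intro: openin_continuous_map_preimage)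
    from openin_Int[OF smooth_manifold_chart(2)[OF S c] this]
    have "openin (mtop S) (fst c \<inter> {x \<in> topspace (mtop S). \<psi> x \<in> fst d})" .
    moreover have "fst c \<inter> {x \<in> topspace (mtop S). \<psi> x \<in> fst d} = fst c \<inter> \<psi> -` fst d"
      using openin_subset[OF smooth_manifold_chart(2)[OF S c]] by auto
    ultimately show ?thesis by (intro smooth_manifold_chart(3)[OF S c]) auto
  qed
  then show "c \<in> atlas S \<Longrightarrow> d \<in> atlas M \<Longrightarrow> open (snd c ` (fst c \<inter> \<psi> -` fst d))" .
  show "chart_diff S M \<psi> p"
    unfolding chart_diff_def
  proof (intro ballI conjI)
    fix c d assume c: "c \<in> charts_at S p" and d: "d \<in> charts_at M (\<psi> p)"
    note C = charts_atD[OF c] and D = charts_atD[OF d]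
    show "open (snd c ` (fst c \<inter> \<psi> -` fst d))" by (rule op[OF C(1) D(1)])
    have "smooth_on (snd c ` (fst c \<inter> \<psi> -` fst d)) (snd d \<circ> \<psi> \<circ> chart_inv c)"
      using \<psi> C D by (auto simp: smooth_map_def)
    then show "(snd d \<circ> \<psi> \<circ> chart_inv c) differentiable (at (snd c p))"
      using C D by (intro smooth_on_differentiable) auto
  qed
qed

lemma riemannian_chart_local_metric:
  assumes M: "smooth_manifold M" and g: "riemannian_metric M g" and c: "c \<in> atlas M"
  shows "riemannian_chart (snd c ` fst c) (local_metric M g c)"
proof
  show "open (snd c ` fst c)" by (rule chart_open[OF diff_atlas_smooth_manifold[OF M] c])
qed (use g c in \<open>auto simp: riemannian_metric_def\<close>)

text \<open>The transformation law of Christoffel symbols. The pulled-back symbols are torsion-free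
  because second derivatives of \<open>\<theta>\<close> are symmetric, and metric by differentiating
  \<open>iso\<close>; \<open>levi_civita_eq\<close> then identifies them.\<close>

lemma levi_civita_change:
  fixes \<theta> :: "real^'n \<Rightarrow> real^'n"
  assumes "riemannian_chart U g" and "riemannian_chart U' g'"
    and T: "open T" "y \<in> T" "T \<subseteq> U" and \<theta>: "smooth_on T \<theta>" "\<And>z. z \<in> T \<Longrightarrow> \<theta> z \<in> U'"
    and iso: "\<And>z u v. z \<in> T \<Longrightarrow> g z u v = g' (\<theta> z) (fd \<theta> z u) (fd \<theta> z v)"
  shows "levi_civita g' (\<theta> y) (fd \<theta> y a) (fd \<theta> y b)
     = fd \<theta> y (levi_civita g y a b) - fd (\<lambda>z. fd \<theta> z b) y a"
proof -
  interpret g: riemannian_chart U g by fact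
  interpret g': riemannian_chart U' g' by fact
  have yU: "y \<in> U" and \<theta>yU: "\<theta> y \<in> U'" using T \<theta> by auto
  have d\<theta>: "\<theta> differentiable (at z)" if "z \<in> T" for z by (rule smooth_on_differentiable[OF \<theta>(1) that])
  have dd\<theta>: "(\<lambda>z. fd \<theta> z u) differentiable (at y)" for u
    by (rule smooth_on_differentiable[OF smooth_on_fd[OF \<theta>(1)] T(2)])
  have lin: "linear (fd \<theta> y)" by (rule linear_fd[OF d\<theta>[OF T(2)]])
  note lins = linear_add[OF lin] linear_cmul[OF lin]
  have "inj (fd \<theta> y)"
  proof (rule linear_injective_0[OF lin, THEN iffD2], intro allI impI)
    fix u assume "fd \<theta> y u = 0"
    then have "g y u u = 0" using iso[OF T(2), of u u] by (simp add: g'.g_lin[OF \<theta>yU])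
    then show "u = 0" using g.g_pos[OF yU, of u] by auto
  qed
  then obtain K where K: "linear K" "\<And>u. K (fd \<theta> y u) = u" "\<And>u. fd \<theta> y (K u) = u"
    using linear_injective_isomorphism[OF lin] by blast
  note Ks = linear_add[OF K(1)] linear_cmul[OF K(1)]
  define B where "B a b = fd (\<lambda>z. fd \<theta> z b) y a" for a b
  have Bsym: "B a b = B b a" for a b
    unfolding B_def by (rule smooth_on_second_symmetric[OF T(1,2) \<theta>(1)])
  have Bl: "linear (\<lambda>a. B a b)" for b unfolding B_def by (rule linear_fd[OF dd\<theta>])
  have Br: "linear (B a)" for a using Bl[of a] by (simp add: Bsym[of _ a])
  note Bs = linear_add[OF Bl] linear_cmul[OF Bl] linear_add[OF Br] linear_cmul[OF Br]
  \<comment> \<open>\<open>K\<close> inverts \<open>fd \<theta> y\<close>, and \<open>B\<close> is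
    the second derivative that arises when the vectors \<open>fd \<theta> z u\<close> move with the
    base point.\<close>
  define \<Gamma> where "\<Gamma> a b = K (levi_civita g' (\<theta> y) (fd \<theta> y a) (fd \<theta> y b) + B a b)" for a b
  have "levi_civita g y = \<Gamma>"
  proof (rule levi_civita_eq)
    show "bilinear (g y)" "g y u v = g y v u" "nondegenerate (g y)" for u v
      by (rule g.g_bil[OF yU] g.g_sym[OF yU] g.g_nondeg[OF yU])+
    show "bilinear \<Gamma>" unfolding \<Gamma>_def bilinear_def
      by (intro conjI allI linearI)
         (simp_all add: lins Bs g'.LC_lin[OF \<theta>yU] Ks[symmetric] algebra_simps)
    show "\<Gamma> u v = \<Gamma> v u" for u v
      unfolding \<Gamma>_def using g'.LC_sym[OF \<theta>yU, of "fd \<theta> y u"] Bsym[of u] by simp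
    fix u v w
    have 1: "((\<lambda>z. g' (\<theta> z) u v) has_derivative (\<lambda>w. fd (\<lambda>x. g' x u v) (\<theta> y) (fd \<theta> y w))) (at y)" for u v
      using diff_chain_at[OF fd_has[OF d\<theta>[OF T(2)]] fd_has[OF g'.g_diff[OF \<theta>yU, of u v]]] by (simp add: o_def)
    have 2: "((\<lambda>z. g' (\<theta> z) (fd \<theta> z u) (fd \<theta> z v)) has_derivative (\<lambda>w.
      fd (\<lambda>x. g' x (fd \<theta> y u) (fd \<theta> y v)) (\<theta> y) (fd \<theta> y w)
      + g' (\<theta> y) (B w u) (fd \<theta> y v) + g' (\<theta> y) (fd \<theta> y u) (B w v))) (at y)"
      unfolding B_def
      by (rule has_derivative_bilinear_family[OF T(1,2) g'.g_bil[OF \<theta>(2)] 1 fd_has[OF dd\<theta>] fd_has[OF dd\<theta>]])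
    have "fd (\<lambda>z. g z u v) y = fd (\<lambda>z. g' (\<theta> z) (fd \<theta> z u) (fd \<theta> z v)) y"
      by (rule fd_cong_open[OF T(1,2)]) (rule iso)
    then show "fd (\<lambda>z. g z u v) y w = g y (\<Gamma> w u) v + g y u (\<Gamma> w v)"
      unfolding fd_eq[OF 2] iso[OF T(2)] \<Gamma>_def K(3) g'.LC_metric[OF \<theta>yU]
      by (simp add: g'.g_lin[OF \<theta>yU])
  qed
  then show ?thesis by (simp add: \<Gamma>_def K(3) B_def)
qed

section \<open>Charts and tangent vectors of the warped product\<close>

definition wchart :: "real set \<Rightarrow> ('m, 'a) chart \<Rightarrow> (real \<times> 'm, real \<times> 'a) chart" where
  "wchart I d = (I \<times> fst d, map_prod (\<lambda>t. t) (snd d))"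

lemma wchart_sel [simp]: "fst (wchart I d) = I \<times> fst d" "snd (wchart I d) q = (fst q, snd d (snd q))"
  by (simp_all add: wchart_def map_prod_def split_beta)

lemma wchart_image:
  "snd (wchart I c) ` (I \<times> A) = I \<times> (snd c ` A)"
  "(\<lambda>q. (fst q, snd c (snd q))) ` (I \<times> A) = I \<times> (snd c ` A)"
  by (auto simp: wchart_def map_prod_def image_def split_beta)

lemma atlas_warped: "atlas (warped I M) = wchart I ` atlas M"
  by (simp add: product_manifold_def interval_manifold_def wchart_def Setcompr_eq_image del: split_paired_Ex)

lemma charts_at_warped: "q \<in> I \<times> UNIV \<Longrightarrow> charts_at (warped I M) q = wchart I ` charts_at M (snd q)"
  by (auto simp: charts_at_def atlas_warped)

lemma charts_at_interval: "t \<in> I \<Longrightarrow> charts_at (interval_manifold I) t = {(I, \<lambda>t. t)}"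
  by (auto simp: charts_at_def interval_manifold_def)

lemma chart_inv_interval: "t \<in> I \<Longrightarrow> chart_inv (I, \<lambda>t. t) t = t"
  using chart_inv_eq[of "(I, \<lambda>t. t)" t] by (simp add: inj_on_def)

context
  fixes I :: "real set" and M :: "('m, 'a::euclidean_space) manifold"
  assumes I: "open I" and M: "diff_atlas M"
begin

lemma diff_atlas_interval: "diff_atlas (interval_manifold I)"
proof -
  have "(\<lambda>t. t) \<circ> chart_inv (I, \<lambda>t. t) differentiable (at x)" if "x \<in> I" for x
    by (rule differentiable_cong_open[OF differentiable_ident I that]) (simp add: chart_inv_interval)
  then show ?thesis unfolding diff_atlas_def using I by (auto simp: interval_manifold_def inj_on_def)
qed

lemma wchart_inj: "d \<in> atlas M \<Longrightarrow> inj_on (snd (wchart I d)) (fst (wchart I d))"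
  using atlas_inj[OF M, of d] by (auto simp: inj_on_def)

lemma wchart_inv: "d \<in> atlas M \<Longrightarrow> t \<in> I \<Longrightarrow> y \<in> snd d ` fst d \<Longrightarrow> chart_inv (wchart I d) (t, y) = (t, chart_inv d y)"
  using chart_inv_eq[OF wchart_inj, of d "(t, chart_inv d y)"] by (auto simp: atlas_inv[OF M])

lemma wchart_trans_has_derivative:
  assumes c: "c \<in> charts_at M m" and d: "d \<in> charts_at M m" and t: "t \<in> I"
  shows "((snd (wchart I d) \<circ> chart_inv (wchart I c)) has_derivative
     (\<lambda>u. (fst u, fd (snd d \<circ> chart_inv c) (snd c m) (snd u)))) (at (t, snd c m))"
proof (rule has_derivative_transform_within_open)
  note C = charts_atD[OF c] and D = charts_atD[OF d]
  show "open (I \<times> snd c ` (fst c \<inter> fst d))" by (rule open_Times[OF I trans_open[OF M C(1) D(1)]])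
  show "(t, snd c m) \<in> I \<times> snd c ` (fst c \<inter> fst d)" using t C D by auto
  have "((\<lambda>x. (snd d \<circ> chart_inv c) (snd x)) has_derivative (\<lambda>u. fd (snd d \<circ> chart_inv c) (snd c m) (snd u)))
     (at (t, snd c m))"
    using diff_chain_at[OF bounded_linear_imp_has_derivative[OF bounded_linear_snd],
        of "snd d \<circ> chart_inv c" _ "(t, snd c m)"] fd_has[OF trans_diff[OF M c d]]
    by (simp add: o_def)
  then show "((\<lambda>x. (fst x, (snd d \<circ> chart_inv c) (snd x))) has_derivative
     (\<lambda>u. (fst u, fd (snd d \<circ> chart_inv c) (snd c m) (snd u)))) (at (t, snd c m))"
    by (intro has_derivative_Pair) (rule bounded_linear_imp_has_derivative[OF bounded_linear_fst])
  show "(fst x, (snd d \<circ> chart_inv c) (snd x)) = (snd (wchart I d) \<circ> chart_inv (wchart I c)) x"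
    if "x \<in> I \<times> snd c ` (fst c \<inter> fst d)" for x
    using that C by (auto simp: wchart_inv)
qed

lemma diff_atlas_warped: "diff_atlas (warped I M)"
  unfolding diff_atlas_def atlas_warped
proof (intro conjI ballI; elim imageE; hypsubst)
  fix c assume c: "c \<in> atlas M"
  show "inj_on (snd (wchart I c)) (fst (wchart I c))" by (rule wchart_inj[OF c])
  fix d assume d: "d \<in> atlas M"
  have e: "snd (wchart I c) ` (fst (wchart I c) \<inter> fst (wchart I d)) = I \<times> snd c ` (fst c \<inter> fst d)"
    unfolding wchart_sel Times_Int_Times by (simp only: Int_absorb wchart_image)
  show "open (snd (wchart I c) ` (fst (wchart I c) \<inter> fst (wchart I d)))"
    unfolding e by (rule open_Times[OF I trans_open[OF M c d]])
next
  fix c d q assume c: "c \<in> atlas M" and d: "d \<in> atlas M" and q: "q \<in> fst (wchart I c) \<inter> fst (wchart I d)"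
  from q have "c \<in> charts_at M (snd q)" "d \<in> charts_at M (snd q)" "fst q \<in> I"
    using c d by (auto simp: charts_at_def)
  from differentiableI[OF wchart_trans_has_derivative[OF this]]
  show "snd (wchart I d) \<circ> chart_inv (wchart I c) differentiable at (snd (wchart I c) q)" by simp
qed

lemma wchart_in: "d \<in> charts_at M m \<Longrightarrow> t \<in> I \<Longrightarrow> wchart I d \<in> charts_at (warped I M) (t, m)"
  by (simp add: charts_at_warped)

lemma push_fst:
  assumes d: "d \<in> charts_at M m" and t: "t \<in> I"
  shows "pushforward (warped I M) (interval_manifold I) fst (t, m)
     (tangent_of (warped I M) (wchart I d) (t, m) u) (I, \<lambda>s. s) = fst u"
proof -
  have 1: "(snd (I, \<lambda>s. s) \<circ> fst \<circ> chart_inv (wchart I c) has_derivative fst) (at (t, snd c m))"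
    if c: "c \<in> charts_at M m" for c
    by (rule has_derivative_transform_within_open[OF bounded_linear_imp_has_derivative[OF bounded_linear_fst]
          open_Times[OF I chart_open[OF M]]])
       (use t charts_atD[OF c] in \<open>auto simp: wchart_inv\<close>)
  have "chart_diff (warped I M) (interval_manifold I) fst (t, m)"
    unfolding chart_diff_def
  proof (intro ballI)
    fix e k assume "e \<in> charts_at (warped I M) (t, m)" "k \<in> charts_at (interval_manifold I) (fst (t, m))"
    then obtain c where c: "c \<in> charts_at M m" "e = wchart I c" and k: "k = (I, \<lambda>s. s)"
      using t by (auto simp: charts_at_warped charts_at_interval)
    have "fst e \<inter> fst -` fst k = I \<times> fst c" by (auto simp: c k)
    then show "open (snd e ` (fst e \<inter> fst -` fst k)) \<and> snd k \<circ> fst \<circ> chart_inv e differentiable at (snd e (t, m))"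
      using differentiableI[OF 1[OF c(1)]] open_Times[OF I chart_open[OF M charts_atD(1)[OF c(1)]]]
      by (simp add: c k wchart_image)
  qed
  note pushforward_tangent_of[OF diff_atlas_warped diff_atlas_interval this wchart_in[OF d t], of "(I, \<lambda>s. s)" u]
  then show ?thesis
    using t fd_eq[OF 1[OF d]] tangent_of_self[OF diff_atlas_interval, of "(I, \<lambda>s. s)" t]
    by (simp add: charts_at_interval)
qed

lemma push_snd:
  assumes d: "d \<in> charts_at M m" and t: "t \<in> I"
  shows "pushforward (warped I M) M snd (t, m) (tangent_of (warped I M) (wchart I d) (t, m) u) = tangent_of M d m (snd u)"
proof -
  have 1: "(snd c' \<circ> snd \<circ> chart_inv (wchart I c) has_derivative (\<lambda>u. fd (snd c' \<circ> chart_inv c) (snd c m) (snd u)))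
     (at (t, snd c m))"
    if c: "c \<in> charts_at M m" and c': "c' \<in> charts_at M m" for c c'
  proof (rule has_derivative_transform_within_open)
    show "((\<lambda>x. (snd c' \<circ> chart_inv c) (snd x)) has_derivative (\<lambda>u. fd (snd c' \<circ> chart_inv c) (snd c m) (snd u)))
     (at (t, snd c m))"
      using diff_chain_at[OF bounded_linear_imp_has_derivative[OF bounded_linear_snd],
          of "snd c' \<circ> chart_inv c" _ "(t, snd c m)"] fd_has[OF trans_diff[OF M c c']]
      by (simp add: o_def)
    show "open (I \<times> snd c ` fst c)" by (rule open_Times[OF I chart_open[OF M charts_atD(1)[OF c]]])
  qed (use t charts_atD[OF c] in \<open>auto simp: wchart_inv\<close>)
  have "chart_diff (warped I M) M snd (t, m)"
    unfolding chart_diff_def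
  proof (intro ballI)
    fix e k assume "e \<in> charts_at (warped I M) (t, m)" and k: "k \<in> charts_at M (snd (t, m))"
    then obtain c where c: "c \<in> charts_at M m" "e = wchart I c"
      using t by (auto simp: charts_at_warped)
    have "fst e \<inter> snd -` fst k = I \<times> (fst c \<inter> fst k)" by (auto simp: c)
    then show "open (snd e ` (fst e \<inter> snd -` fst k)) \<and> snd k \<circ> snd \<circ> chart_inv e differentiable at (snd e (t, m))"
      using differentiableI[OF 1[OF c(1)]] k
        open_Times[OF I trans_open[OF M charts_atD(1)[OF c(1)] charts_atD(1)[OF k]]]
      by (simp add: c wchart_image)
  qed
  note pushforward_tangent_of[OF diff_atlas_warped M this wchart_in[OF d t], of d u]
  then show ?thesis
    using d fd_eq[OF 1[OF d d]] by (simp add: trans_id[OF M d])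
qed

lemma dt_field_eq:
  assumes d: "d \<in> charts_at M m" and t: "t \<in> I"
  shows "dt_field I M (t, m) = tangent_of (warped I M) (wchart I d) (t, m) (1, 0)"
proof -
  have 1: "(snd (wchart I c) \<circ> (\<lambda>s. (s, m)) \<circ> chart_inv (I, \<lambda>s. s) has_derivative (\<lambda>a. (a, 0))) (at t)"
    if c: "c \<in> charts_at M m" for c
  proof (rule has_derivative_transform_within_open[OF _ I t])
    show "((\<lambda>s. (s, snd c m)) has_derivative (\<lambda>a. (a, 0))) (at t)"
      by (auto intro!: derivative_eq_intros)
  qed (simp add: chart_inv_interval)
  have k0: "(I, \<lambda>s. s) \<in> charts_at (interval_manifold I) t" using t by (simp add: charts_at_interval)
  have "chart_diff (interval_manifold I) (warped I M) (\<lambda>s. (s, m)) t"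
    unfolding chart_diff_def
  proof (intro ballI)
    fix e k assume "e \<in> charts_at (warped I M) (t, m)" "k \<in> charts_at (interval_manifold I) t"
    then obtain c where c: "c \<in> charts_at M m" "e = wchart I c" and k: "k = (I, \<lambda>s. s)"
      using t by (auto simp: charts_at_warped charts_at_interval)
    have "fst k \<inter> (\<lambda>s. (s, m)) -` fst e = I" using charts_atD[OF c(1)] by (auto simp: c k)
    then show "open (snd k ` (fst k \<inter> (\<lambda>s. (s, m)) -` fst e)) \<and> snd e \<circ> (\<lambda>s. (s, m)) \<circ> chart_inv k differentiable at (snd k t)"
      using differentiableI[OF 1[OF c(1)]] I by (simp add: c k)
  qed
  note pushforward_tangent_of[OF diff_atlas_interval diff_atlas_warped this k0, of "wchart I d" 1]
  then show ?thesis
    using wchart_in[OF d t] fd_eq[OF 1[OF d]] by (simp add: dt_field_def)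
qed

lemma conformal_field_eq:
  assumes d: "d \<in> charts_at M m" and t: "t \<in> I"
  shows "conformal_field I f M (t, m) = tangent_of (warped I M) (wchart I d) (t, m) (f t, 0)"
  using tangent_of_scaleR[OF diff_atlas_warped wchart_in[OF d t], of "f t" "(1, 0)"]
  by (simp add: conformal_field_def dt_field_eq[OF d t])

lemma warped_metric_eq:
  assumes d: "d \<in> charts_at M m" and t: "t \<in> I"
  shows "warped_metric \<epsilon> I f M g (t, m) (tangent_of (warped I M) (wchart I d) (t, m) u)
      (tangent_of (warped I M) (wchart I d) (t, m) v)
     = \<epsilon> * (fst u * fst v) + (f t)\<^sup>2 * local_metric M g d (snd d m) (snd u) (snd v)"
  unfolding warped_metric_def interval_metric_def fst_conv snd_conv push_fst[OF d t] push_snd[OF d t]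
  using charts_atD[OF d] by (simp add: local_metric_def atlas_inv[OF M])

end


section \<open>Immersions into warped products\<close>

locale warped_immersion =
  fixes \<epsilon> :: real and I :: "real set" and f :: "real \<Rightarrow> real"
    and M :: "('m, real^'n) manifold" and g :: "('m, real^'n) metric"
    and S :: "('s, real^'n) manifold" and \<psi> :: "'s \<Rightarrow> real \<times> 'm"
    and N :: "'s \<Rightarrow> (real \<times> 'm, real \<times> (real^'n)) tangent"
  assumes \<epsilon>: "\<epsilon> \<in> {-1, 1}" and M: "smooth_manifold M" and g: "riemannian_metric M g"
    and I: "open I" and f_smooth: "smooth_on I f" and f_pos: "\<And>t. t \<in> I \<Longrightarrow> f t > 0"
    and imm: "riemannian_immersion S (warped I M) (warped_metric \<epsilon> I f M g) \<psi>"
    and N: "unit_normal S (warped I M) (warped_metric \<epsilon> I f M g) \<psi> N"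
begin

abbreviation "WM \<equiv> warped I M"
abbreviation "gb \<equiv> warped_metric \<epsilon> I f M g"
abbreviation "hS \<equiv> induced_metric S WM gb \<psi>"

lemma S: "smooth_manifold S" and \<psi>: "smooth_map S WM \<psi>" and hS: "riemannian_metric S hS"
  using imm by (auto simp: riemannian_immersion_def immersion_def)

lemmas atM = diff_atlas_smooth_manifold[OF M]
lemmas atS = diff_atlas_smooth_manifold[OF S]
lemmas atW = diff_atlas_warped[OF I atM]

lemma open_chart_WM: "d \<in> atlas WM \<Longrightarrow> openin (mtop WM) (fst d)"
  using smooth_manifold_chart(2)[OF M]
  by (auto simp: atlas_warped product_manifold_def interval_manifold_def openin_prod_Times_iff)

lemmas cd = chart_diff_smooth_map(2)[OF S open_chart_WM \<psi>]

lemma \<psi>_points: "q \<in> points S \<Longrightarrow> fst (\<psi> q) \<in> I \<and> snd (\<psi> q) \<in> points M"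
  using \<psi> continuous_map_image_subset_topspace
  by (fastforce simp: smooth_map_def product_manifold_def interval_manifold_def)

lemma chart_at_S: "q \<in> points S \<Longrightarrow> chart_at S q \<in> charts_at S q"
  using S chart_at_in[of _ S q] by (fastforce simp: smooth_manifold_def charts_at_def)

lemma chart_at_M: "m \<in> points M \<Longrightarrow> chart_at M m \<in> charts_at M m"
  using M chart_at_in[of _ M m] by (fastforce simp: smooth_manifold_def charts_at_def)

lemma in_points: "c \<in> atlas S \<Longrightarrow> q \<in> fst c \<Longrightarrow> q \<in> points S"
  using openin_subset[OF smooth_manifold_chart(2)[OF S]] by blast

lemma wchart_at: "e \<in> charts_at M (snd (\<psi> q)) \<Longrightarrow> q \<in> points S \<Longrightarrow> wchart I e \<in> charts_at WM (\<psi> q)"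
  using wchart_in[OF I atM, of e "snd (\<psi> q)" "fst (\<psi> q)"] \<psi>_points[of q] by simp

text \<open>The chart chosen at a point of the warped product is unrelated to the one chosen on
  \<open>M\<close>, but it is a product chart.\<close>

lemma wchart_at_ex:
  assumes q: "q \<in> points S"
  obtains e where "e \<in> charts_at M (snd (\<psi> q))" "chart_at WM (\<psi> q) = wchart I e"
proof -
  have "chart_at WM (\<psi> q) \<in> charts_at WM (\<psi> q)"
    by (rule chart_at_in[OF wchart_at[OF chart_at_M q]]) (use \<psi>_points[OF q] in simp)
  then show ?thesis using that \<psi>_points[OF q] by (auto simp: charts_at_warped mem_Times_iff)
qed

lemma N_tangent: "q \<in> points S \<Longrightarrow> N q \<in> tangent_space WM (\<psi> q)"
  using N by (auto simp: unit_normal_def smooth_field_along_def)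

lemma warped_chart:
  assumes e: "e \<in> atlas M"
  shows "warped_chart (snd e ` fst e) (local_metric M g e) I f (deriv f) (deriv (deriv f)) \<epsilon>"
  using riemannian_chart_local_metric[OF M g e] I f_pos smooth_on_real_deriv[OF I f_smooth] \<epsilon>
  unfolding warped_chart_def warped_chart_axioms_def by auto

abbreviation "Gm e \<equiv> warped_chart.G (local_metric M g e) f \<epsilon>"
abbreviation "Gam e \<equiv> warped_chart.\<Gamma> (local_metric M g e) f (deriv f) \<epsilon>"

section \<open>The immersion and its normal in a pair of charts\<close>

definition "cdom c e = snd c ` (fst c \<inter> \<psi> -` fst (wchart I e))"
definition "Psi c e = snd (wchart I e) \<circ> \<psi> \<circ> chart_inv c"
definition "Nu c e x = N (chart_inv c x) (wchart I e)"

lemma gb_eq: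
  assumes e: "e \<in> charts_at M (snd q)" and q: "fst q \<in> I"
  shows "gb q (tangent_of WM (wchart I e) q u) (tangent_of WM (wchart I e) q v)
    = Gm e (fst q, snd e (snd q)) u v"
  using warped_metric_eq[OF I atM e q, of \<epsilon> f g u v] warped_chart.G_def[OF warped_chart[OF charts_atD(1)[OF e]]]
  by simp

context
  fixes c e q
  assumes c: "c \<in> charts_at S q" and e: "e \<in> charts_at M (snd (\<psi> q))"
begin

lemma q_points: "q \<in> points S"
  by (rule in_points[OF charts_atD[OF c]])

lemma in_cdom: "snd c q \<in> cdom c e"
  using charts_atD[OF c] charts_atD[OF e] \<psi>_points[OF q_points] by (auto simp: cdom_def mem_Times_iff)

lemma Psi_eq: "Psi c e (snd c q) = (fst (\<psi> q), snd e (snd (\<psi> q)))"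
  using charts_atD[OF c] by (simp add: Psi_def atlas_inv[OF atS])

lemma Psi_diff: "Psi c e differentiable (at (snd c q))"
  unfolding Psi_def by (rule chart_map_diff[OF atS atW cd c wchart_at[OF e q_points]])

lemma push_\<psi>:
  "pushforward S WM \<psi> q (tangent_of S c q u) = tangent_of WM (wchart I e) (\<psi> q) (fd (Psi c e) (snd c q) u)"
  unfolding Psi_def by (rule pushforward_tangent_of[OF atS atW cd c wchart_at[OF e q_points]])

lemma N_eq: "N q = tangent_of WM (wchart I e) (\<psi> q) (Nu c e (snd c q))"
  using tangent_space_eq[OF atW N_tangent[OF q_points] wchart_at[OF e q_points]] charts_atD[OF c]
  by (simp add: Nu_def atlas_inv[OF atS])

lemma gb_Psi:
  "gb (\<psi> q) (tangent_of WM (wchart I e) (\<psi> q) u) (tangent_of WM (wchart I e) (\<psi> q) v) = Gm e (Psi c e (snd c q)) u v"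
  using gb_eq[OF e] \<psi>_points[OF q_points] by (simp add: Psi_eq)

lemma local_hS:
  "local_metric S hS c (snd c q) u v
    = Gm e (Psi c e (snd c q)) (fd (Psi c e) (snd c q) u) (fd (Psi c e) (snd c q) v)"
  using charts_atD[OF c]
  by (simp add: local_metric_def atlas_inv[OF atS] induced_metric_def push_\<psi> gb_Psi)

end

lemma cdom_cases:
  assumes c: "c \<in> atlas S" and e: "e \<in> atlas M" and x: "x \<in> cdom c e"
  obtains q where "c \<in> charts_at S q" "e \<in> charts_at M (snd (\<psi> q))" "x = snd c q"
  using x c e that by (auto simp: cdom_def charts_at_def)

text \<open>Most requirements are translations into coordinates. The exception is
  \<open>unit\<close>: the definition of a unit normal fixes its square only up to sign.\<close>

lemma hypersurface_chart:
  assumes c: "c \<in> atlas S" and e: "e \<in> atlas M"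
  shows "hypersurface_chart (cdom c e) (I \<times> snd e ` fst e) (Psi c e) (Nu c e) (Gm e) (Gam e) \<epsilon>"
proof -
  interpret wc: warped_chart "snd e ` fst e" "local_metric M g e" I f "deriv f" "deriv (deriv f)" \<epsilon>
    by (rule warped_chart[OF e])
  have we: "wchart I e \<in> atlas WM" using e by (simp add: atlas_warped)
  have pos: "Gm e (Psi c e x) (fd (Psi c e) x u) (fd (Psi c e) x u) > 0" if x: "x \<in> cdom c e" and u: "u \<noteq> 0" for x u
  proof -
    obtain q where q: "c \<in> charts_at S q" "e \<in> charts_at M (snd (\<psi> q))" "x = snd c q"
      by (rule cdom_cases[OF c e x])
    have "local_metric S hS c x u u > 0"
      using hS c u charts_atD[OF q(1)] q(3) by (auto simp: riemannian_metric_def)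
    then show ?thesis using local_hS[OF q(1,2)] q(3) by simp
  qed
  have nrm: "Gm e (Psi c e x) (Nu c e x) (fd (Psi c e) x u) = 0" if x: "x \<in> cdom c e" for x u
  proof -
    obtain q where q: "c \<in> charts_at S q" "e \<in> charts_at M (snd (\<psi> q))" "x = snd c q"
      by (rule cdom_cases[OF c e x])
    have "gb (\<psi> q) (N q) (pushforward S WM \<psi> q (tangent_of S c q u)) = 0"
      using N q_points[OF q(1,2)] tangent_of_in[OF atS q(1)] by (auto simp: unit_normal_def)
    then show ?thesis
      unfolding N_eq[OF q(1,2)] push_\<psi>[OF q(1,2)] gb_Psi[OF q(1,2)] q(3) .
  qed
  have in_W: "Psi c e x \<in> I \<times> snd e ` fst e" if x: "x \<in> cdom c e" for x
  proof -
    obtain q where q: "c \<in> charts_at S q" "e \<in> charts_at M (snd (\<psi> q))" "x = snd c q"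
      by (rule cdom_cases[OF c e x])
    then show ?thesis using Psi_eq[OF q(1,2)] \<psi>_points[OF q_points[OF q(1,2)]] charts_atD[OF q(2)] by auto
  qed
  have unt: "Gm e (Psi c e x) (Nu c e x) (Nu c e x) = \<epsilon>" if x: "x \<in> cdom c e" for x
  proof -
    obtain q where q: "c \<in> charts_at S q" "e \<in> charts_at M (snd (\<psi> q))" "x = snd c q"
      by (rule cdom_cases[OF c e x])
    note W = in_W[OF x]
    define \<nu> where "\<nu> = Nu c e x"
    define s where "s = Gm e (Psi c e x) \<nu> \<nu>"
    have "\<bar>gb (\<psi> q) (N q) (N q)\<bar> = 1"
      using N q_points[OF q(1,2)] by (auto simp: unit_normal_def)
    then have s: "\<bar>s\<bar> = 1"
      unfolding N_eq[OF q(1,2)] gb_Psi[OF q(1,2)] q(3)[symmetric] s_def \<nu>_def .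
    text \<open>Otherwise \<open>G\<close> has the wrong signature: if \<open>\<epsilon> = 1\<close> then \<open>G\<close> is positive definite, and if \<open>\<epsilon> = - 1\<close>
      and \<open>\<nu>\<close> is spacelike then \<open>G\<close> is positive on the span of the tangent hyperplane and \<open>\<nu>\<close>, which contains \<open>\<partial>\<^sub>t\<close>.\<close>
    show ?thesis
    proof (cases "\<epsilon> = 1")
      case True
      have "local_metric M g e (snd (Psi c e x)) u u \<ge> 0" for u
        using wc.g_pos[of "snd (Psi c e x)" u] wc.g_lin(9)[of "snd (Psi c e x)" 0] W
        by (cases "u = 0") (auto intro: less_imp_le)
      then have "s \<ge> 0" unfolding s_def wc.G_def using True by simp
      then show ?thesis using s True by (simp add: s_def \<nu>_def)
    next
      case False
      then have \<epsilon>': "\<epsilon> = - 1" using \<epsilon> by auto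
      have d: "Psi c e differentiable (at x)" using Psi_diff[OF q(1,2)] q(3) by simp
      note lin = linear_add[OF linear_fd[OF d]] linear_cmul[OF linear_fd[OF d]]
      note Gl = wc.G_bil[OF W, THEN bilinear_ladd] wc.G_bil[OF W, THEN bilinear_radd]
        wc.G_bil[OF W, THEN bilinear_lmul] wc.G_bil[OF W, THEN bilinear_rmul]
      \<comment> \<open>The same map as \<open>frame\<close>, rebuilt because that locale
        presupposes the sign being proved.\<close>
      define F where "F p = fst p *\<^sub>R \<nu> + fd (Psi c e) x (snd p)" for p
      have GF: "Gm e (Psi c e x) (F p) (F p) = (fst p)\<^sup>2 * s
          + Gm e (Psi c e x) (fd (Psi c e) x (snd p)) (fd (Psi c e) x (snd p))" for p
        using nrm[OF x, of "snd p"] wc.G_sym[OF W, of "fd (Psi c e) x (snd p)" \<nu>]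
        by (simp add: F_def Gl s_def \<nu>_def power2_eq_square)
      show ?thesis
      proof (rule ccontr)
        assume "Gm e (Psi c e x) (Nu c e x) (Nu c e x) \<noteq> \<epsilon>"
        then have s1: "s = 1" using s \<epsilon>' by (auto simp: s_def \<nu>_def abs_if split: if_splits)
        have nn: "Gm e (Psi c e x) (fd (Psi c e) x u) (fd (Psi c e) x u) \<ge> 0" for u
          using pos[OF x, of u] linear_0[OF linear_fd[OF d]] bilinear_lzero[OF wc.G_bil[OF W], of 0]
          by (cases "u = 0") (auto intro: less_imp_le)
        have lF: "linear F" unfolding F_def
          by (rule linearI) (simp_all add: lin scaleR_add_left scaleR_add_right)
        have "inj F"
        proof (rule linear_injective_0[OF lF, THEN iffD2], intro allI impI)
          fix p assume "F p = 0"
          then have z: "(fst p)\<^sup>2 + Gm e (Psi c e x) (fd (Psi c e) x (snd p)) (fd (Psi c e) x (snd p)) = 0"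
            using GF[of p] s1 bilinear_lzero[OF wc.G_bil[OF W], of 0] by simp
          then have "fst p = 0" using nn[of "snd p"] by (simp add: add_nonneg_eq_0_iff)
          moreover have "snd p = 0"
            using z nn[of "snd p"] pos[OF x, of "snd p"] by (cases "snd p = 0") (auto simp: add_nonneg_eq_0_iff)
          ultimately show "p = 0" by (simp add: prod_eq_iff)
        qed
        then have "surj F" using linear_injective_imp_surjective lF by blast
        then obtain p where p: "(1, 0) = F p" by (metis surjD)
        have "Gm e (Psi c e x) (F p) (F p) = - 1"
          unfolding p[symmetric] wc.G_def using W by (auto simp: \<epsilon>' wc.g_lin)
        then show False using GF[of p] nn[of "snd p"] zero_le_power2[of "fst p"] unfolding s1 by linarith
      qed
    qed
  qed
  show ?thesis
  proof
    show "open (cdom c e)"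
      unfolding cdom_def by (rule chart_diff_smooth_map(1)[OF S open_chart_WM \<psi> c we])
    show "open (I \<times> snd e ` fst e)" by (rule wc.open_dom)
    show "smooth_on (cdom c e) (Psi c e)"
      unfolding cdom_def Psi_def using \<psi> c we unfolding smooth_map_def by blast
    show "smooth_on (cdom c e) (Nu c e)"
      unfolding cdom_def Nu_def using N c we unfolding unit_normal_def smooth_field_along_def by blast
    show "(\<lambda>z. Gm e z u v) differentiable (at y)" if "y \<in> I \<times> snd e ` fst e" for y u v
      by (rule differentiableI[OF wc.G_has_derivative[OF that]])
    show "(\<lambda>z. Gam e z u v) differentiable (at y)" if "y \<in> I \<times> snd e ` fst e" for y u v
      by (rule differentiableI[OF wc.\<Gamma>_has_derivative[OF that]])
    show "fd (\<lambda>z. Gm e z u v) y w = Gm e y (Gam e y w u) v + Gm e y u (Gam e y w v)"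
      if "y \<in> I \<times> snd e ` fst e" for y u v w
      by (simp add: fd_eq[OF wc.G_has_derivative[OF that]])
    show "\<epsilon> * \<epsilon> = 1" by (rule wc.eps_sq)
  qed (rule in_W wc.G_bil wc.G_sym wc.\<Gamma>_bil wc.\<Gamma>_sym pos nrm unt; assumption)+
qed

text \<open>\<open>\<nabla>\<^bsub>u\<^esub>N\<close> in the charts \<open>c\<close> and \<open>wchart I e\<close>.\<close>

definition covN where
  "covN c e x u = fd (Nu c e) x u + Gam e (Psi c e x) (fd (Psi c e) x u) (Nu c e x)"

abbreviation "shp c e \<equiv> hypersurface_chart.shape (Psi c e) (Nu c e) (Gm e) (Gam e) \<epsilon>"

lemma Nu_diff:
  assumes c: "c \<in> charts_at S q" and e: "e \<in> charts_at M (snd (\<psi> q))"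
  shows "Nu c e differentiable (at (snd c q))"
  by (rule hypersurface_chart.\<nu>_diff[OF hypersurface_chart[OF charts_atD(1)[OF c] charts_atD(1)[OF e]] in_cdom[OF c e]])

lemma covN_source:
  assumes c: "c \<in> charts_at S q" and c': "c' \<in> charts_at S q" and e: "e \<in> charts_at M (snd (\<psi> q))"
  shows "covN c' e (snd c' q) u = covN c e (snd c q) (fd (snd c \<circ> chart_inv c') (snd c' q) u)"
proof -
  note C = charts_atD[OF c] and C' = charts_atD[OF c']
  have q: "q \<in> points S" by (rule in_points[OF C])
  have P: "fd (Psi c e) (snd c q) (fd (snd c \<circ> chart_inv c') (snd c' q) u) = fd (Psi c' e) (snd c' q) u"
    unfolding Psi_def by (rule chart_map_pre[OF atS atW cd c c' wchart_at[OF e q]])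
  have p: "(snd c \<circ> chart_inv c') (snd c' q) = snd c q" using C' by (simp add: atlas_inv[OF atS])
  have "fd (Nu c' e) (snd c' q) = fd (\<lambda>y. Nu c e ((snd c \<circ> chart_inv c') y)) (snd c' q)"
    by (rule fd_cong_open[of "snd c' ` (fst c' \<inter> fst c)"])
       (use C C' in \<open>auto simp: atlas_inv[OF atS] trans_open[OF atS] Nu_def\<close>)
  moreover have "fd (\<lambda>y. Nu c e ((snd c \<circ> chart_inv c') y)) (snd c' q) u
      = fd (Nu c e) (snd c q) (fd (snd c \<circ> chart_inv c') (snd c' q) u)"
    using fd_chain[OF trans_diff[OF atS c' c], of "Nu c e"] Nu_diff[OF c e] p by simp
  moreover have "Nu c' e (snd c' q) = Nu c e (snd c q)"
    using C C' by (simp add: Nu_def atlas_inv[OF atS])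
  ultimately show ?thesis
    unfolding covN_def by (simp add: P Psi_eq[OF c e] Psi_eq[OF c' e])
qed

text \<open>Differentiating the transformed normal brings in the second derivative of the transition
  map \<open>\<theta>\<close>, which cancels the inhomogeneous term of
  \<open>levi_civita_change\<close>. The remaining Christoffel terms depend only on f and the fibre
  metric and transform as tensors.\<close>

lemma covN_target:
  assumes c: "c \<in> charts_at S q" and e: "e \<in> charts_at M (snd (\<psi> q))" and e': "e' \<in> charts_at M (snd (\<psi> q))"
  shows "tangent_of WM (wchart I e') (\<psi> q) (covN c e' (snd c q) u)
    = tangent_of WM (wchart I e) (\<psi> q) (covN c e (snd c q) u)"
proof -
  note C = charts_atD[OF c] and E = charts_atD[OF e] and E' = charts_atD[OF e']
  have q: "q \<in> points S" by (rule in_points[OF C])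
  note we = wchart_at[OF e q] and we' = wchart_at[OF e' q]
  interpret wc: warped_chart "snd e ` fst e" "local_metric M g e" I f "deriv f" "deriv (deriv f)" \<epsilon>
    by (rule warped_chart[OF E(1)])
  interpret wc': warped_chart "snd e' ` fst e'" "local_metric M g e'" I f "deriv f" "deriv (deriv f)" \<epsilon>
    by (rule warped_chart[OF E'(1)])
  define x where "x = snd c q"
  define y where "y = snd e (snd (\<psi> q))"
  define \<theta> where "\<theta> = snd e' \<circ> chart_inv e"
  define D where "D = cdom c e \<inter> cdom c e'"
  \<comment> \<open>The differential of the transition between the two product charts: the identity
    on the interval factor.\<close>
  define L where "L p = (fst p, fd \<theta> y (snd p))" for p :: "real \<times> (real^'n)"
  have t: "fst (\<psi> q) \<in> I" using \<psi>_points[OF q] by simp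
  have wL: "fd (snd (wchart I e') \<circ> chart_inv (wchart I e)) (snd (wchart I e) r) =
      (\<lambda>p. (fst p, fd \<theta> (snd e (snd r)) (snd p)))"
    if "e \<in> charts_at M (snd r)" "e' \<in> charts_at M (snd r)" "fst r \<in> I" for r
    using fd_eq[OF wchart_trans_has_derivative[OF I atM that]] by (simp add: \<theta>_def)
  have dP: "fd (Psi c e') x u = L (fd (Psi c e) x u)"
    using chart_map_post[OF atS atW cd c we we', of u] wL[OF e e' t]
    unfolding Psi_def x_def L_def y_def by simp
  have Dx: "open D" "x \<in> D"
    using hypersurface_chart.open_\<Omega>[OF hypersurface_chart[OF C(1) E(1)]]
      hypersurface_chart.open_\<Omega>[OF hypersurface_chart[OF C(1) E'(1)]] in_cdom[OF c e] in_cdom[OF c e']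
    by (auto simp: D_def x_def)
  have Dq: "\<exists>r. c \<in> charts_at S r \<and> e \<in> charts_at M (snd (\<psi> r)) \<and> e' \<in> charts_at M (snd (\<psi> r)) \<and> z = snd c r"
    if "z \<in> D" for z
  proof -
    have z: "z \<in> cdom c e" "z \<in> cdom c e'" using that by (auto simp: D_def)
    obtain r where r: "c \<in> charts_at S r" "e \<in> charts_at M (snd (\<psi> r))" "z = snd c r"
      by (rule cdom_cases[OF C(1) E(1) z(1)])
    obtain r' where r': "c \<in> charts_at S r'" "e' \<in> charts_at M (snd (\<psi> r'))" "z = snd c r'"
      by (rule cdom_cases[OF C(1) E'(1) z(2)])
    have "r = r'"
      using inj_onD[OF atlas_inj[OF atS C(1)]] r(3) r'(3) charts_atD(2)[OF r(1)] charts_atD(2)[OF r'(1)] by auto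
    then show ?thesis using r r' by blast
  qed
  have \<theta>s: "smooth_on (snd e ` (fst e \<inter> fst e')) \<theta>"
    using M E(1) E'(1) by (auto simp: smooth_manifold_def \<theta>_def)
  have \<theta>o: "open (snd e ` (fst e \<inter> fst e'))" by (rule trans_open[OF atM E(1) E'(1)])
  have y: "y \<in> snd e ` (fst e \<inter> fst e')" using E E' by (auto simp: y_def)
  have \<theta>y: "\<theta> y = snd e' (snd (\<psi> q))" using E by (simp add: \<theta>_def y_def atlas_inv[OF atM])
  have \<theta>D: "snd (Psi c e z) \<in> snd e ` (fst e \<inter> fst e')" if "z \<in> D" for z
    using Dq[OF that] by (auto simp: Psi_eq charts_at_def)
  have N1: "Nu c e' z = (fst (Nu c e z), fd \<theta> (snd (Psi c e z)) (snd (Nu c e z)))" if z: "z \<in> D" for z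
  proof -
    obtain r where r: "c \<in> charts_at S r" "e \<in> charts_at M (snd (\<psi> r))" "e' \<in> charts_at M (snd (\<psi> r))" "z = snd c r"
      using Dq[OF z] by blast
    have rp: "r \<in> points S" by (rule q_points[OF r(1,2)])
    have "Nu c e' z = N r (wchart I e')"
      using charts_atD[OF r(1)] r(4) by (simp add: Nu_def atlas_inv[OF atS])
    also have "\<dots> = tangent_of WM (wchart I e) (\<psi> r) (Nu c e z) (wchart I e')"
      using N_eq[OF r(1,2)] r(4) by simp
    also have "\<dots> = (fst (Nu c e z), fd \<theta> (snd (Psi c e z)) (snd (Nu c e z)))"
      unfolding tangent_of_apply[OF atW wchart_at[OF r(3) rp]]
      using wL[OF r(2,3)] \<psi>_points[OF rp] Psi_eq[OF r(1,2)] r(4) by simp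
    finally show ?thesis .
  qed
  have Pd: "(Psi c e has_derivative fd (Psi c e) x) (at x)"
    using fd_has[OF Psi_diff[OF c e]] by (simp add: x_def)
  have Nd: "(Nu c e has_derivative fd (Nu c e) x) (at x)"
    using fd_has[OF Nu_diff[OF c e]] by (simp add: x_def)
  have Px: "snd (Psi c e x) = y" using Psi_eq[OF c e] by (simp add: x_def y_def)
  have "((\<lambda>z. fd \<theta> (snd (Psi c e z)) (snd (Nu c e z))) has_derivative
     (\<lambda>w. fd (\<lambda>z. fd \<theta> z (snd (Nu c e x))) y (snd (fd (Psi c e) x w)) + fd \<theta> (snd (Psi c e x)) (snd (fd (Nu c e) x w)))) (at x)"
  proof (rule has_derivative_linear_family[OF Dx _ _ has_derivative_snd[OF Nd]])
    show "linear (fd \<theta> (snd (Psi c e z)))" if "z \<in> D" for z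
      by (rule linear_fd[OF smooth_on_differentiable[OF \<theta>s \<theta>D[OF that]]])
    have "(\<lambda>z. fd \<theta> z v) differentiable (at (snd (Psi c e x)))" for v
      unfolding Px by (rule smooth_on_differentiable[OF smooth_on_fd[OF \<theta>s] y])
    from diff_chain_at[OF has_derivative_snd[OF Pd] fd_has[OF this]]
    show "((\<lambda>z. fd \<theta> (snd (Psi c e z)) v) has_derivative
      (\<lambda>w. fd (\<lambda>z. fd \<theta> z v) y (snd (fd (Psi c e) x w)))) (at x)" for v
      by (simp add: o_def Px)
  qed
  then have "((\<lambda>z. (fst (Nu c e z), fd \<theta> (snd (Psi c e z)) (snd (Nu c e z)))) has_derivative
     (\<lambda>w. (fst (fd (Nu c e) x w), fd (\<lambda>z. fd \<theta> z (snd (Nu c e x))) y (snd (fd (Psi c e) x w))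
        + fd \<theta> y (snd (fd (Nu c e) x w))))) (at x)"
    unfolding Px by (rule has_derivative_Pair[OF has_derivative_fst[OF Nd]])
  then have "(Nu c e' has_derivative
     (\<lambda>w. (fst (fd (Nu c e) x w), fd (\<lambda>z. fd \<theta> z (snd (Nu c e x))) y (snd (fd (Psi c e) x w))
        + fd \<theta> y (snd (fd (Nu c e) x w))))) (at x)"
    by (rule has_derivative_transform_within_open[OF _ Dx]) (rule N1[symmetric])
  note dN = fd_eq[OF this]
  have iso: "local_metric M g e z a b = local_metric M g e' (\<theta> z) (fd \<theta> z a) (fd \<theta> z b)"
    if z: "z \<in> snd e ` (fst e \<inter> fst e')" for z a b
  proof -
    obtain m where m: "z = snd e m" "e \<in> charts_at M m" "e' \<in> charts_at M m"
      using z E(1) E'(1) by (auto simp: charts_at_def)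
    have "\<theta> z = snd e' m" using charts_atD[OF m(2)] by (simp add: \<theta>_def m(1) atlas_inv[OF atM])
    then show ?thesis using local_metric_change[OF atM m(2,3), of g a b] by (simp add: m(1) \<theta>_def)
  qed
  have LC': "levi_civita (local_metric M g e') (\<theta> y) (fd \<theta> y a) (fd \<theta> y b)
     = fd \<theta> y (levi_civita (local_metric M g e) y a b) - fd (\<lambda>z. fd \<theta> z b) y a" for a b
  proof (rule levi_civita_change[OF wc.riemannian_chart_axioms wc'.riemannian_chart_axioms \<theta>o y _ \<theta>s _ iso])
    show "\<theta> z \<in> snd e' ` fst e'" if "z \<in> snd e ` (fst e \<inter> fst e')" for z
      using that E(1) by (auto simp: \<theta>_def atlas_inv[OF atM])
  qed auto
  have lin: "linear (fd \<theta> y)" by (rule linear_fd[OF smooth_on_differentiable[OF \<theta>s y]])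
  have P: "Psi c e x = (fst (\<psi> q), y)" "Psi c e' x = (fst (\<psi> q), \<theta> y)"
    unfolding \<theta>y x_def using Psi_eq[OF c e] Psi_eq[OF c e'] by (simp_all add: y_def)
  have "covN c e' x u = L (covN c e x u)"
    unfolding covN_def dN dP N1[OF Dx(2)] P wc.\<Gamma>_def wc'.\<Gamma>_def
    by (simp add: L_def iso[OF y, symmetric] LC' linear_add[OF lin] linear_cmul[OF lin] algebra_simps)
  then show ?thesis
    using tangent_of_change[OF atW we we', of "covN c e x u"] wL[OF e e' t]
    by (simp add: L_def y_def x_def)
qed

section \<open>The shape operator, its trace and its norm in arbitrary charts\<close>

lemma levi_civita_WM:
  assumes e: "e \<in> charts_at M (snd r)" and r: "fst r \<in> I"
  shows "levi_civita (local_metric WM gb (wchart I e)) (fst r, snd e (snd r)) = Gam e (fst r, snd e (snd r))"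
proof -
  note E = charts_atD[OF e]
  interpret wc: warped_chart "snd e ` fst e" "local_metric M g e" I f "deriv f" "deriv (deriv f)" \<epsilon>
    by (rule warped_chart[OF E(1)])
  have p: "(fst r, snd e (snd r)) \<in> I \<times> snd e ` fst e" using r E by auto
  have "levi_civita (local_metric WM gb (wchart I e)) (fst r, snd e (snd r)) = levi_civita (Gm e) (fst r, snd e (snd r))"
  proof (rule levi_civita_cong[OF wc.open_dom p])
    fix z a b assume "z \<in> I \<times> snd e ` fst e"
    then obtain m where m: "fst z \<in> I" "e \<in> charts_at M m" "snd z = snd e m" using E(1) by (auto simp: charts_at_def)
    have b: "(fst z, snd e m) = z" using m(3) by (simp add: prod_eq_iff)
    have "chart_inv (wchart I e) (fst z, snd e m) = (fst z, m)"
      using wchart_inv[OF I atM E(1) m(1), of "snd e m"] charts_atD[OF m(2)] by (simp add: atlas_inv[OF atM])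
    then have "chart_inv (wchart I e) z = (fst z, m)" unfolding b .
    then show "local_metric WM gb (wchart I e) z a b = Gm e z a b"
      using gb_eq[of e "(fst z, m)" a b, unfolded fst_conv snd_conv b] m(1,2) by (simp add: local_metric_def)
  qed
  then show ?thesis by (simp add: wc.levi_civita_G[OF p])
qed

text \<open>\<open>nabla_along\<close> uses charts chosen anew at each point; the two invariance
  lemmas replace them by fixed ones, first in the source and then in the target.\<close>

lemma nabla_eq:
  assumes c: "c \<in> charts_at S q" and e: "e \<in> charts_at M (snd (\<psi> q))"
  shows "nabla_along S WM gb \<psi> N q (tangent_of S c q u) = tangent_of WM (wchart I e) (\<psi> q) (covN c e (snd c q) u)"
proof -
  have q: "q \<in> points S" by (rule q_points[OF c e])
  define c0 where "c0 = chart_at S q"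
  have c0: "c0 \<in> charts_at S q" unfolding c0_def by (rule chart_at_S[OF q])
  obtain e0 where e0: "e0 \<in> charts_at M (snd (\<psi> q))" and w0: "chart_at WM (\<psi> q) = wchart I e0"
    by (rule wchart_at_ex[OF q])
  have "nabla_along S WM gb \<psi> N q (tangent_of S c q u)
    = tangent_of WM (wchart I e0) (\<psi> q) (covN c0 e0 (snd c0 q) (fd (snd c0 \<circ> chart_inv c) (snd c q) u))"
    using levi_civita_WM[OF e0] \<psi>_points[OF q] N_eq[OF c0 e0] charts_atD[OF c0]
    by (simp add: nabla_along_def Let_def w0 c0_def[symmetric] covN_def Nu_def[abs_def] Psi_def
        tangent_of_apply[OF atS c0] atlas_inv[OF atS])
  also have "\<dots> = tangent_of WM (wchart I e0) (\<psi> q) (covN c e0 (snd c q) u)"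
    unfolding covN_source[OF c0 c e0] ..
  also have "\<dots> = tangent_of WM (wchart I e) (\<psi> q) (covN c e (snd c q) u)"
    by (rule covN_target[OF c e e0])
  finally show ?thesis .
qed

lemma shape_operator_eq:
  assumes c: "c \<in> charts_at S q" and e: "e \<in> charts_at M (snd (\<psi> q))"
  shows "shape_operator S WM gb \<psi> N q (tangent_of S c q u) = tangent_of S c q (shp c e (snd c q) u)"
proof -
  have q: "q \<in> points S" by (rule q_points[OF c e])
  interpret hy: hypersurface_chart "cdom c e" "I \<times> snd e ` fst e" "Psi c e" "Nu c e" "Gm e" "Gam e" \<epsilon>
    by (rule hypersurface_chart[OF charts_atD(1)[OF c] charts_atD(1)[OF e]])
  have x: "snd c q \<in> cdom c e" by (rule in_cdom[OF c e])
  have cov: "covN c e (snd c q) u = - fd (Psi c e) (snd c q) (shp c e (snd c q) u)"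
    unfolding hy.d\<Psi>_shape[OF x] by (simp add: covN_def hy.covD_def)
  have nab: "(\<lambda>d. - nabla_along S WM gb \<psi> N q (tangent_of S c q u) d)
     = tangent_of WM (wchart I e) (\<psi> q) (fd (Psi c e) (snd c q) (shp c e (snd c q) u))"
    unfolding nabla_eq[OF c e] cov tangent_of_minus[OF atW wchart_at[OF e q]] by simp
  show ?thesis
    unfolding shape_operator_def nab
  proof (rule the_equality)
    show "tangent_of S c q (shp c e (snd c q) u) \<in> tangent_space S q \<and>
      pushforward S WM \<psi> q (tangent_of S c q (shp c e (snd c q) u))
        = tangent_of WM (wchart I e) (\<psi> q) (fd (Psi c e) (snd c q) (shp c e (snd c q) u))"
      using tangent_of_in[OF atS c] push_\<psi>[OF c e] by blast
    fix w assume w: "w \<in> tangent_space S q \<and> pushforward S WM \<psi> q w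
        = tangent_of WM (wchart I e) (\<psi> q) (fd (Psi c e) (snd c q) (shp c e (snd c q) u))"
    have wc: "w = tangent_of S c q (w c)" by (rule tangent_space_eq[OF atS _ c]) (use w in blast)
    have "tangent_of WM (wchart I e) (\<psi> q) (fd (Psi c e) (snd c q) (w c))
      = tangent_of WM (wchart I e) (\<psi> q) (fd (Psi c e) (snd c q) (shp c e (snd c q) u))"
      using w push_\<psi>[OF c e, of "w c"] wc by simp
    then have "fd (Psi c e) (snd c q) (w c) = fd (Psi c e) (snd c q) (shp c e (snd c q) u)"
      by (rule tangent_of_inject[OF atW wchart_at[OF e q]])
    then have "w c = shp c e (snd c q) u" by (rule hy.d\<Psi>_inj[OF x])
    then show "w = tangent_of S c q (shp c e (snd c q) u)" using wc by simp
  qed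
qed

text \<open>Changing from the chosen chart to \<open>c\<close> conjugates the operator by mutually
  inverse differentials, which leaves its trace unchanged.\<close>

lemma tangent_trace_shape:
  assumes c: "c \<in> charts_at S q" and e: "e \<in> charts_at M (snd (\<psi> q))"
  shows "tangent_trace S q (shape_operator S WM gb \<psi> N q) = ltrace (shp c e (snd c q))"
proof -
  have q: "q \<in> points S" by (rule q_points[OF c e])
  interpret hy: hypersurface_chart "cdom c e" "I \<times> snd e ` fst e" "Psi c e" "Nu c e" "Gm e" "Gam e" \<epsilon>
    by (rule hypersurface_chart[OF charts_atD(1)[OF c] charts_atD(1)[OF e]])
  have x: "snd c q \<in> cdom c e" by (rule in_cdom[OF c e])
  define c0 where "c0 = chart_at S q"
  have c0: "c0 \<in> charts_at S q" unfolding c0_def by (rule chart_at_S[OF q])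
  define K where "K = fd (snd c0 \<circ> chart_inv c) (snd c q)"
  define K' where "K' = fd (snd c \<circ> chart_inv c0) (snd c0 q)"
  have K: "linear K" and K': "linear K'"
    unfolding K_def K'_def by (rule linear_fd[OF trans_diff[OF atS]]; fact)+
  have KK: "K' (K u) = u" for u
    unfolding K_def K'_def trans_chain[OF atS c c0 c] trans_id[OF atS c] ..
  have "in_chart S c0 q (shape_operator S WM gb \<psi> N q) = (\<lambda>u. K (shp c e (snd c q) (K' u)))"
    unfolding in_chart_def
    by (simp add: tangent_of_change[OF atS c0 c, symmetric] shape_operator_eq[OF c e] tangent_of_apply[OF atS c0] K_def K'_def)
  then have "tangent_trace S q (shape_operator S WM gb \<psi> N q) = ltrace (\<lambda>u. K (shp c e (snd c q) (K' u)))"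
    by (simp add: tangent_trace_def c0_def)
  also have "\<dots> = ltrace (\<lambda>u. shp c e (snd c q) (K' (K u)))"
    using ltrace_commute[OF K linear_compose[OF K' hy.linear_shape[OF x]]] by (simp add: o_def)
  finally show ?thesis by (simp add: KK)
qed

text \<open>The adjoint of \<open>shape\<close> is \<open>shape\<close> itself, and nonnegativity
  removes the square root. The norm is used at a single point, so the chart of its definition can
  stay.\<close>

lemma hs_norm_shape:
  assumes q: "q \<in> points S" and e: "e \<in> charts_at M (snd (\<psi> q))"
  defines "c \<equiv> chart_at S q"
  shows "(hs_norm S hS q (shape_operator S WM gb \<psi> N q))\<^sup>2
    = ltrace (\<lambda>u. shp c e (snd c q) (shp c e (snd c q) u))"
proof -
  have c: "c \<in> charts_at S q" unfolding c_def by (rule chart_at_S[OF q])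
  interpret hy: hypersurface_chart "cdom c e" "I \<times> snd e ` fst e" "Psi c e" "Nu c e" "Gm e" "Gam e" \<epsilon>
    by (rule hypersurface_chart[OF charts_atD(1)[OF c] charts_atD(1)[OF e]])
  have x: "snd c q \<in> cdom c e" by (rule in_cdom[OF c e])
  have K: "in_chart S c q (shape_operator S WM gb \<psi> N q) = shp c e (snd c q)"
    unfolding in_chart_def by (simp add: shape_operator_eq[OF c e] tangent_of_self[OF atS c])
  have B: "local_metric S hS c (snd c q) = hy.h (snd c q)"
    by (intro ext) (simp add: local_hS[OF c e] hy.h_def)
  have "metric_adjoint (hy.h (snd c q)) (shp c e (snd c q)) = shp c e (snd c q)"
    unfolding metric_adjoint_def
  proof (rule the_equality)
    show "\<forall>u v. hy.h (snd c q) (shp c e (snd c q) u) v = hy.h (snd c q) u (shp c e (snd c q) v)"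
      using hy.shape_self_adjoint[OF x] by blast
    fix L assume L: "\<forall>u v. hy.h (snd c q) (shp c e (snd c q) u) v = hy.h (snd c q) u (L v)"
    show "L = shp c e (snd c q)"
    proof
      fix v
      have "hy.h (snd c q) (L v) u = hy.h (snd c q) (shp c e (snd c q) v) u" for u
        using L hy.shape_self_adjoint[OF x, of u v] hy.h_sym[OF x, of u] by simp
      then show "L v = shp c e (snd c q) v" by (rule hy.h_cancel[OF x x])
    qed
  qed
  moreover have "ltrace (\<lambda>u. shp c e (snd c q) (shp c e (snd c q) u)) \<ge> 0"
  proof (rule ltrace_square_nonneg[where B = "hy.h (snd c q)"])
    show "hy.h (snd c q) u u > 0" if "u \<noteq> 0" for u
      using hy.h_pos[OF x that] by (simp add: hy.h_def)
  qed (rule hy.bilinear_h[OF x] hy.h_sym[OF x] hy.linear_shape[OF x] hy.shape_self_adjoint[OF x])+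
  ultimately show ?thesis
    by (simp add: hs_norm_def Let_def c_def[symmetric] K B o_def)
qed

lemma mean_curvature_shape:
  assumes c: "c \<in> charts_at S q" and e: "e \<in> charts_at M (snd (\<psi> q))"
    and H: "mean_curvature \<epsilon> S WM gb \<psi> N q = H"
  shows "ltrace (shp c e (snd c q)) = \<epsilon> * real CARD('n) * H"
proof -
  have "\<epsilon> * ltrace (shp c e (snd c q)) = real CARD('n) * H"
    using H by (simp add: mean_curvature_def tangent_trace_shape[OF c e] field_simps)
  moreover have "\<epsilon> * (\<epsilon> * ltrace (shp c e (snd c q))) = ltrace (shp c e (snd c q))" using \<epsilon> by auto
  ultimately show ?thesis by (simp add: mult.assoc)
qed

lemma ln_deriv_deriv:
  assumes t: "t \<in> I"
  shows "deriv (deriv (\<lambda>s. ln (f s))) t = deriv (deriv f) t / f t - (deriv f t / f t)\<^sup>2"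
proof -
  note d = smooth_on_real_deriv[OF I f_smooth]
  have 1: "deriv (\<lambda>s. ln (f s)) s = deriv f s / f s" if "s \<in> I" for s
    by (rule DERIV_imp_deriv) (use d(1)[OF that] f_pos[OF that] in \<open>auto intro!: derivative_eq_intros\<close>)
  have "((\<lambda>s. deriv f s / f s) has_real_derivative
      (deriv (deriv f) t * f t - deriv f t * deriv f t) / (f t * f t)) (at t)"
    using DERIV_divide[OF d(2)[OF t] d(1)[OF t]] f_pos[OF t] by simp
  then have "(deriv (\<lambda>s. ln (f s)) has_real_derivative
      (deriv (deriv f) t * f t - deriv f t * deriv f t) / (f t * f t)) (at t)"
    by (rule has_field_derivative_transform_within_open[OF _ I t]) (simp add: 1)
  then show ?thesis
    using f_pos[OF t] by (simp add: DERIV_imp_deriv field_simps power2_eq_square)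
qed

lemma laplacian_support_function:
  assumes p: "p \<in> points S"
    and H: "\<And>q. q \<in> points S \<Longrightarrow> mean_curvature \<epsilon> S WM gb \<psi> N q = H"
  defines "\<eta> \<equiv> \<lambda>p. gb (\<psi> p) (conformal_field I f M (\<psi> p)) (N p)"
    and "t \<equiv> fst (\<psi> p)" and "Nt \<equiv> pushforward WM M snd (\<psi> p) (N p)"
  shows "laplacian S hS \<eta> p =
       - \<epsilon> * \<eta> p *
         (ricci M g (snd (\<psi> p)) Nt Nt
          + (real CARD('n) - 1) * deriv (deriv (\<lambda>s. ln (f s))) t
            * (1 - (gb (\<psi> p) (N p) (dt_field I M (\<psi> p)))\<^sup>2)
          + (hs_norm S hS p (shape_operator S WM gb \<psi> N p))\<^sup>2)
       - \<epsilon> * real CARD('n) * H * deriv f t"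
proof -
  \<comment> \<open>These are the charts chosen in the definitions of \<open>laplacian\<close>,
    \<open>hs_norm\<close> and \<open>ricci\<close>, so none of them needs a change of
    chart.\<close>
  define c where "c = chart_at S p"
  define e where "e = chart_at M (snd (\<psi> p))"
  have c: "c \<in> charts_at S p" unfolding c_def by (rule chart_at_S[OF p])
  have e: "e \<in> charts_at M (snd (\<psi> p))" unfolding e_def by (rule chart_at_M) (use \<psi>_points[OF p] in simp)
  note C = charts_atD[OF c] and E = charts_atD[OF e]
  interpret wc: warped_chart "snd e ` fst e" "local_metric M g e" I f "deriv f" "deriv (deriv f)" \<epsilon>
    by (rule warped_chart[OF E(1)])
  interpret hy: hypersurface_chart "cdom c e" "I \<times> snd e ` fst e" "Psi c e" "Nu c e" "Gm e" "Gam e" \<epsilon>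
    by (rule hypersurface_chart[OF C(1) E(1)])
  define x where "x = snd c p"
  define y where "y = snd e (snd (\<psi> p))"
  define b where "b = fst (Nu c e x)"
  define w where "w = snd (Nu c e x)"
  define V where "V r = (f (fst r), 0 :: real^'n)" for r :: "real \<times> (real^'n)"
  have x: "x \<in> cdom c e" unfolding x_def by (rule in_cdom[OF c e])
  have t: "t \<in> I" using \<psi>_points[OF p] by (simp add: t_def)
  have Px: "Psi c e x = (t, y)" using Psi_eq[OF c e] by (simp add: x_def t_def y_def)
  have W: "(t, y) \<in> I \<times> snd e ` fst e" using hy.\<Psi>_in[OF x] by (simp add: Px)
  then have y: "y \<in> snd e ` fst e" by simp
  have Nx: "Nu c e x = (b, w)" by (simp add: b_def w_def)
  have dV: "(V has_derivative (\<lambda>u. (deriv f (fst r) * fst u, 0))) (at r)" if "r \<in> I \<times> snd e ` fst e" for r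
    unfolding V_def
    by (intro has_derivative_Pair has_derivative_const wc.has_derivative_fst_comp wc.f1) (use that in auto)
  have \<eta>x: "(\<eta> \<circ> chart_inv c) z = Gm e (Psi c e z) (V (Psi c e z)) (Nu c e z)" if z: "z \<in> cdom c e" for z
  proof -
    obtain q where q: "c \<in> charts_at S q" "e \<in> charts_at M (snd (\<psi> q))" "z = snd c q"
      by (rule cdom_cases[OF C(1) E(1) z])
    have tq: "fst (\<psi> q) \<in> I" using \<psi>_points[OF q_points[OF q(1,2)]] by simp
    have "\<eta> q = gb (\<psi> q) (tangent_of WM (wchart I e) (\<psi> q) (f (fst (\<psi> q)), 0))
        (tangent_of WM (wchart I e) (\<psi> q) (Nu c e z))"
      using conformal_field_eq[OF I atM q(2) tq, of f] N_eq[OF q(1,2)] by (simp add: \<eta>_def q(3))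
    also have "\<dots> = Gm e (Psi c e z) (V (Psi c e z)) (Nu c e z)"
      using gb_Psi[OF q(1,2)] Psi_eq[OF q(1,2)] by (simp add: q(3) V_def)
    finally show ?thesis using charts_atD[OF q(1)] by (simp add: q(3) atlas_inv[OF atS])
  qed
  have \<eta>p: "\<eta> p = (\<eta> \<circ> chart_inv c) x" using C by (simp add: x_def atlas_inv[OF atS])
  have tr: "ltrace (shp c e z) = \<epsilon> * real CARD('n) * H" if z: "z \<in> cdom c e" for z
  proof -
    obtain q where q: "c \<in> charts_at S q" "e \<in> charts_at M (snd (\<psi> q))" "z = snd c q"
      by (rule cdom_cases[OF C(1) E(1) z])
    show ?thesis using mean_curvature_shape[OF q(1,2) H[OF q_points[OF q(1,2)]]] q(3) by simp
  qed
  \<comment> \<open>Constancy of the mean curvature enters here: the trace is constant on the open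
    set \<open>cdom c e\<close>, in one and the same chart.\<close>
  have dtr: "fd (\<lambda>z. ltrace (shp c e z)) x u = 0" for u
    using fd_cong_open[OF hy.open_\<Omega> x, of "\<lambda>z. ltrace (shp c e z)", OF tr] by simp
  have "laplacian S hS \<eta> p = local_laplacian (local_metric S hS c) (\<eta> \<circ> chart_inv c) x"
    by (simp add: laplacian_def Let_def c_def x_def)
  also have "\<dots> = local_laplacian hy.h (\<eta> \<circ> chart_inv c) x"
  proof (rule local_laplacian_cong[OF hy.open_\<Omega> x])
    fix z u v assume z: "z \<in> cdom c e"
    obtain q where q: "c \<in> charts_at S q" "e \<in> charts_at M (snd (\<psi> q))" "z = snd c q"
      by (rule cdom_cases[OF C(1) E(1) z])
    show "local_metric S hS c z u v = hy.h z u v" using local_hS[OF q(1,2)] q(3) by (simp add: hy.h_def)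
  qed simp
  also have "\<dots> = - deriv f (fst (Psi c e x)) * ltrace (shp c e x)
      - \<epsilon> * (\<eta> \<circ> chart_inv c) x * ltrace (\<lambda>v. shp c e x (shp c e x v))
      - fd (\<lambda>y. ltrace (shp c e y)) x (hy.tang x (V (Psi c e x)))
      + ric (Gam e) (Psi c e x) (V (Psi c e x)) (Nu c e x)
      - \<epsilon> * (\<eta> \<circ> chart_inv c) x * ric (Gam e) (Psi c e x) (Nu c e x) (Nu c e x)"
  proof (rule hy.laplacian_support[OF x, where \<phi> = "\<lambda>r. deriv f (fst r)"])
    show "V differentiable (at r)" if "r \<in> I \<times> snd e ` fst e" for r
      by (rule differentiableI[OF dV[OF that]])
    show "fd V r u + Gam e r u (V r) = deriv f (fst r) *\<^sub>R u" if r: "r \<in> I \<times> snd e ` fst e" for r u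
    proof -
      have "snd r \<in> snd e ` fst e" "f (fst r) \<noteq> 0" using r wc.f_ne by auto
      then show ?thesis
        unfolding fd_eq[OF dV[OF r]]
        by (simp add: wc.\<Gamma>_def V_def wc.g_lin bilinear_rzero[OF wc.LC_bil] prod_eq_iff)
    qed
    show "Gm e (Psi c e x) (curv (Gam e) (Psi c e x) u v w) w = 0" for u v w
      by (rule wc.curv_\<Gamma>_skew[OF hy.\<Psi>_in[OF x]])
  qed (rule \<eta>x)
  also have "\<dots> = - deriv f t * (\<epsilon> * real CARD('n) * H) - \<epsilon> * \<eta> p * ltrace (\<lambda>v. shp c e x (shp c e x v))
      + ric (Gam e) (t, y) (f t, 0) (b, w) - \<epsilon> * \<eta> p * ric (Gam e) (t, y) (b, w) (b, w)"
    by (simp add: tr[OF x] dtr \<eta>p Px Nx V_def)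
  finally have lap: "laplacian S hS \<eta> p = - deriv f t * (\<epsilon> * real CARD('n) * H)
      - \<epsilon> * \<eta> p * ltrace (\<lambda>v. shp c e x (shp c e x v))
      + ric (Gam e) (t, y) (f t, 0) (b, w) - \<epsilon> * \<eta> p * ric (Gam e) (t, y) (b, w) (b, w)" .
  have hs: "(hs_norm S hS p (shape_operator S WM gb \<psi> N p))\<^sup>2 = ltrace (\<lambda>v. shp c e x (shp c e x v))"
    using hs_norm_shape[OF p e] by (simp add: c_def x_def)
  have \<psi>p: "\<psi> p = (t, snd (\<psi> p))" by (simp add: t_def)
  have "Nt = tangent_of M e (snd (\<psi> p)) w"
    unfolding Nt_def N_eq[OF c e] x_def[symmetric] Nx
    using push_snd[OF I atM e t, of "(b, w)"] \<psi>p by simp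
  then have Nt: "Nt e = w" by (simp add: tangent_of_self[OF atM e])
  have ricM: "ricci M g (snd (\<psi> p)) Nt Nt = ric wc.LC y w w"
    by (simp add: ricci_def Let_def e_def[symmetric] local_ricci_eq Nt y_def)
  \<comment> \<open>\<open>V\<close> has no fibre component, so its Ricci term contains the fibre
    tensor at the zero vector.\<close>
  have ric0: "ric wc.LC y 0 w = 0"
  proof -
    have z: "fd (\<lambda>z. wc.LC z 0 w) y u = 0" for u
      using fd_cong_open[OF wc.open_U y, of "\<lambda>z. wc.LC z 0 w" "\<lambda>_. 0"]
      by (simp add: bilinear_lzero[OF wc.LC_bil])
    have "fd (\<lambda>z. wc.LC z u w) y 0 = 0" for u by (rule linear_0[OF linear_fd[OF wc.LC_diff[OF y]]])
    then have "curv wc.LC y u 0 w = 0" for u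
      unfolding curv_def z by (simp add: bilinear_lzero[OF wc.LC_bil[OF y]] bilinear_rzero[OF wc.LC_bil[OF y]])
    then show ?thesis by (simp add: ric_def ltrace_def)
  qed
  define k where "k = local_metric M g e y w w"
  have "gb (\<psi> p) (N p) (dt_field I M (\<psi> p)) = \<epsilon> * b"
  proof -
    have "dt_field I M (\<psi> p) = tangent_of WM (wchart I e) (\<psi> p) (1, 0)"
      using dt_field_eq[OF I atM e t] \<psi>p by simp
    then have "gb (\<psi> p) (N p) (dt_field I M (\<psi> p)) = Gm e (t, y) (b, w) (1, 0)"
      using gb_Psi[OF c e] N_eq[OF c e] by (simp add: x_def[symmetric] Nx Px)
    then show ?thesis by (simp add: wc.G_def wc.g_lin[OF y])
  qed
  then have \<Theta>: "(gb (\<psi> p) (N p) (dt_field I M (\<psi> p)))\<^sup>2 = b\<^sup>2"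
    using wc.eps_sq by (simp add: power2_eq_square algebra_simps)
  have \<eta>b: "\<eta> p = \<epsilon> * f t * b"
    unfolding \<eta>p \<eta>x[OF x] Px Nx by (simp add: wc.G_def V_def wc.g_lin[OF y])
  have f0: "f t \<noteq> 0" using f_pos[OF t] by simp
  have "\<epsilon> * b\<^sup>2 + (f t)\<^sup>2 * k = \<epsilon>"
    using hy.unit[OF x] unfolding Px Nx by (simp add: wc.G_def k_def power2_eq_square)
  \<comment> \<open>The unit condition expresses the fibre length of N by its dt-component b, whose
    square is that of <N, dt> = \<epsilon> b.\<close>
  then have k: "k = \<epsilon> * (1 - b\<^sup>2) / (f t)\<^sup>2" using f0 by (simp add: field_simps)
  define n where "n = real CARD('n)"
  define f1 where "f1 = deriv f t"
  define f2 where "f2 = deriv (deriv f) t"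
  have r1: "ric (Gam e) (t, y) (f t, 0) (b, w) = - (n * (f2 / f t) * (f t * b))"
    using wc.ric_\<Gamma>[OF W, of "f t" 0 b w] ric0 by (simp add: wc.g_lin[OF y] n_def f2_def)
  have r2: "ric (Gam e) (t, y) (b, w) (b, w) = - (n * (f2 / f t) * (b * b)) + ric wc.LC y w w
     - \<epsilon> * k * (f t * f2 + (n - 1) * f1\<^sup>2)"
    using wc.ric_\<Gamma>[OF W, of b w b w] by (simp add: n_def f1_def f2_def k_def)
  have e2: "\<epsilon> * k * (f t * f2 + (n - 1) * f1\<^sup>2) = (1 - b\<^sup>2) * (f2 / f t + (n - 1) * (f1 / f t)\<^sup>2)"
  proof -
    have ek: "\<epsilon> * k = (1 - b\<^sup>2) / (f t)\<^sup>2" unfolding k using wc.eps_cancel[of "(1 - b\<^sup>2) / (f t)\<^sup>2"] by simp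
    show ?thesis unfolding ek using f0 by (simp add: field_simps power2_eq_square)
  qed
  have e1: "n * (f2 / f t) * (f t * b) = \<epsilon> * \<eta> p * (n * (f2 / f t))"
    unfolding \<eta>b using wc.eps_cancel[of "f t * b * (n * (f2 / f t))"] by (simp add: mult.assoc mult.left_commute mult.commute)
  define q1 where "q1 = f1 / f t"
  define q2 where "q2 = f2 / f t"
  \<comment> \<open>Inside the braces q2 occurs n times with weight 1 - b^2 and is taken away once,
    together with (n - 1) q1^2. The coefficient of 1 - b^2 is thus (n - 1)(q2 - q1^2), and q2 - q1^2
    is the second derivative of log f.\<close>
  show ?thesis
    unfolding lap hs ricM \<Theta> ln_deriv_deriv[OF t] r1 r2 e1 e2
    unfolding n_def[symmetric] f1_def[symmetric] f2_def[symmetric] q1_def[symmetric] q2_def[symmetric]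
    by (simp add: algebra_simps power2_eq_square)
qed

end

theorem proposition3p1:
  fixes \<epsilon> H :: real
    and I :: "real set"
    and f :: "real \<Rightarrow> real"
    and M :: "('m, real^'n) manifold"
    and Q :: "('m, real^'n) chart set"
    and g :: "('m, real^'n) metric"
    and S :: "('s, real^'n) manifold"
    and \<psi> :: "'s \<Rightarrow> real \<times> 'm"
    and N :: "'s \<Rightarrow> (real \<times> 'm, real \<times> (real^'n)) tangent"
  defines "gbar \<equiv> warped_metric \<epsilon> I f M g"
  defines "A \<equiv> shape_operator S (warped I M) gbar \<psi> N"
  defines "\<eta> \<equiv> \<lambda>p. gbar (\<psi> p) (conformal_field I f M (\<psi> p)) (N p)"
  defines "h \<equiv> induced_metric S (warped I M) gbar \<psi>"
  assumes "\<epsilon> \<in> {-1, 1}"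
    and "smooth_manifold M" and "connected_space (mtop M)" and "orientation_of M Q"
    and "riemannian_metric M g"
    and "is_interval I" and "open I" and "I \<noteq> {}"
    and "smooth_on I f" and "\<forall>t\<in>I. f t > 0"
    and "riemannian_immersion S (warped I M) gbar \<psi>"
    and "unit_normal S (warped I M) gbar \<psi> N"
    and "\<forall>p\<in>points S. mean_curvature \<epsilon> S (warped I M) gbar \<psi> N p = H"
  shows "\<forall>p\<in>points S.
    (let t = fst (\<psi> p); Ntop = pushforward (warped I M) M snd (\<psi> p) (N p) in
     laplacian S h \<eta> p =
       - \<epsilon> * \<eta> p *
         (ricci M g (snd (\<psi> p)) Ntop Ntop
          + (real CARD('n) - 1) * deriv (deriv (\<lambda>s. ln (f s))) t
            * (1 - (gbar (\<psi> p) (N p) (dt_field I M (\<psi> p)))\<^sup>2)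
          + (hs_norm S h p (A p))\<^sup>2)
       - \<epsilon> * real CARD('n) * H * deriv f t)"
proof -
  interpret warped_immersion \<epsilon> I f M g S \<psi> N
    by unfold_locales (use assms in auto)
  show ?thesis
    using assms(17) laplacian_support_function unfolding Let_def h_def \<eta>_def A_def gbar_def by blast
qed

end
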